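(* Consider the redundancy-$d$ model with $K$ servers and i.i.d. copies, in which all servers implement Processor Sharing (PS), or all servers implement Random Order of Service (ROS). In either case the system is stable when $\rho<1$, where $\rho=\frac{\lambda}{\mu K}$.
   Context: Redundancy-$d$ model: there are $K$ homogeneous servers $S=\{1,\ldots,K\}$, each with capacity 1 and its own queue, and an integer $1\le d\le K$. Jobs arrive according to a Poisson process of rate $\lambda>0$. Each arriving job chooses $d$ of the $K$ servers uniformly at random and sends one copy of itself to each of them. The type of a job is the set $c\subset S$ of the $d$ chosen servers; $\mathcal C$ is the set of all types ($|\mathcal C|=\binom{K}{d}$) and $\mathcal C(s)=\{c\in\mathcal C: s\in c\}$. As soon as one copy of a job completes service, all its other copies are immediately removed and the job departs. $N_c(t)$ is the number of type-$c$ jobs at time $t$, $\vec N(t)=(N_c(t),c\in\mathcal C)$, and $M_s(t)=\sum_{c\in\mathcal C(s)}N_c(t)$ is the number of copies in server $s$. I.i.d. copies: the service requirements of the $d$ copies of a job are i.i.d. exponential with mean $1/\mu$ (independent across jobs). Policies: under PS each copy in server $s$ receives service at rate $1/M_s(t)$. Under ROS, a server that becomes idle chooses uniformly at random a new copy from its queue and serves it until the copy completes or is removed. Stability: the Markovian descriptor of the system is $(N_c(t),A_c(t))_{c\in\mathcal C}$, where $A_c(t)$ records the attained service of each copy of each type-$c$ job. The system is called stable when the process $\vec N(t)$ is positive recurrent, and unstable when it is transient. The total load is $\rho:=\frac{\lambda}{\mu K}$. *)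

theory Defs
  imports "HOL-Probability.Probability"
begin

datatype policy = PS | ROS

definition job_types :: "nat \<Rightarrow> nat \<Rightarrow> nat set set" where
  "job_types K d = {c. c \<subseteq> {1..K} \<and> card c = d}"

text \<open>
  A state of the descriptor at time 0: the types of the jobs present (job \<open>j\<close> is the \<open>j\<close>-th entry),
  the attained service \<open>start_attained x j s\<close> of the copy of job \<open>j\<close> in server \<open>s\<close>, and, for
  \<open>ROS\<close> only, the job that each server is serving; \<open>PS\<close> ignores the last field.
\<close>

record descriptor =
  start_types :: "nat set list"
  start_attained :: "nat \<Rightarrow> nat \<Rightarrow> real"
  start_serving :: "nat \<Rightarrow> nat option"

abbreviation start_number :: "descriptor \<Rightarrow> nat" where
  "start_number x \<equiv> length (start_types x)"

definition start_queue :: "descriptor \<Rightarrow> nat \<Rightarrow> nat set" where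
  "start_queue x s = {j. j < start_number x \<and> s \<in> start_types x ! j}"

definition descriptors :: "policy \<Rightarrow> nat \<Rightarrow> nat \<Rightarrow> descriptor set" where
  "descriptors pol K d = {x.
     set (start_types x) \<subseteq> job_types K d \<and>
     (\<forall>j s. 0 \<le> start_attained x j s) \<and>
     (pol = ROS \<longrightarrow>
       (\<forall>s\<in>{1..K}.
          (case start_serving x s of
             None \<Rightarrow> start_queue x s = {}
           | Some j \<Rightarrow> j \<in> start_queue x s) \<and>
          (\<forall>j\<in>start_queue x s. start_serving x s \<noteq> Some j \<longrightarrow> start_attained x j s = 0)))}"

text \<open>
  The random input attached to job \<open>j\<close>: the interarrival time that precedes it, its type, the
  service requirement of its copy in each server, and one uniform variable per server, which
  that server uses to choose its next copy if job \<open>j\<close> departs while the server is serving it.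
  Every server gets a requirement; only those of the servers in the type of the job are used.
  Jobs \<open>j < start_number x\<close> are present at time 0: their interarrival time and random type are
  not used, and the requirement of each of their copies is distributed as an exponential variable
  conditioned to exceed the service already attained.
\<close>

type_synonym mark = "real \<times> nat set \<times> (nat \<Rightarrow> real) \<times> (nat \<Rightarrow> real)"

definition interarrival :: "mark \<Rightarrow> real" where
  "interarrival m = fst m"

definition drawn_type :: "mark \<Rightarrow> nat set" where
  "drawn_type m = fst (snd m)"

definition requirement :: "mark \<Rightarrow> nat \<Rightarrow> real" where
  "requirement m = fst (snd (snd m))"

definition choice_var :: "mark \<Rightarrow> nat \<Rightarrow> real" where
  "choice_var m = snd (snd (snd m))"

definition exp_law :: "real \<Rightarrow> real measure" where
  "exp_law r = density lborel (exponential_density r)"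

definition requirement_law :: "real \<Rightarrow> descriptor \<Rightarrow> nat \<Rightarrow> nat \<Rightarrow> real measure" where
  "requirement_law mu x j s =
     (if j < start_number x then uniform_measure (exp_law mu) {start_attained x j s<..}
      else exp_law mu)"

definition mark_law :: "nat \<Rightarrow> nat \<Rightarrow> real \<Rightarrow> real \<Rightarrow> descriptor \<Rightarrow> nat \<Rightarrow> mark measure" where
  "mark_law K d lam mu x j =
     exp_law lam \<Otimes>\<^sub>M (uniform_count_measure (job_types K d) \<Otimes>\<^sub>M
       ((\<Pi>\<^sub>M s\<in>UNIV. requirement_law mu x j s) \<Otimes>\<^sub>M
        (\<Pi>\<^sub>M s\<in>UNIV. uniform_measure lborel {0..<1})))"

definition input_law ::
  "nat \<Rightarrow> nat \<Rightarrow> real \<Rightarrow> real \<Rightarrow> descriptor \<Rightarrow> (nat \<Rightarrow> mark) measure" where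
  "input_law K d lam mu x = (\<Pi>\<^sub>M j\<in>UNIV. mark_law K d lam mu x j)"

definition job_type :: "descriptor \<Rightarrow> (nat \<Rightarrow> mark) \<Rightarrow> nat \<Rightarrow> nat set" where
  "job_type x \<omega> j =
     (if j < start_number x then start_types x ! j else drawn_type (\<omega> j))"

definition arrival_time :: "descriptor \<Rightarrow> (nat \<Rightarrow> mark) \<Rightarrow> nat \<Rightarrow> real" where
  "arrival_time x \<omega> j = (\<Sum>i=start_number x..j. interarrival (\<omega> i))"

text \<open>
  The state just after an arrival or departure epoch. \<open>next_job\<close> is the index of the next job to
  arrive; \<open>present\<close> lists the jobs in the system.
\<close>

record state =
  clock :: real
  next_job :: nat
  present :: "nat list"
  attained :: "nat \<Rightarrow> nat \<Rightarrow> real"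
  serving :: "nat \<Rightarrow> nat option"

definition initial_state :: "descriptor \<Rightarrow> state" where
  "initial_state x =
     \<lparr>clock = 0, next_job = start_number x, present = [0..<start_number x],
      attained = start_attained x, serving = start_serving x\<rparr>"

context
  fixes pol :: policy and x :: descriptor and \<omega> :: "nat \<Rightarrow> mark"
begin

definition queue :: "nat list \<Rightarrow> nat \<Rightarrow> nat list" where
  "queue js s = filter (\<lambda>j. s \<in> job_type x \<omega> j) js"

definition speed :: "state \<Rightarrow> nat \<Rightarrow> nat \<Rightarrow> real" where
  "speed \<sigma> j s =
     (if j \<in> set (present \<sigma>) \<and> s \<in> job_type x \<omega> j then
        (case pol of
           PS \<Rightarrow> 1 / real (length (queue (present \<sigma>) s))
         | ROS \<Rightarrow> (if serving \<sigma> s = Some j then 1 else 0))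
      else 0)"

definition copies_in_service :: "state \<Rightarrow> (nat \<times> nat) set" where
  "copies_in_service \<sigma> =
     {(j, s). j \<in> set (present \<sigma>) \<and> s \<in> job_type x \<omega> j \<and> 0 < speed \<sigma> j s}"

text \<open>The time at which a copy would complete if no other event occurred first.\<close>

definition completion_time :: "state \<Rightarrow> nat \<times> nat \<Rightarrow> real" where
  "completion_time \<sigma> = (\<lambda>(j, s).
     clock \<sigma> + (requirement (\<omega> j) s - attained \<sigma> j s) / speed \<sigma> j s)"

definition next_epoch :: "state \<Rightarrow> real" where
  "next_epoch \<sigma> =
     Min (insert (arrival_time x \<omega> (next_job \<sigma>)) (completion_time \<sigma> ` copies_in_service \<sigma>))"

definition completed_jobs :: "state \<Rightarrow> nat set" where
  "completed_jobs \<sigma> =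
     {j. \<exists>s. (j, s) \<in> copies_in_service \<sigma> \<and> completion_time \<sigma> (j, s) = next_epoch \<sigma>}"

text \<open>For \<open>u\<close> uniform on \<open>[0, 1)\<close> this is a uniformly random element of \<open>q\<close>.\<close>

definition choose_from :: "real \<Rightarrow> nat list \<Rightarrow> nat option" where
  "choose_from u q = (if q = [] then None else Some (q ! nat \<lfloor>u * real (length q)\<rfloor>))"

definition serve :: "state \<Rightarrow> state" where
  "serve \<sigma> = \<sigma>\<lparr>clock := next_epoch \<sigma>,
     attained := (\<lambda>j s. attained \<sigma> j s + speed \<sigma> j s * (next_epoch \<sigma> - clock \<sigma>))\<rparr>"

definition arrive :: "state \<Rightarrow> state" where
  "arrive \<sigma> = (let k = next_job \<sigma> in
     \<sigma>\<lparr>next_job := Suc k,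
       present := present \<sigma> @ [k],
       attained := (attained \<sigma>)(k := (\<lambda>s. 0)),
       serving := (\<lambda>s. if s \<in> job_type x \<omega> k \<and> serving \<sigma> s = None then Some k
                       else serving \<sigma> s)\<rparr>)"

definition depart :: "nat set \<Rightarrow> state \<Rightarrow> state" where
  "depart D \<sigma> = (let js = filter (\<lambda>j. j \<notin> D) (present \<sigma>) in
     \<sigma>\<lparr>present := js,
       serving := (\<lambda>s. case serving \<sigma> s of
           None \<Rightarrow> None
         | Some j \<Rightarrow> if j \<in> D then choose_from (choice_var (\<omega> j) s) (queue js s) else Some j)\<rparr>)"

text \<open>
  An arrival and a completion coincide with probability 0; then the arrival is handled first and
  the completion by the next step, at the same clock value.
\<close>

definition step :: "state \<Rightarrow> state" where
  "step \<sigma> =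
     (if next_epoch \<sigma> = arrival_time x \<omega> (next_job \<sigma>) then arrive (serve \<sigma>)
      else depart (completed_jobs \<sigma>) (serve \<sigma>))"

definition epoch_state :: "nat \<Rightarrow> state" where
  "epoch_state i = (step ^^ i) (initial_state x)"

definition state_at :: "real \<Rightarrow> state" where
  "state_at t = epoch_state (LEAST i. t < clock (epoch_state (Suc i)))"

definition job_counts :: "real \<Rightarrow> nat set \<Rightarrow> nat" where
  "job_counts t c = card {j \<in> set (present (state_at t)). job_type x \<omega> j = c}"

end

text \<open>The first time a path is back in its initial state after having left it.\<close>

definition return_time :: "(real \<Rightarrow> 'a) \<Rightarrow> ennreal" where
  "return_time Y = (INF t\<in>{t. \<exists>u. 0 \<le> u \<and> u < t \<and> Y u \<noteq> Y 0 \<and> Y t = Y 0}. ennreal t)"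

text \<open>
  Positive recurrence of a process \<open>Y\<close> that is a function of a Markov process: \<open>Y x\<close> under
  \<open>P x\<close> is the process when the Markov process starts in \<open>x\<close>. Whatever the starting state \<open>x\<close>,
  the mean return time of \<open>Y\<close> to its initial value is finite.
\<close>

definition positive_recurrent ::
  "'x set \<Rightarrow> ('x \<Rightarrow> 'w measure) \<Rightarrow> ('x \<Rightarrow> 'w \<Rightarrow> real \<Rightarrow> 'a) \<Rightarrow> bool" where
  "positive_recurrent X P Y \<longleftrightarrow>
     (\<forall>x\<in>X. (\<lambda>\<omega>. return_time (Y x \<omega>)) \<in> borel_measurable (P x) \<and>
            (\<integral>\<^sup>+ \<omega>. return_time (Y x \<omega>) \<partial>P x) < \<infinity>)"

definition system_stable :: "policy \<Rightarrow> nat \<Rightarrow> nat \<Rightarrow> real \<Rightarrow> real \<Rightarrow> bool" where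
  "system_stable pol K d lam mu \<longleftrightarrow>
     positive_recurrent (descriptors pol K d) (input_law K d lam mu) (job_counts pol)"

definition total_load :: "nat \<Rightarrow> real \<Rightarrow> real \<Rightarrow> real" where
  "total_load K lam mu = lam / (mu * real K)"

end

theory Submission
  imports Defs
begin

text \<open>
  Why the system is stable. Copies have exponential requirements, so the residual requirements of
  the copies in progress are at every epoch independent exponential variables again, whatever the
  past. The population together with the jobs in service is therefore a Markov jump chain: in a
  configuration the clock of the next arrival races against the clocks of the copies in service.
  Its stability is a Foster-Lyapunov argument with a quadratic function.

  Let \<open>W\<^sub>s\<close> be the number of copies in server \<open>s\<close> that belong to waiting jobs, and
  \<open>U = \<Sum>\<^sub>s W\<^sub>s\<^sup>2\<close>. Under \<open>PS\<close> every job present counts as waiting; under \<open>ROS\<close> a job stops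
  waiting when a server first starts one of its copies. With this convention both policies look
  alike: while server \<open>s\<close> is busy, it removes at rate \<open>mu\<close> a job that is uniform among those it
  holds, up to at most \<open>K\<close> jobs that are in service elsewhere. Removing a job of type \<open>c\<close> lowers
  \<open>U\<close> by about \<open>2 \<Sum>\<^sub>l W\<^sub>l\<close>, the sum over \<open>l \<in> c\<close>. Hence, up to a bounded error, departures lower
  \<open>U\<close> at rate \<open>2 mu \<Sum>\<^sub>i (\<Sum>\<^sub>l W\<^sub>l) (\<Sum>\<^sub>s 1 / W\<^sub>s)\<close>, where \<open>i\<close> runs over the waiting jobs and \<open>l\<close>, \<open>s\<close>
  over the type of \<open>i\<close>. By the Cauchy-Schwarz inequality each term is at least \<open>d\<^sup>2\<close>, which gives
  \<open>2 mu d\<^sup>2\<close> times the number of waiting jobs (\<open>total_gain\<close>). Arrivals raise \<open>U\<close> at rate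
  \<open>2 (lam / K) d\<^sup>2\<close> times the same number, plus a constant (\<open>energy_arrival\<close>). So the drift is
  negative outside a set of bounded populations as soon as \<open>lam < mu K\<close> (\<open>drift\<close>).

  From a bounded population, the chance to empty the system and then to rebuild the initial
  population by arrivals is bounded below (\<open>reach_uniform\<close>). Together with the drift this bounds the
  expected number of events, and the expected time, until the population is again the initial one
  (\<open>foster\<close>, \<open>hitting_bound\<close>).

  What remains is to connect this chain with the event-driven model, in which all requirements are
  drawn in advance. The coupling \<open>linked\<close> rewrites the model in terms of residuals, and
  \<open>distr_strip\<close> shows that these have the law \<open>fresh_law\<close> at time 0. The Markov property
  (\<open>markov_property\<close>) is proved directly on the product space of the input, by redrawing one
  coordinate at a time (\<open>race\<close>, \<open>decouple_outcome\<close>). Measurability of the return time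
  holds because every path, exceptional ones included, is right-constant.
\<close>

section \<open>Exponential laws and resampling\<close>

lemma sets_exp_law [measurable_cong]: "sets (exp_law h) = sets borel"
  by (simp add: exp_law_def)

lemma space_exp_law [simp]: "space (exp_law h) = UNIV"
  by (simp add: exp_law_def)

lemma prob_space_exp_law: "0 < h \<Longrightarrow> prob_space (exp_law h)"
  unfolding exp_law_def by (rule prob_space_exponential_density)

lemma nn_integral_exp_law:
  assumes [measurable]: "G \<in> borel_measurable borel"
  shows "(\<integral>\<^sup>+y. G y \<partial>exp_law h) = (\<integral>\<^sup>+y. ennreal (exponential_density h y) * G y \<partial>lborel)"
  unfolding exp_law_def by (rule nn_integral_density) measurable

text \<open>
  Shifting the density of \<open>exp_law h\<close> by \<open>c\<close> only multiplies it by the constant \<open>exp (- h * c)\<close>.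
\<close>

lemma exp_law_memoryless:
  assumes h: "0 < h" and c: "0 \<le> c" and [measurable]: "G \<in> borel_measurable borel"
  shows "(\<integral>\<^sup>+y. (if c < y then G (y - c) else 0) \<partial>exp_law h) =
    ennreal (exp (- h * c)) * (\<integral>\<^sup>+y. G y \<partial>exp_law h)"
proof -
  have "(\<integral>\<^sup>+y. (if c < y then G (y - c) else 0) \<partial>exp_law h) =
    (\<integral>\<^sup>+y. ennreal (exponential_density h y) * (if c < y then G (y - c) else 0) \<partial>lborel)"
    by (subst nn_integral_exp_law) auto
  also have "\<dots> = (\<integral>\<^sup>+x. ennreal (exponential_density h (c + x)) * (if 0 < x then G x else 0) \<partial>lborel)"
    by (subst nn_integral_real_affine[where c=1 and t=c]) (auto intro!: nn_integral_cong)
  also have "\<dots> = (\<integral>\<^sup>+x. ennreal (exp (- h * c)) * (ennreal (exponential_density h x) * G x) \<partial>lborel)"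
  proof (rule nn_integral_cong_AE)
    have "AE x in lborel. x \<noteq> (0::real)" by (rule AE_lborel_singleton)
    then show "AE x in lborel. ennreal (exponential_density h (c + x)) * (if 0 < x then G x else 0) =
       ennreal (exp (- h * c)) * (ennreal (exponential_density h x) * G x)"
    proof eventually_elim
      case (elim x)
      have "exponential_density h (c + x) = exp (- h * c) * exponential_density h x" if "0 < x"
        using that c by (simp add: exponential_density_def exp_add [symmetric] algebra_simps)
      moreover have "exponential_density h x = 0" if "x < 0"
        using that by (simp add: exponential_density_def)
      ultimately show ?case
        using elim c h by (cases "0 < x")
          (auto simp: ennreal_mult' exponential_density_nonneg mult.assoc)
    qed
  qed
  also have "\<dots> = ennreal (exp (- h * c)) * (\<integral>\<^sup>+y. G y \<partial>exp_law h)"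
    by (simp add: nn_integral_cmult nn_integral_exp_law)
  finally show ?thesis .
qed

text \<open>
  With \<open>exp (- y * b)\<close> read as the probability that competing clocks of total rate \<open>b\<close> are silent
  up to \<open>y\<close>, this is the probability that a clock of rate \<open>h\<close> rings first.
\<close>

lemma nn_integral_exp_law_exp:
  assumes h: "0 < h" and b: "0 \<le> b"
  shows "(\<integral>\<^sup>+y. ennreal (exp (- y * b)) \<partial>exp_law h) = ennreal (h / (h + b))"
proof -
  have hb: "0 < h + b" using h b by simp
  have eq: "exponential_density h y * exp (- y * b) = h / (h + b) * exponential_density (h + b) y" for y
    using hb by (auto simp: exponential_density_def exp_add [symmetric] field_simps)
  have "(\<integral>\<^sup>+y. ennreal (exp (- y * b)) \<partial>exp_law h) =
      (\<integral>\<^sup>+y. ennreal (exponential_density h y * exp (- y * b)) \<partial>lborel)"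
    using h by (subst nn_integral_exp_law) (auto simp: ennreal_mult' exponential_density_nonneg)
  also have "\<dots> = (\<integral>\<^sup>+y. ennreal (h / (h + b)) * ennreal (exponential_density (h + b) y) \<partial>lborel)"
    unfolding eq using hb h b
    by (intro nn_integral_cong ennreal_mult) (auto intro!: exponential_density_nonneg)
  also have "\<dots> = ennreal (h / (h + b)) * emeasure (exp_law (h + b)) (space (exp_law (h + b)))"
    by (subst nn_integral_cmult) (auto simp: exp_law_def emeasure_density)
  also have "\<dots> = ennreal (h / (h + b))"
    using prob_space.emeasure_space_1[OF prob_space_exp_law[OF hb]] by simp
  finally show ?thesis .
qed

lemma AE_exp_law_nonneg: "AE y in exp_law h. 0 \<le> y"
  unfolding exp_law_def by (subst AE_density) (auto simp: exponential_density_def)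

lemma nn_integral_exp_law_mean:
  assumes h: "0 < h"
  shows "(\<integral>\<^sup>+y. ennreal y \<partial>exp_law h) = ennreal (1 / h)"
  using nn_integral_erlang_ith_moment[OF h, of 0 1] h
  by (simp add: nn_integral_exp_law ennreal_mult' exponential_density_nonneg)

text \<open>
  The link between \<open>requirement_law\<close>, which conditions on the service attained at time 0, and
  residuals with an unconditioned exponential law.
\<close>

lemma distr_residual_exp_law:
  assumes h: "0 < h" and a: "0 \<le> a"
  shows "distr (uniform_measure (exp_law h) {a<..}) borel (\<lambda>y. y - a) = exp_law h" (is "?L = _")
proof (rule measure_eqI)
  show "sets ?L = sets (exp_law h)" by (simp add: sets_exp_law)
  fix A assume "A \<in> sets ?L"
  then have A [measurable]: "A \<in> sets borel" by simp
  have tail: "emeasure (exp_law h) {a<..} = ennreal (exp (- h * a))"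
  proof -
    have "emeasure (exp_law h) {a<..} = (\<integral>\<^sup>+y. indicator {a<..} y \<partial>exp_law h)"
      by (simp add: sets_exp_law)
    also have "\<dots> = (\<integral>\<^sup>+y. (if a < y then 1 else 0) \<partial>exp_law h)"
      by (rule nn_integral_cong) (simp add: indicator_def)
    also have "\<dots> = ennreal (exp (- h * a))"
      using exp_law_memoryless[OF h a, of "\<lambda>_. 1"] prob_space.emeasure_space_1[OF prob_space_exp_law[OF h]]
      by simp
    finally show ?thesis .
  qed
  have pre: "(\<lambda>y. y - a) -` A \<in> sets borel"
    using measurable_sets[of "\<lambda>y. y - a" borel borel A] A by simp
  have "emeasure ?L A = emeasure (uniform_measure (exp_law h) {a<..}) ((\<lambda>y. y - a) -` A)"
    using A by (subst emeasure_distr) (simp_all add: sets_exp_law cong: measurable_cong_sets)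
  also have "\<dots> = emeasure (exp_law h) ({a<..} \<inter> (\<lambda>y. y - a) -` A) / emeasure (exp_law h) {a<..}"
    using pre by (subst emeasure_uniform_measure) (simp_all add: sets_exp_law)
  also have "emeasure (exp_law h) ({a<..} \<inter> (\<lambda>y. y - a) -` A) =
      (\<integral>\<^sup>+y. indicator ({a<..} \<inter> (\<lambda>y. y - a) -` A) y \<partial>exp_law h)"
    using pre by (subst nn_integral_indicator) (simp_all add: sets_exp_law)
  also have "\<dots> = (\<integral>\<^sup>+y. (if a < y then indicator A (y - a) else 0) \<partial>exp_law h)"
    by (rule nn_integral_cong) (simp add: indicator_def)
  also have "\<dots> = ennreal (exp (- h * a)) * emeasure (exp_law h) A"
    by (subst exp_law_memoryless[OF h a]) (auto simp: sets_exp_law)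
  finally have *: "emeasure ?L A = ennreal (exp (- h * a)) * emeasure (exp_law h) A / ennreal (exp (- h * a))"
    unfolding tail .
  show "emeasure ?L A = emeasure (exp_law h) A"
    unfolding * by (subst mult.commute) (simp add: ennreal_mult_divide_eq)
qed

text \<open>
  A coordinate of a product measure may be redrawn independently of all others. Every use of
  independence below goes through this identity.
\<close>

lemma nn_integral_PiM_resample:
  assumes M: "\<And>i. prob_space (M i)" and [measurable]: "F \<in> borel_measurable (PiM UNIV M)"
  shows "(\<integral>\<^sup>+w. F w \<partial>PiM UNIV M) = (\<integral>\<^sup>+y. (\<integral>\<^sup>+w. F (w(i := y)) \<partial>PiM UNIV M) \<partial>M i)"
proof -
  interpret prob_space "M k" for k by (rule M)
  interpret P: prob_space "PiM UNIV M" by (rule prob_space_PiM) (rule M)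
  interpret Q: pair_sigma_finite "M i" "PiM UNIV M" ..
  have upd [measurable]: "(\<lambda>(y, w). w(i := y)) \<in> M i \<Otimes>\<^sub>M PiM UNIV M \<rightarrow>\<^sub>M PiM UNIV M"
    using measurable_fun_upd[of UNIV UNIV i "\<lambda>x. snd x" "M i \<Otimes>\<^sub>M PiM UNIV M" M "\<lambda>x. fst x"]
    by (simp add: case_prod_beta)
  have "PiM UNIV M = distr (M i \<Otimes>\<^sub>M PiM UNIV M) (PiM UNIV M) (\<lambda>(y, w). w(i := y))"
    using distr_pair_PiM_eq_PiM[of UNIV M i] M by simp
  then have "(\<integral>\<^sup>+w. F w \<partial>PiM UNIV M) =
      (\<integral>\<^sup>+w. F w \<partial>distr (M i \<Otimes>\<^sub>M PiM UNIV M) (PiM UNIV M) (\<lambda>(y, w). w(i := y)))"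
    by simp
  also have "\<dots> = (\<integral>\<^sup>+p. F ((\<lambda>(y, w). w(i := y)) p) \<partial>(M i \<Otimes>\<^sub>M PiM UNIV M))"
    by (subst nn_integral_distr) auto
  also have "\<dots> = (\<integral>\<^sup>+y. (\<integral>\<^sup>+w. F (w(i := y)) \<partial>PiM UNIV M) \<partial>M i)"
    by (subst P.nn_integral_fst [symmetric]) auto
  finally show ?thesis .
qed

lemma distr_PiM_componentwise:
  assumes M: "\<And>i. prob_space (M i)" and N: "\<And>i. distr (M i) (N i) (f i) = N i"
    and f [measurable]: "\<And>i. f i \<in> M i \<rightarrow>\<^sub>M N i"
  shows "distr (PiM UNIV M) (PiM UNIV N) (\<lambda>w i. f i (w i)) = PiM UNIV N"
proof -
  have PN: "prob_space (N i)" for i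
    using prob_space.prob_space_distr[OF M f, of i] N by simp
  have fm [measurable]: "(\<lambda>w i. f i (w i)) \<in> PiM UNIV M \<rightarrow>\<^sub>M PiM UNIV N"
    by (rule measurable_PiM_single') (auto simp: space_PiM PiE_iff dest: measurable_space[OF f])
  interpret P: prob_space "PiM UNIV M" by (rule prob_space_PiM) (rule M)
  interpret D: prob_space "distr (PiM UNIV M) (PiM UNIV N) (\<lambda>w i. f i (w i))"
    by (rule P.prob_space_distr) (rule fm)
  show ?thesis
  proof (rule measure_eqI_PiM_infinite)
    fix A J assume J: "finite J" "J \<subseteq> UNIV" and A: "\<And>i. i \<in> J \<Longrightarrow> A i \<in> sets (N i)"
    have pre: "f i -` A i \<inter> space (M i) \<in> sets (M i)" if "i \<in> J" for i
      using A[OF that] by measurable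
    have "emeasure (distr (PiM UNIV M) (PiM UNIV N) (\<lambda>w i. f i (w i))) (prod_emb UNIV N J (Pi\<^sub>E J A)) =
      emeasure (PiM UNIV M) ((\<lambda>w i. f i (w i)) -` prod_emb UNIV N J (Pi\<^sub>E J A) \<inter> space (PiM UNIV M))"
      using J A by (subst emeasure_distr) auto
    also have "(\<lambda>w i. f i (w i)) -` prod_emb UNIV N J (Pi\<^sub>E J A) \<inter> space (PiM UNIV M) =
        prod_emb UNIV M J (Pi\<^sub>E J (\<lambda>i. f i -` A i \<inter> space (M i)))"
      using measurable_space[OF f] by (auto simp: prod_emb_def space_PiM PiE_iff)
    also have "emeasure (PiM UNIV M) \<dots> = (\<Prod>i\<in>J. emeasure (M i) (f i -` A i \<inter> space (M i)))"
      using J pre M by (intro emeasure_PiM_emb) auto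
    also have "\<dots> = (\<Prod>i\<in>J. emeasure (N i) (A i))"
    proof (rule prod.cong)
      fix i assume "i \<in> J"
      then have "emeasure (distr (M i) (N i) (f i)) (A i) = emeasure (M i) (f i -` A i \<inter> space (M i))"
        using A by (subst emeasure_distr) auto
      then show "emeasure (M i) (f i -` A i \<inter> space (M i)) = emeasure (N i) (A i)" by (simp add: N)
    qed simp
    also have "\<dots> = emeasure (PiM UNIV N) (prod_emb UNIV N J (Pi\<^sub>E J A))"
      using J A PN by (intro emeasure_PiM_emb [symmetric]) auto
    finally show "emeasure (distr (PiM UNIV M) (PiM UNIV N) (\<lambda>w i. f i (w i))) (prod_emb UNIV N J (Pi\<^sub>E J A)) =
       emeasure (PiM UNIV N) (prod_emb UNIV N J (Pi\<^sub>E J A))" .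
  qed (auto intro: D.finite_measure_axioms)
qed

section \<open>Return times of right-constant paths\<close>

text \<open>
  The path keeps each value for a positive time, as if its values carried the discrete topology. The
  paths of the model have this property for every input, even if their epochs are out of order or
  accumulate (\<open>right_constant_chain\<close>).
\<close>

definition right_constant :: "(real \<Rightarrow> 'a) \<Rightarrow> bool" where
  "right_constant Y \<longleftrightarrow> (\<forall>t. \<exists>e>0. \<forall>t'. t \<le> t' \<and> t' < t + e \<longrightarrow> Y t' = Y t)"

text \<open>
  Both times in the definition of a return can be moved a little to the right without changing the
  values of the path, hence to rational times. The infimum becomes a countable one, which makes the
  return time measurable although it is defined by uncountably many conditions.
\<close>

lemma return_time_rational:
  assumes rc: "right_constant Y"
  shows "return_time Y = (INF r\<in>\<rat>. if \<exists>q\<in>\<rat>. 0 \<le> q \<and> q < r \<and> Y q \<noteq> Y 0 \<and> Y r = Y 0 then ennreal r else \<top>)"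
    (is "_ = ?I")
proof (rule antisym)
  show "return_time Y \<le> ?I"
  proof (rule INF_greatest)
    fix r :: real assume "r \<in> \<rat>"
    show "return_time Y \<le> (if \<exists>q\<in>\<rat>. 0 \<le> q \<and> q < r \<and> Y q \<noteq> Y 0 \<and> Y r = Y 0 then ennreal r else \<top>)"
    proof (cases "\<exists>q\<in>\<rat>. 0 \<le> q \<and> q < r \<and> Y q \<noteq> Y 0 \<and> Y r = Y 0")
      case True
      then have "return_time Y \<le> ennreal r" unfolding return_time_def by (intro INF_lower) blast
      then show ?thesis using True by simp
    next
      case False
      show ?thesis unfolding if_not_P[OF False] by simp
    qed
  qed
  show "?I \<le> return_time Y"
    unfolding return_time_def
  proof (rule INF_greatest)
    fix t assume "t \<in> {t. \<exists>u. 0 \<le> u \<and> u < t \<and> Y u \<noteq> Y 0 \<and> Y t = Y 0}"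
    then obtain u where u: "0 \<le> u" "u < t" "Y u \<noteq> Y 0" "Y t = Y 0" by blast
    have rc': "\<exists>e>0. \<forall>t'. v \<le> t' \<and> t' < v + e \<longrightarrow> Y t' = Y v" for v
      by (rule rc[unfolded right_constant_def, THEN spec])
    obtain eu where eu: "0 < eu" "\<forall>t'. u \<le> t' \<and> t' < u + eu \<longrightarrow> Y t' = Y u"
      using rc'[of u] by (elim exE conjE)
    obtain et where et: "0 < et" "\<forall>t'. t \<le> t' \<and> t' < t + et \<longrightarrow> Y t' = Y t"
      using rc'[of t] by (elim exE conjE)
    show "?I \<le> ennreal t"
    proof (rule ennreal_le_epsilon)
      fix e :: real assume e: "0 < e"
      have "u < min t (u + eu)" using u(2) eu(1) by simp
      then obtain q where q: "q \<in> \<rat>" "u < q" "q < min t (u + eu)" using Rats_dense_in_real by blast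
      have "t < t + min et e" using et(1) e by simp
      then obtain r where r: "r \<in> \<rat>" "t < r" "r < t + min et e" using Rats_dense_in_real by blast
      have "Y q \<noteq> Y 0" using eu(2)[THEN spec, of q] q(2,3) u(3) by simp
      moreover have "Y r = Y 0" using et(2)[THEN spec, of r] r(2,3) u(4) by simp
      ultimately have cond: "\<exists>q\<in>\<rat>. 0 \<le> q \<and> q < r \<and> Y q \<noteq> Y 0 \<and> Y r = Y 0"
        using q r(2) u(1) by (intro bexI[of _ q]) auto
      have "?I \<le> (if \<exists>q\<in>\<rat>. 0 \<le> q \<and> q < r \<and> Y q \<noteq> Y 0 \<and> Y r = Y 0 then ennreal r else \<top>)"
        by (rule INF_lower[OF r(1)])
      also have "\<dots> = ennreal r" using cond by simp
      also have "\<dots> \<le> ennreal (t + e)" using r by (intro ennreal_leI) simp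
      also have "\<dots> = ennreal t + ennreal e" using u(1,2) e by (intro ennreal_plus) auto
      finally show "?I \<le> ennreal t + ennreal e" .
    qed
  qed
qed

lemma measurable_return_time:
  assumes rc: "\<And>w. w \<in> space M \<Longrightarrow> right_constant (Y w)"
    and pred: "\<And>t. Measurable.pred M (\<lambda>w. Y w t = Y w 0)"
  shows "(\<lambda>w. return_time (Y w)) \<in> borel_measurable M"
proof -
  have c: "countable (\<rat> :: real set)" by (rule countable_rat)
  have p: "Measurable.pred M (\<lambda>w. 0 \<le> q \<and> q < r \<and> Y w q \<noteq> Y w 0 \<and> Y w r = Y w 0)" for q r :: real
    using pred[of q] pred[of r]
    by (cases "0 \<le> q \<and> q < r") simp_all
  have "Measurable.pred M (\<lambda>w. \<exists>q\<in>\<rat>. 0 \<le> q \<and> q < r \<and> Y w q \<noteq> Y w 0 \<and> Y w r = Y w 0)" for r :: real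
  proof -
    have "Measurable.pred M (\<lambda>w. \<exists>q::rat. 0 \<le> (of_rat q :: real) \<and> of_rat q < r \<and> Y w (of_rat q) \<noteq> Y w 0 \<and> Y w r = Y w 0)"
      by (rule pred_intros_countable(2)) (rule p)
    moreover have "(\<exists>q\<in>\<rat>. P q) \<longleftrightarrow> (\<exists>q::rat. P (of_rat q))" for P :: "real \<Rightarrow> bool"
      unfolding Rats_def by blast
    ultimately show ?thesis by (simp only:)
  qed
  then have "(\<lambda>w. if \<exists>q\<in>\<rat>. 0 \<le> q \<and> q < r \<and> Y w q \<noteq> Y w 0 \<and> Y w r = Y w 0 then ennreal r else \<top>) \<in> borel_measurable M" for r :: real
    by (intro measurable_If) (auto simp: pred_def)
  then have "(\<lambda>w. INF r\<in>\<rat>. if \<exists>q\<in>\<rat>. 0 \<le> q \<and> q < r \<and> Y w q \<noteq> Y w 0 \<and> Y w r = Y w 0 then ennreal r else \<top>) \<in> borel_measurable M"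
    by (intro borel_measurable_INF[OF c])
  then show ?thesis
    by (rule measurable_cong[THEN iffD1, rotated]) (simp add: return_time_rational[OF rc])
qed

section \<open>The residual dynamics\<close>

text \<open>
  The discrete part of a state. Clock and attained services are absent: the residual dynamics keeps
  the input up to date instead, so that the requirement of a copy is always the part still to be
  served, and the interarrival time of job \<open>upcoming\<close> is the time until its arrival. Job types are
  part of the configuration because, once a job is present, its drawn type no longer belongs to the
  future input.
\<close>

record config =
  upcoming :: nat
  jobs :: "nat list"
  kind :: "nat \<Rightarrow> nat set"
  head :: "nat \<Rightarrow> nat option"

locale redundancy =
  fixes pol :: policy and K d :: nat and lam mu :: real
  assumes d_pos: "1 \<le> d" and d_le: "d \<le> K" and lam_pos: "0 < lam" and mu_pos: "0 < mu"
begin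

definition line :: "config \<Rightarrow> nat \<Rightarrow> nat list" where
  "line z s = filter (\<lambda>j. s \<in> kind z j) (jobs z)"

definition rate :: "config \<Rightarrow> nat \<Rightarrow> nat \<Rightarrow> real" where
  "rate z j s =
     (if j \<in> set (jobs z) \<and> s \<in> kind z j then
        (case pol of PS \<Rightarrow> 1 / real (length (line z s)) | ROS \<Rightarrow> (if head z s = Some j then 1 else 0))
      else 0)"

definition copies :: "config \<Rightarrow> (nat \<times> nat) set" where
  "copies z = {(j, s). 0 < rate z j s}"

text \<open>
  The clocks that race in a configuration: \<open>None\<close> is the next arrival, \<open>Some (j, s)\<close> the completion
  of the copy of job \<open>j\<close> in server \<open>s\<close>.
\<close>

definition clocks :: "config \<Rightarrow> (nat \<times> nat) option set" where
  "clocks z = insert None (Some ` copies z)"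

definition level :: "config \<Rightarrow> (nat \<times> nat) option \<Rightarrow> (nat \<Rightarrow> mark) \<Rightarrow> real" where
  "level z k w = (case k of None \<Rightarrow> interarrival (w (upcoming z)) | Some (j, s) \<Rightarrow> requirement (w j) s)"

definition drain :: "config \<Rightarrow> (nat \<times> nat) option \<Rightarrow> real" where
  "drain z k = (case k of None \<Rightarrow> 1 | Some (j, s) \<Rightarrow> rate z j s)"

definition ring_time :: "config \<Rightarrow> (nat \<times> nat) option \<Rightarrow> (nat \<Rightarrow> mark) \<Rightarrow> real" where
  "ring_time z k w = level z k w / drain z k"

definition sojourn :: "config \<Rightarrow> (nat \<Rightarrow> mark) \<Rightarrow> real" where
  "sojourn z w = Min ((\<lambda>k. ring_time z k w) ` clocks z)"

definition elapse :: "config \<Rightarrow> real \<Rightarrow> (nat \<Rightarrow> mark) \<Rightarrow> (nat \<Rightarrow> mark)" where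
  "elapse z t w = (\<lambda>j. (interarrival (w j) - (if j = upcoming z then t else 0), drawn_type (w j),
     (\<lambda>s. requirement (w j) s - rate z j s * t), choice_var (w j)))"

definition admit :: "config \<Rightarrow> nat set \<Rightarrow> config" where
  "admit z c = \<lparr>upcoming = Suc (upcoming z), jobs = jobs z @ [upcoming z],
     kind = (kind z)(upcoming z := c),
     head = (\<lambda>s. if s \<in> c \<and> head z s = None then Some (upcoming z) else head z s)\<rparr>"

definition discharge :: "config \<Rightarrow> nat set \<Rightarrow> (nat \<Rightarrow> nat \<Rightarrow> real) \<Rightarrow> config" where
  "discharge z D u = \<lparr>upcoming = upcoming z, jobs = filter (\<lambda>j. j \<notin> D) (jobs z), kind = kind z,
     head = (\<lambda>s. case head z s of None \<Rightarrow> None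
       | Some j \<Rightarrow> if j \<in> D then choose_from (u j s) (filter (\<lambda>j. s \<in> kind z j) (filter (\<lambda>j. j \<notin> D) (jobs z)))
                 else Some j)\<rparr>"

definition finished :: "config \<Rightarrow> (nat \<Rightarrow> mark) \<Rightarrow> nat set" where
  "finished z w = {j. \<exists>s. (j, s) \<in> copies z \<and> ring_time z (Some (j, s)) w = sojourn z w}"

definition follow :: "config \<Rightarrow> (nat \<Rightarrow> mark) \<Rightarrow> config" where
  "follow z w = (if sojourn z w = interarrival (w (upcoming z))
     then admit z (drawn_type (w (upcoming z)))
     else discharge z (finished z w) (\<lambda>j. choice_var (w j)))"

text \<open>
  The next configuration if clock \<open>k\<close> rings alone. Unlike \<open>follow\<close>, it reads only a drawn type or
  choice variables and no residual time, which is what makes it independent of the race.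
\<close>

definition outcome :: "config \<Rightarrow> (nat \<times> nat) option \<Rightarrow> (nat \<Rightarrow> mark) \<Rightarrow> config" where
  "outcome z k w = (case k of None \<Rightarrow> admit z (drawn_type (w (upcoming z)))
     | Some (j, s) \<Rightarrow> discharge z {j} (\<lambda>j. choice_var (w j)))"

text \<open>
  Kinds of future jobs and heads outside \<open>{1..K}\<close> carry no information; pinning them to a default
  value makes the set countable.
\<close>

definition configs :: "config set" where
  "configs = {z. distinct (jobs z) \<and> set (jobs z) \<subseteq> {..<upcoming z} \<and>
     (\<forall>j<upcoming z. kind z j \<in> job_types K d) \<and> (\<forall>j\<ge>upcoming z. kind z j = {}) \<and>
     (\<forall>s. s \<notin> {1..K} \<longrightarrow> head z s = None)}"

abbreviation type_law :: "nat set measure" where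
  "type_law \<equiv> uniform_count_measure (job_types K d)"

abbreviation service_law :: "(nat \<Rightarrow> real) measure" where
  "service_law \<equiv> \<Pi>\<^sub>M s\<in>UNIV. exp_law mu"

abbreviation choice_law :: "(nat \<Rightarrow> real) measure" where
  "choice_law \<equiv> \<Pi>\<^sub>M s\<in>UNIV. uniform_measure lborel {0..<1}"

text \<open>
  The law of a mark whose copies have attained no service. By memorylessness it will turn out to be
  the law of the residual input at every epoch.
\<close>

definition fresh_mark :: "mark measure" where
  "fresh_mark = exp_law lam \<Otimes>\<^sub>M (type_law \<Otimes>\<^sub>M
       (service_law \<Otimes>\<^sub>M choice_law))"

definition fresh_law :: "(nat \<Rightarrow> mark) measure" where
  "fresh_law = (\<Pi>\<^sub>M j\<in>UNIV. fresh_mark)"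

abbreviation expect :: "((nat \<Rightarrow> mark) \<Rightarrow> ennreal) \<Rightarrow> ennreal"  (binder \<open>\<bbbE>\<close> 10) where
  "expect F \<equiv> nn_integral fresh_law F"

lemma finite_job_types: "finite (job_types K d)"
  unfolding job_types_def by (rule finite_subset[of _ "Pow {1..K}"]) auto

lemma job_types_nonempty: "job_types K d \<noteq> {}"
proof -
  have "{1..d} \<in> job_types K d" using d_le by (auto simp: job_types_def)
  then show ?thesis by blast
qed

lemma job_typeD: "c \<in> job_types K d \<Longrightarrow> c \<subseteq> {1..K} \<and> card c = d \<and> finite c"
  by (auto simp: job_types_def intro: finite_subset)

subsection \<open>Countability of configurations\<close>

text \<open>
  Countability reduces every joint measurability question about configuration and input to a fixed
  configuration (\<open>measurable_config_compose\<close>).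
\<close>

lemma countable_configs: "countable configs"
proof -
  let ?g = "\<lambda>z. (upcoming z, jobs z, map (kind z) [0..<upcoming z], map (head z) [0..<Suc K])"
  have "inj_on ?g configs"
  proof (rule inj_onI)
    fix z z' assume z: "z \<in> configs" "z' \<in> configs" and eq: "?g z = ?g z'"
    have "kind z = kind z'"
    proof
      fix j show "kind z j = kind z' j"
        using z eq by (cases "j < upcoming z") (auto simp: configs_def)
    qed
    moreover have "head z = head z'"
    proof
      fix s show "head z s = head z' s"
        using z eq by (cases "s \<in> {1..K}") (auto simp: configs_def)
    qed
    ultimately show "z = z'" using eq by (cases z; cases z') auto
  qed
  moreover have "countable (?g ` configs)"
    by (rule countable_subset[of _ "UNIV \<times> UNIV \<times> lists (job_types K d) \<times> UNIV"])
       (auto simp: configs_def countable_finite[OF finite_job_types])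
  ultimately show ?thesis by (rule countable_image_inj_on[rotated])
qed

lemma finite_copies:
  assumes "z \<in> configs" shows "finite (copies z)" "copies z \<subseteq> set (jobs z) \<times> {1..K}"
proof -
  show sub: "copies z \<subseteq> set (jobs z) \<times> {1..K}"
  proof
    fix p assume "p \<in> copies z"
    then obtain j s where p: "p = (j, s)" and j: "j \<in> set (jobs z)" and s: "s \<in> kind z j"
      by (auto simp: copies_def rate_def split: if_splits)
    have "kind z j \<in> job_types K d" using assms j by (auto simp: configs_def)
    with job_typeD s p j show "p \<in> set (jobs z) \<times> {1..K}" by blast
  qed
  show "finite (copies z)" by (rule finite_subset[OF sub]) simp
qed

lemma finite_clocks: "z \<in> configs \<Longrightarrow> finite (clocks z)"
  by (simp add: clocks_def finite_copies)

lemma rate_nonneg: "0 \<le> rate z j s"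
  by (auto simp: rate_def split: policy.split)

lemma rate_eq_0: "(j, s) \<notin> copies z \<Longrightarrow> rate z j s = 0"
  using rate_nonneg[of z j s] by (simp add: copies_def)

lemma drain_pos: "k \<in> clocks z \<Longrightarrow> 0 < drain z k"
  by (auto simp: clocks_def drain_def copies_def)

lemma choose_from_mem: "0 \<le> u \<Longrightarrow> u < 1 \<Longrightarrow> choose_from u q = Some i \<Longrightarrow> i \<in> set q"
proof -
  assume u: "0 \<le> u" "u < 1" and "choose_from u q = Some i"
  then have q: "q \<noteq> []" and i: "i = q ! nat \<lfloor>u * real (length q)\<rfloor>"
    by (auto simp: choose_from_def split: if_splits)
  from q u have "u * real (length q) < real (length q)" by simp
  then have "nat \<lfloor>u * real (length q)\<rfloor> < length q" using u
    by (simp add: nat_less_iff floor_less_iff)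
  then show ?thesis unfolding i by simp
qed

lemma admit_configs: "z \<in> configs \<Longrightarrow> c \<in> job_types K d \<Longrightarrow> admit z c \<in> configs"
  using job_typeD[of c] by (auto simp: configs_def admit_def less_Suc_eq)

lemma discharge_configs: "z \<in> configs \<Longrightarrow> discharge z D u \<in> configs"
  by (auto simp: configs_def discharge_def split: option.splits)

subsection \<open>The law of fresh input\<close>

lemma prob_space_types: "prob_space type_law"
  by (rule prob_space_uniform_count_measure[OF finite_job_types job_types_nonempty])

lemma prob_space_unif: "prob_space (uniform_measure lborel {0..<1::real})"
  by (rule prob_space_uniform_measure) auto

interpretation A: prob_space "exp_law lam" by (rule prob_space_exp_law[OF lam_pos])
interpretation E: prob_space "exp_law mu" by (rule prob_space_exp_law[OF mu_pos])
interpretation T: prob_space type_law by (rule prob_space_types)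
interpretation R: prob_space service_law
  by (rule prob_space_PiM) (rule prob_space_exp_law[OF mu_pos])
interpretation C: prob_space choice_law
  by (rule prob_space_PiM) (rule prob_space_unif)
interpretation RC: pair_prob_space service_law choice_law ..
interpretation TRC: pair_prob_space type_law "service_law \<Otimes>\<^sub>M choice_law" ..
interpretation ATRC: pair_prob_space "exp_law lam" "type_law \<Otimes>\<^sub>M (service_law \<Otimes>\<^sub>M choice_law)" ..

lemma prob_space_fresh_mark: "prob_space fresh_mark"
  unfolding fresh_mark_def by (rule ATRC.prob_space_axioms)

lemma prob_space_fresh_law: "prob_space fresh_law"
  unfolding fresh_law_def by (rule prob_space_PiM) (rule prob_space_fresh_mark)

interpretation P: prob_space fresh_law by (rule prob_space_fresh_law)

lemma measurable_interarrival [measurable]: "interarrival \<in> borel_measurable fresh_mark"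
  unfolding interarrival_def fresh_mark_def by measurable

lemma measurable_drawn_type [measurable]: "drawn_type \<in> fresh_mark \<rightarrow>\<^sub>M count_space (job_types K d)"
  unfolding drawn_type_def fresh_mark_def by measurable

lemma measurable_requirement: "(\<lambda>m. requirement m s) \<in> borel_measurable fresh_mark"
  unfolding requirement_def fresh_mark_def by measurable

lemma measurable_choice_var: "(\<lambda>m. choice_var m s) \<in> borel_measurable fresh_mark"
  unfolding choice_var_def fresh_mark_def by measurable

lemma measurable_requirement' [measurable (raw)]:
  "f \<in> M \<rightarrow>\<^sub>M fresh_mark \<Longrightarrow> (\<lambda>x. requirement (f x) s) \<in> borel_measurable M"
  by (rule measurable_compose[OF _ measurable_requirement])

lemma measurable_choice_var' [measurable (raw)]:
  "f \<in> M \<rightarrow>\<^sub>M fresh_mark \<Longrightarrow> (\<lambda>x. choice_var (f x) s) \<in> borel_measurable M"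
  by (rule measurable_compose[OF _ measurable_choice_var])

lemma measurable_markI [measurable (raw)]:
  assumes [measurable]: "a \<in> borel_measurable M" "c \<in> M \<rightarrow>\<^sub>M count_space (job_types K d)"
    and r: "\<And>s. (\<lambda>x. r x s) \<in> borel_measurable M" and u: "\<And>s. (\<lambda>x. u x s) \<in> borel_measurable M"
  shows "(\<lambda>x. (a x, c x, r x, u x)) \<in> M \<rightarrow>\<^sub>M fresh_mark"
proof -
  have [measurable]: "r \<in> M \<rightarrow>\<^sub>M service_law"
    by (rule measurable_PiM_single')
       (use r in \<open>auto simp: measurable_cong_sets[OF refl sets_exp_law]\<close>)
  have [measurable]: "u \<in> M \<rightarrow>\<^sub>M choice_law"
    by (rule measurable_PiM_single')
       (use u in \<open>auto simp: measurable_cong_sets[OF refl sets_uniform_measure]\<close>)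
  show ?thesis unfolding fresh_mark_def by measurable
qed

lemma measurable_inputI:
  assumes "\<And>j. (\<lambda>x. f x j) \<in> M \<rightarrow>\<^sub>M fresh_mark"
  shows "f \<in> M \<rightarrow>\<^sub>M fresh_law"
  unfolding fresh_law_def using assms measurable_space[OF assms]
  by (intro measurable_PiM_single') auto

lemma measurable_input_component [measurable (raw)]:
  "f \<in> M \<rightarrow>\<^sub>M fresh_law \<Longrightarrow> (\<lambda>x. f x j) \<in> M \<rightarrow>\<^sub>M fresh_mark"
  unfolding fresh_law_def by (rule measurable_compose[OF _ measurable_component_singleton]) auto

lemma measurable_input_upd [measurable (raw)]:
  assumes [measurable]: "f \<in> M \<rightarrow>\<^sub>M fresh_law" "g \<in> M \<rightarrow>\<^sub>M fresh_mark"
  shows "(\<lambda>x. (f x)(j := g x)) \<in> M \<rightarrow>\<^sub>M fresh_law"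
  by (rule measurable_inputI) (auto simp: fun_upd_def)

lemma drawn_type_space: "w \<in> space fresh_law \<Longrightarrow> drawn_type (w j) \<in> job_types K d"
  using measurable_space[OF measurable_drawn_type, of "w j"] by (auto simp: fresh_law_def space_PiM)

lemma nn_integral_resample_mark:
  assumes "F \<in> borel_measurable fresh_law"
  shows "(\<bbbE>w. F w) = (\<integral>\<^sup>+m. (\<bbbE>w. F (w(i := m))) \<partial>fresh_mark)"
  using nn_integral_PiM_resample[of "\<lambda>_. fresh_mark" F i] assms prob_space_fresh_mark
  unfolding fresh_law_def by simp

text \<open>
  Lifts the redrawing of a part of a single mark to the whole input.
\<close>

lemma nn_integral_resample_part:
  assumes L: "prob_space L" and F [measurable]: "F \<in> borel_measurable fresh_law"
    and g [measurable]: "(\<lambda>(y, m). g y m) \<in> L \<Otimes>\<^sub>M fresh_mark \<rightarrow>\<^sub>M fresh_mark"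
    and part: "\<And>G. G \<in> borel_measurable fresh_mark \<Longrightarrow>
      (\<integral>\<^sup>+m. G m \<partial>fresh_mark) = (\<integral>\<^sup>+y. (\<integral>\<^sup>+m. G (g y m) \<partial>fresh_mark) \<partial>L)"
  shows "(\<bbbE>w. F w) = (\<integral>\<^sup>+y. (\<bbbE>w. F (w(i := g y (w i)))) \<partial>L)"
proof -
  interpret Q: prob_space fresh_mark by (rule prob_space_fresh_mark)
  have G: "(\<lambda>m. \<integral>\<^sup>+w. F (w(i := m)) \<partial>fresh_law) \<in> borel_measurable fresh_mark"
    by measurable
  have "(\<bbbE>w. F w) = (\<integral>\<^sup>+y. (\<integral>\<^sup>+m. (\<bbbE>w. F (w(i := g y m))) \<partial>fresh_mark) \<partial>L)"
    unfolding nn_integral_resample_mark[OF F, of i] by (rule part[OF G])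
  also have "\<dots> = (\<integral>\<^sup>+y. (\<bbbE>w. F (w(i := g y (w i)))) \<partial>L)"
  proof (rule nn_integral_cong)
    fix y assume y: "y \<in> space L"
    have gy [measurable]: "(\<lambda>m. g y m) \<in> fresh_mark \<rightarrow>\<^sub>M fresh_mark"
      using measurable_compose[OF measurable_Pair1'[OF y] g] by simp
    show "(\<integral>\<^sup>+m. (\<bbbE>w. F (w(i := g y m))) \<partial>fresh_mark) =
        (\<bbbE>w. F (w(i := g y (w i))))"
      by (subst nn_integral_resample_mark[of "\<lambda>w. F (w(i := g y (w i)))" i]) auto
  qed
  finally show ?thesis .
qed

lemma nn_integral_fresh_mark:
  assumes "G \<in> borel_measurable fresh_mark"
  shows "(\<integral>\<^sup>+m. G m \<partial>fresh_mark) =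
    (\<integral>\<^sup>+a. (\<integral>\<^sup>+c. (\<integral>\<^sup>+r. (\<integral>\<^sup>+u. G (a, c, r, u) \<partial>choice_law)
      \<partial>service_law) \<partial>type_law) \<partial>exp_law lam)"
proof -
  note G = assms[unfolded fresh_mark_def, measurable]
  show ?thesis
    unfolding fresh_mark_def
    apply (subst TRC.nn_integral_fst [symmetric])
     apply measurable
    apply (intro nn_integral_cong)
    apply (subst RC.nn_integral_fst [symmetric])
     apply measurable
    apply (intro nn_integral_cong)
    apply (subst C.nn_integral_fst [symmetric])
     apply measurable
    done
qed

lemma nn_integral_resample_interarrival:
  assumes [measurable]: "F \<in> borel_measurable fresh_law"
  shows "(\<bbbE>w. F w) =
    (\<integral>\<^sup>+y. (\<bbbE>w. F (w(i := (y, drawn_type (w i), requirement (w i), choice_var (w i))))) \<partial>exp_law lam)"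
proof (rule nn_integral_resample_part[where g="\<lambda>y m. (y, drawn_type m, requirement m, choice_var m)"])
  show "prob_space (exp_law lam)" by (rule prob_space_exp_law[OF lam_pos])
  show "(\<lambda>(y, m). (y, drawn_type m, requirement m, choice_var m)) \<in> exp_law lam \<Otimes>\<^sub>M fresh_mark \<rightarrow>\<^sub>M fresh_mark"
    unfolding case_prod_beta by (rule measurable_markI) measurable
  fix G :: "mark \<Rightarrow> ennreal" assume G [measurable]: "G \<in> borel_measurable fresh_mark"
  have H: "(\<lambda>m. G (y, drawn_type m, requirement m, choice_var m)) \<in> borel_measurable fresh_mark" for y
    by measurable
  show "(\<integral>\<^sup>+m. G m \<partial>fresh_mark) =
      (\<integral>\<^sup>+y. (\<integral>\<^sup>+m. G (y, drawn_type m, requirement m, choice_var m) \<partial>fresh_mark) \<partial>exp_law lam)"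
    unfolding nn_integral_fresh_mark[OF G] nn_integral_fresh_mark[OF H]
    by (simp add: drawn_type_def requirement_def choice_var_def A.emeasure_space_1[simplified])
qed (rule assms)

lemma nn_integral_resample_type:
  assumes [measurable]: "F \<in> borel_measurable fresh_law"
  shows "(\<bbbE>w. F w) =
    (\<integral>\<^sup>+c. (\<bbbE>w. F (w(i := (interarrival (w i), c, requirement (w i), choice_var (w i)))))
       \<partial>type_law)"
proof (rule nn_integral_resample_part[where g="\<lambda>y m. (interarrival m, y, requirement m, choice_var m)"])
  show "prob_space type_law" by (rule prob_space_types)
  show "(\<lambda>(y, m). (interarrival m, y, requirement m, choice_var m))
      \<in> type_law \<Otimes>\<^sub>M fresh_mark \<rightarrow>\<^sub>M fresh_mark"
    unfolding case_prod_beta by (rule measurable_markI) measurable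
  fix G :: "mark \<Rightarrow> ennreal" assume G [measurable]: "G \<in> borel_measurable fresh_mark"
  have H: "(\<lambda>m. G (interarrival m, c, requirement m, choice_var m)) \<in> borel_measurable fresh_mark"
    if "c \<in> job_types K d" for c
    using measurable_const[of c "count_space (job_types K d)" fresh_mark] that
    by (intro measurable_compose[OF _ G] measurable_markI measurable_requirement measurable_choice_var) auto
  let ?I = "\<lambda>a c. \<integral>\<^sup>+r. (\<integral>\<^sup>+u. G (a, c, r, u) \<partial>choice_law) \<partial>service_law"
  interpret AT: pair_sigma_finite "exp_law lam" type_law ..
  note G' = G[unfolded fresh_mark_def]
  have I: "(\<lambda>(a, c). ?I a c) \<in> borel_measurable (exp_law lam \<Otimes>\<^sub>M type_law)"
    using G' by measurable
  have "(\<integral>\<^sup>+c. (\<integral>\<^sup>+m. G (interarrival m, c, requirement m, choice_var m) \<partial>fresh_mark)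
       \<partial>type_law) = (\<integral>\<^sup>+c. (\<integral>\<^sup>+a. ?I a c \<partial>exp_law lam) \<partial>type_law)"
  proof (rule nn_integral_cong)
    fix c assume "c \<in> space type_law"
    then have c: "c \<in> job_types K d" by (simp add: space_uniform_count_measure)
    show "(\<integral>\<^sup>+m. G (interarrival m, c, requirement m, choice_var m) \<partial>fresh_mark) = (\<integral>\<^sup>+a. ?I a c \<partial>exp_law lam)"
      unfolding nn_integral_fresh_mark[OF H[OF c]]
      by (simp add: interarrival_def requirement_def choice_var_def T.emeasure_space_1)
  qed
  also have "\<dots> = (\<integral>\<^sup>+a. (\<integral>\<^sup>+c. ?I a c \<partial>type_law) \<partial>exp_law lam)"
    by (rule AT.Fubini'[OF I])
  finally show "(\<integral>\<^sup>+m. G m \<partial>fresh_mark) = (\<integral>\<^sup>+c. (\<integral>\<^sup>+m. G (interarrival m, c, requirement m, choice_var m) \<partial>fresh_mark)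
       \<partial>type_law)"
    unfolding nn_integral_fresh_mark[OF G] by simp
qed (rule assms)

lemma nn_integral_resample_requirement:
  assumes [measurable]: "F \<in> borel_measurable fresh_law"
  shows "(\<bbbE>w. F w) =
    (\<integral>\<^sup>+y. (\<bbbE>w. F (w(i := (interarrival (w i), drawn_type (w i), (requirement (w i))(s := y), choice_var (w i)))))
       \<partial>exp_law mu)"
proof (rule nn_integral_resample_part[where g="\<lambda>y m. (interarrival m, drawn_type m, (requirement m)(s := y), choice_var m)"])
  show "prob_space (exp_law mu)" by (rule prob_space_exp_law[OF mu_pos])
  show jm: "(\<lambda>(y, m). (interarrival m, drawn_type m, (requirement m)(s := y), choice_var m))
      \<in> exp_law mu \<Otimes>\<^sub>M fresh_mark \<rightarrow>\<^sub>M fresh_mark"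
    unfolding case_prod_beta fun_upd_def by (rule measurable_markI) measurable
  fix G :: "mark \<Rightarrow> ennreal" assume G [measurable]: "G \<in> borel_measurable fresh_mark"
  interpret EA: pair_sigma_finite "exp_law mu" "exp_law lam" ..
  interpret ET: pair_sigma_finite "exp_law mu" type_law ..
  note G' = G[unfolded fresh_mark_def]
  have H: "(\<lambda>m. G (interarrival m, drawn_type m, (requirement m)(s := y), choice_var m)) \<in> borel_measurable fresh_mark" for y
    unfolding fun_upd_def by measurable
  let ?J = "\<lambda>y a c. \<integral>\<^sup>+r. (\<integral>\<^sup>+u. G (a, c, r(s := y), u) \<partial>choice_law) \<partial>service_law"
  have upd: "(\<lambda>(y, a, c, r, u). G (a, c, r(s := y), u)) \<in> borel_measurable (exp_law mu \<Otimes>\<^sub>M (exp_law lam \<Otimes>\<^sub>M (type_law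
     \<Otimes>\<^sub>M (service_law \<Otimes>\<^sub>M choice_law))))"
    using measurable_compose[OF jm G] unfolding fresh_mark_def
    by (simp add: case_prod_beta interarrival_def drawn_type_def requirement_def choice_var_def)
  have J3: "(\<lambda>((y, a), c). ?J y a c) \<in> borel_measurable ((exp_law mu \<Otimes>\<^sub>M exp_law lam) \<Otimes>\<^sub>M type_law)"
    using upd unfolding case_prod_beta by measurable
  have J1: "(\<lambda>(y, a). \<integral>\<^sup>+c. ?J y a c \<partial>type_law) \<in> borel_measurable (exp_law mu \<Otimes>\<^sub>M exp_law lam)"
    using J3 unfolding case_prod_beta by measurable
  have J2: "(\<lambda>(y, c). ?J y a c) \<in> borel_measurable (exp_law mu \<Otimes>\<^sub>M type_law)" for a
    using J3 unfolding case_prod_beta by measurable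
  have "(\<integral>\<^sup>+y. (\<integral>\<^sup>+m. G (interarrival m, drawn_type m, (requirement m)(s := y), choice_var m) \<partial>fresh_mark) \<partial>exp_law mu)
     = (\<integral>\<^sup>+y. (\<integral>\<^sup>+a. (\<integral>\<^sup>+c. ?J y a c \<partial>type_law) \<partial>exp_law lam) \<partial>exp_law mu)"
    unfolding nn_integral_fresh_mark[OF H]
    by (simp add: interarrival_def drawn_type_def requirement_def choice_var_def)
  also have "\<dots> = (\<integral>\<^sup>+a. (\<integral>\<^sup>+c. (\<integral>\<^sup>+y. ?J y a c \<partial>exp_law mu) \<partial>type_law) \<partial>exp_law lam)"
    by (subst EA.Fubini'[OF J1, symmetric]) (intro nn_integral_cong ET.Fubini'[OF J2, symmetric])
  also have "\<dots> = (\<integral>\<^sup>+m. G m \<partial>fresh_mark)"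
    unfolding nn_integral_fresh_mark[OF G]
  proof (intro nn_integral_cong)
    fix a c assume c: "c \<in> space type_law"
    have Gr: "(\<lambda>r. \<integral>\<^sup>+u. G (a, c, r, u) \<partial>choice_law) \<in> borel_measurable service_law"
      using G' c by (simp add: space_uniform_count_measure) measurable
    show "(\<integral>\<^sup>+y. ?J y a c \<partial>exp_law mu) = (\<integral>\<^sup>+r. (\<integral>\<^sup>+u. G (a, c, r, u) \<partial>choice_law) \<partial>service_law)"
      using nn_integral_PiM_resample[of "\<lambda>_. exp_law mu", OF _ Gr, of s] prob_space_exp_law[OF mu_pos] by simp
  qed
  finally show "(\<integral>\<^sup>+m. G m \<partial>fresh_mark) =
     (\<integral>\<^sup>+y. (\<integral>\<^sup>+m. G (interarrival m, drawn_type m, (requirement m)(s := y), choice_var m) \<partial>fresh_mark) \<partial>exp_law mu)" by simp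
qed (rule assms)

lemma mark_sel [simp]:
  "interarrival (a, c, r, u) = a" "drawn_type (a, c, r, u) = c"
  "requirement (a, c, r, u) = r" "choice_var (a, c, r, u) = u"
  by (simp_all add: interarrival_def drawn_type_def requirement_def choice_var_def)

lemma mark_eqI:
  "interarrival m = interarrival m' \<Longrightarrow> drawn_type m = drawn_type m' \<Longrightarrow>
   requirement m = requirement m' \<Longrightarrow> choice_var m = choice_var m' \<Longrightarrow> m = m'"
  by (cases m; cases m') simp

subsection \<open>Measurability of the dynamics\<close>

lemma measurable_level [measurable (raw)]:
  "f \<in> M \<rightarrow>\<^sub>M fresh_law \<Longrightarrow> (\<lambda>x. level z k (f x)) \<in> borel_measurable M"
  unfolding level_def by (cases k) (auto simp: case_prod_beta)

lemma measurable_ring_time [measurable (raw)]: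
  "f \<in> M \<rightarrow>\<^sub>M fresh_law \<Longrightarrow> (\<lambda>x. ring_time z k (f x)) \<in> borel_measurable M"
  unfolding ring_time_def by simp

lemma measurable_sojourn:
  "z \<in> configs \<Longrightarrow> sojourn z \<in> borel_measurable fresh_law"
  unfolding sojourn_def by (intro borel_measurable_Min finite_clocks) auto

lemma measurable_elapse [measurable (raw)]:
  assumes [measurable]: "t \<in> borel_measurable M" "f \<in> M \<rightarrow>\<^sub>M fresh_law"
  shows "(\<lambda>x. elapse z (t x) (f x)) \<in> M \<rightarrow>\<^sub>M fresh_law"
  unfolding elapse_def by (intro measurable_inputI measurable_markI) measurable

lemma measurable_choose_from: "(\<lambda>u. choose_from u q) \<in> borel \<rightarrow>\<^sub>M count_space UNIV"
  unfolding choose_from_def by (cases "q = []") simp_all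

lemma measurable_discharge:
  assumes z: "z \<in> configs"
  shows "(\<lambda>w. discharge z D (\<lambda>j. choice_var (w j))) \<in> fresh_law \<rightarrow>\<^sub>M count_space configs"
proof (rule iffD2[OF measurable_count_space_eq_countable[OF countable_configs]], intro conjI ballI)
  let ?f = "\<lambda>w. discharge z D (\<lambda>j. choice_var (w j))"
  show "?f \<in> space fresh_law \<rightarrow> configs" using discharge_configs[OF z] by auto
  fix z' assume z': "z' \<in> configs"
  let ?q = "\<lambda>s. filter (\<lambda>j. s \<in> kind z j) (filter (\<lambda>j. j \<notin> D) (jobs z))"
  have outside: "head z s = None" "head z' s = None" if "s \<notin> {1..K}" for s
    using z z' that by (auto simp: configs_def)
  have "?f w = z' \<longleftrightarrow> upcoming z = upcoming z' \<and> filter (\<lambda>j. j \<notin> D) (jobs z) = jobs z' \<and> kind z = kind z' \<and>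
     (\<forall>s\<in>{1..K}. (case head z s of None \<Rightarrow> None | Some j \<Rightarrow> if j \<in> D then choose_from (choice_var (w j) s) (?q s) else Some j) = head z' s)"
    (is "_ \<longleftrightarrow> ?R w") for w
  proof -
    have "head (?f w) = head z' \<longleftrightarrow> (\<forall>s\<in>{1..K}. head (?f w) s = head z' s)"
    proof (intro iffI ext)
      fix s assume eq: "\<forall>s\<in>{1..K}. head (?f w) s = head z' s"
      show "head (?f w) s = head z' s"
        using eq outside[of s] by (cases "s \<in> {1..K}") (auto simp: discharge_def)
    qed simp
    then show ?thesis
      by (cases z') (auto simp: discharge_def)
  qed
  then have eq: "?f -` {z'} \<inter> space fresh_law = {w \<in> space fresh_law. ?R w}" by auto
  have pick: "Measurable.pred fresh_law (\<lambda>w. choose_from (choice_var (w j) s) (?q s) = head z' s)" for j s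
    by (rule pred_eq_const1[where N="count_space UNIV"])
       (auto intro!: measurable_compose[OF _ measurable_choose_from])
  have "Measurable.pred fresh_law ?R"
  proof (intro pred_intros_logic pred_intros_finite)
    fix s show "Measurable.pred fresh_law (\<lambda>w. (case head z s of None \<Rightarrow> None
       | Some j \<Rightarrow> if j \<in> D then choose_from (choice_var (w j) s) (?q s) else Some j) = head z' s)"
      using pick by (cases "head z s") auto
  qed auto
  then show "?f -` {z'} \<inter> space fresh_law \<in> sets fresh_law"
    unfolding eq by (rule predE)
qed

lemma measurable_admit:
  assumes z: "z \<in> configs"
  shows "(\<lambda>w. admit z (drawn_type (w j))) \<in> fresh_law \<rightarrow>\<^sub>M count_space configs"
proof -
  have "(\<lambda>c. admit z c) \<in> count_space (job_types K d) \<rightarrow>\<^sub>M count_space configs"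
    using admit_configs[OF z] by auto
  then show ?thesis
    by (rule measurable_compose[rotated]) measurable
qed

lemma measurable_outcome: "z \<in> configs \<Longrightarrow> outcome z k \<in> fresh_law \<rightarrow>\<^sub>M count_space configs"
  unfolding outcome_def by (cases k) (simp_all add: case_prod_beta measurable_admit measurable_discharge)

lemma finished_subset: "finished z w \<subseteq> set (jobs z)"
  by (auto simp: finished_def copies_def rate_def split: if_splits)

lemma measurable_follow:
  assumes z: "z \<in> configs" shows "follow z \<in> fresh_law \<rightarrow>\<^sub>M count_space configs"
proof -
  have [measurable]: "sojourn z \<in> borel_measurable fresh_law" by (rule measurable_sojourn[OF z])
  have fin: "finished z \<in> fresh_law \<rightarrow>\<^sub>M count_space (Pow (set (jobs z)))"
  proof (subst measurable_count_space_eq_countable, goal_cases)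
    case 1 show "countable (Pow (set (jobs z)))" by (rule countable_finite) simp
  next
    case 2 show ?case
  proof (intro conjI ballI)
    show "finished z \<in> space fresh_law \<rightarrow> Pow (set (jobs z))" using finished_subset by auto
    fix D assume "D \<in> Pow (set (jobs z))"
    then have D: "D \<subseteq> set (jobs z)" by simp
    have "finished z w = D \<longleftrightarrow> (\<forall>j\<in>set (jobs z). (\<exists>p\<in>copies z. fst p = j \<and> ring_time z (Some p) w = sojourn z w) \<longleftrightarrow> j \<in> D)" for w
    proof -
      have "j \<in> finished z w \<longleftrightarrow> (\<exists>p\<in>copies z. fst p = j \<and> ring_time z (Some p) w = sojourn z w)" for j
        by (force simp: finished_def)
      then show ?thesis using D finished_subset[of z w] by blast
    qed
    then have eq: "finished z -` {D} \<inter> space fresh_law = {w \<in> space fresh_law.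
       \<forall>j\<in>set (jobs z). (\<exists>p\<in>copies z. fst p = j \<and> ring_time z (Some p) w = sojourn z w) \<longleftrightarrow> j \<in> D}" by auto
    have "Measurable.pred fresh_law (\<lambda>w. \<forall>j\<in>set (jobs z). (\<exists>p\<in>copies z. fst p = j \<and> ring_time z (Some p) w = sojourn z w) \<longleftrightarrow> j \<in> D)"
    proof (rule pred_intros_finite(3)[OF finite_set])
      fix j
      have eq: "Measurable.pred fresh_law (\<lambda>w. ring_time z (Some p) w = sojourn z w)" for p
        unfolding pred_def by (rule borel_measurable_eq) (simp_all add: measurable_ring_time measurable_sojourn[OF z])
      have "Measurable.pred fresh_law (\<lambda>w. fst p = j \<and> ring_time z (Some p) w = sojourn z w)" for p
        by (rule pred_intros_logic(3)[OF _ eq]) (rule measurable_const, simp)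
      then have "Measurable.pred fresh_law (\<lambda>w. \<exists>p\<in>copies z. fst p = j \<and> ring_time z (Some p) w = sojourn z w)"
        by (rule pred_intros_finite(4)[OF finite_copies(1)[OF z]])
      then show "Measurable.pred fresh_law (\<lambda>w. (\<exists>p\<in>copies z. fst p = j \<and> ring_time z (Some p) w = sojourn z w) \<longleftrightarrow> j \<in> D)"
        by (rule pred_intros_logic(6)) (rule measurable_const, simp)
    qed
    then show "finished z -` {D} \<inter> space fresh_law \<in> sets fresh_law"
      unfolding eq by (rule predE)
  qed
  qed
  have dis: "(\<lambda>w. discharge z (finished z w) (\<lambda>j. choice_var (w j))) \<in> fresh_law \<rightarrow>\<^sub>M count_space configs"
    by (rule measurable_compose_countable'[OF measurable_discharge[OF z] fin])
       (rule countable_finite, simp)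
  have "{w \<in> space fresh_law. sojourn z w = interarrival (w (upcoming z))} \<in> sets fresh_law"
    by (rule borel_measurable_eq) measurable
  then show ?thesis
    unfolding follow_def by (intro measurable_If dis measurable_admit[OF z])
qed

lemma measurable_config_compose:
  assumes f: "\<And>z. z \<in> configs \<Longrightarrow> f z \<in> fresh_law \<rightarrow>\<^sub>M N"
    and z: "zf \<in> M \<rightarrow>\<^sub>M count_space configs" and w: "wg \<in> M \<rightarrow>\<^sub>M fresh_law"
  shows "(\<lambda>x. f (zf x) (wg x)) \<in> M \<rightarrow>\<^sub>M N"
  by (rule measurable_compose_countable'[OF _ z countable_configs])
     (rule measurable_compose[OF w f])

subsection \<open>Live and dead coordinates\<close>

text \<open>
  Equality of the live coordinates, those that can still influence the future from \<open>z\<close> on. The marks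
  of departed jobs are dead, and so are the interarrival times and drawn types of all jobs that have
  arrived.
\<close>

definition agree :: "config \<Rightarrow> (nat \<Rightarrow> mark) \<Rightarrow> (nat \<Rightarrow> mark) \<Rightarrow> bool" where
  "agree z w w' \<longleftrightarrow>
     (\<forall>i\<ge>upcoming z. interarrival (w i) = interarrival (w' i) \<and> drawn_type (w i) = drawn_type (w' i)) \<and>
     (\<forall>i. i \<in> set (jobs z) \<or> upcoming z \<le> i \<longrightarrow>
        requirement (w i) = requirement (w' i) \<and> choice_var (w i) = choice_var (w' i))"

text \<open>
  The functionals of the future to which the Markov property applies.
\<close>

definition observable :: "(config \<Rightarrow> (nat \<Rightarrow> mark) \<Rightarrow> ennreal) \<Rightarrow> bool" where
  "observable F \<longleftrightarrow> (\<forall>z\<in>configs. F z \<in> borel_measurable fresh_law) \<and>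
     (\<forall>z w w'. agree z w w' \<longrightarrow> F z w = F z w')"

lemma agree_ring_time: "agree z w w' \<Longrightarrow> k \<in> clocks z \<Longrightarrow> ring_time z k w = ring_time z k w'"
  by (auto simp: agree_def ring_time_def level_def clocks_def copies_def rate_def split: option.split if_splits)

lemma agree_sojourn: "agree z w w' \<Longrightarrow> sojourn z w = sojourn z w'"
  unfolding sojourn_def by (intro arg_cong[where f=Min] image_cong) (auto simp: agree_ring_time)

lemma agree_finished: "agree z w w' \<Longrightarrow> finished z w = finished z w'"
  unfolding finished_def using agree_ring_time[of z w w'] agree_sojourn[of z w w']
  by (auto simp: clocks_def)

lemma discharge_cong:
  assumes "\<And>j. j \<in> D \<Longrightarrow> u j = u' j" shows "discharge z D u = discharge z D u'"
  unfolding discharge_def using assms by (auto simp: fun_eq_iff split: option.split)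

lemma agree_follow: "agree z w w' \<Longrightarrow> follow z w = follow z w'"
  unfolding follow_def using agree_sojourn[of z w w'] agree_finished[of z w w'] finished_subset[of z w']
  by (auto simp: agree_def intro!: discharge_cong)

lemma agree_elapse: "agree z w w' \<Longrightarrow> agree z (elapse z t w) (elapse z t w')"
  by (auto simp: agree_def elapse_def fun_eq_iff)

lemma agree_follow_mono: "agree z w w' \<Longrightarrow> agree (follow z w'') w w'"
  by (auto simp: agree_def follow_def admit_def discharge_def)

lemma agree_step: "agree z w w' \<Longrightarrow>
   agree (follow z w) (elapse z (sojourn z w) w) (elapse z (sojourn z w') w')"
  using agree_elapse agree_follow_mono agree_sojourn by metis

subsection \<open>The race between clocks\<close>

text \<open>
  Sets the residual that drives clock \<open>k\<close>.
\<close>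

definition put :: "config \<Rightarrow> (nat \<times> nat) option \<Rightarrow> real \<Rightarrow> (nat \<Rightarrow> mark) \<Rightarrow> (nat \<Rightarrow> mark)" where
  "put z k y w = (case k of
     None \<Rightarrow> w(upcoming z := (y, drawn_type (w (upcoming z)), requirement (w (upcoming z)), choice_var (w (upcoming z))))
   | Some (j, s) \<Rightarrow> w(j := (interarrival (w j), drawn_type (w j), (requirement (w j))(s := y), choice_var (w j))))"

text \<open>
  The rate of the exponential law of a residual. A copy that is served at speed \<open>drain z k\<close> uses it
  up faster or slower, so that its clock rings at rate \<open>intensity z k\<close>.
\<close>

definition hazard :: "(nat \<times> nat) option \<Rightarrow> real" where
  "hazard k = (case k of None \<Rightarrow> lam | Some _ \<Rightarrow> mu)"

definition intensity :: "config \<Rightarrow> (nat \<times> nat) option \<Rightarrow> real" where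
  "intensity z k = hazard k * drain z k"

definition total :: "config \<Rightarrow> real" where
  "total z = (\<Sum>k\<in>clocks z. intensity z k)"

lemma hazard_pos: "0 < hazard k"
  using lam_pos mu_pos by (auto simp: hazard_def split: option.split)

lemma drain_nonneg: "0 \<le> drain z k"
  by (auto simp: drain_def rate_nonneg split: option.split)

lemma intensity_nonneg: "0 \<le> intensity z k"
  using hazard_pos[of k] drain_nonneg[of z k] by (simp add: intensity_def)

lemma measurable_put [measurable (raw)]:
  assumes [measurable]: "y \<in> borel_measurable M" "f \<in> M \<rightarrow>\<^sub>M fresh_law"
  shows "(\<lambda>x. put z k (y x) (f x)) \<in> M \<rightarrow>\<^sub>M fresh_law"
proof (cases k)
  case None
  show ?thesis unfolding put_def None option.case by measurable
next
  case (Some p)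
  obtain j s where p: "p = (j, s)" by (cases p)
  have [measurable]: "(\<lambda>x. ((requirement (f x j))(s := y x)) s') \<in> borel_measurable M" for s'
    by (cases "s' = s") simp_all
  show ?thesis unfolding put_def Some p option.case prod.case by measurable
qed

lemma level_put [simp]: "level z k (put z k y w) = y"
  by (auto simp: level_def put_def split: option.split)

lemma level_put_other: "k' \<noteq> k \<Longrightarrow> level z k' (put z k y w) = level z k' w"
  by (cases k; cases k') (auto simp: level_def put_def split: if_splits)

lemma put_put [simp]: "put z k y (put z k x w) = put z k y w"
  by (auto simp: put_def split: option.split)

lemma resample_clock:
  assumes "F \<in> borel_measurable fresh_law"
  shows "(\<bbbE>w. F w) = (\<integral>\<^sup>+y. (\<bbbE>w. F (put z k y w)) \<partial>exp_law (hazard k))"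
proof (cases k)
  case None
  then show ?thesis
    using nn_integral_resample_interarrival[OF assms, of "upcoming z"] by (simp add: put_def hazard_def)
next
  case (Some p)
  then show ?thesis
    using nn_integral_resample_requirement[OF assms, of "fst p" "snd p"]
    by (simp add: put_def hazard_def case_prod_beta)
qed

text \<open>
  Redraw the residual of clock \<open>k\<close>; on the event that it exceeds \<open>c\<close>, the excess is as good as new.
\<close>

lemma memoryless_clock:
  assumes F [measurable]: "F \<in> borel_measurable fresh_law" and c: "0 \<le> c"
  shows "(\<bbbE>w. (if c < level z k w then F (put z k (level z k w - c) w) else 0)) =
    ennreal (exp (- hazard k * c)) * (\<bbbE>w. F w)"
proof -
  have "(\<bbbE>w. (if c < level z k w then F (put z k (level z k w - c) w) else 0)) =
     (\<integral>\<^sup>+y. (\<bbbE>w. (if c < y then F (put z k (y - c) w) else 0)) \<partial>exp_law (hazard k))"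
    by (subst resample_clock[of _ k z]) (simp_all cong del: if_weak_cong)
  also have "\<dots> = (\<integral>\<^sup>+y. (if c < y then (\<bbbE>w. F (put z k (y - c) w)) else 0) \<partial>exp_law (hazard k))"
    by (intro nn_integral_cong) auto
  also have "\<dots> = ennreal (exp (- hazard k * c)) * (\<integral>\<^sup>+y. (\<bbbE>w. F (put z k y w)) \<partial>exp_law (hazard k))"
    by (rule exp_law_memoryless[OF hazard_pos c]) measurable
  also have "\<dots> = ennreal (exp (- hazard k * c)) * (\<bbbE>w. F w)"
    by (simp flip: resample_clock)
  finally show ?thesis .
qed

text \<open>
  Time passes for the clocks in \<open>J\<close> only. It serves for treating the clocks one at a time.
\<close>

definition elapse_on :: "config \<Rightarrow> (nat \<times> nat) option set \<Rightarrow> real \<Rightarrow> (nat \<Rightarrow> mark) \<Rightarrow> (nat \<Rightarrow> mark)" where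
  "elapse_on z J t w = (\<lambda>j. (interarrival (w j) - (if j = upcoming z \<and> None \<in> J then t else 0), drawn_type (w j),
     (\<lambda>s. requirement (w j) s - (if Some (j, s) \<in> J then rate z j s * t else 0)), choice_var (w j)))"

lemma measurable_elapse_on [measurable (raw)]:
  assumes [measurable]: "f \<in> M \<rightarrow>\<^sub>M fresh_law"
  shows "(\<lambda>x. elapse_on z J t (f x)) \<in> M \<rightarrow>\<^sub>M fresh_law"
  unfolding elapse_on_def by (intro measurable_inputI measurable_markI) measurable

lemma elapse_on_empty [simp]: "elapse_on z {} t w = w"
  by (auto simp: elapse_on_def fun_eq_iff intro: mark_eqI)

lemma level_elapse_on: "k \<notin> J \<Longrightarrow> level z k (elapse_on z J t w) = level z k w"
  by (cases k) (auto simp: level_def elapse_on_def)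

lemma elapse_on_insert:
  assumes "k \<notin> J"
  shows "elapse_on z (insert k J) t w =
    put z k (level z k (elapse_on z J t w) - drain z k * t) (elapse_on z J t w)"
proof (cases k)
  case None
  then show ?thesis using assms
    by (auto simp: elapse_on_def put_def level_def drain_def fun_eq_iff)
next
  case (Some p)
  then show ?thesis using assms
    by (cases p) (auto simp: elapse_on_def put_def level_def drain_def fun_eq_iff)
qed

lemma elapse_put:
  assumes "k \<in> clocks z"
  shows "elapse z t (put z k y w) = put z k (y - drain z k * t) (elapse_on z (clocks z - {k}) t w)"
proof -
  have Z: "rate z j s = 0" if "Some (j, s) \<notin> clocks z" for j s
    using that rate_eq_0[of j s z] by (auto simp: clocks_def)
  have N: "None \<in> clocks z" by (simp add: clocks_def)
  show ?thesis
  proof (cases k)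
    case None
    then show ?thesis using Z by (auto simp: elapse_def elapse_on_def put_def drain_def fun_eq_iff)
  next
    case (Some p)
    then show ?thesis using Z N by (cases p) (auto simp: elapse_def elapse_on_def put_def drain_def fun_eq_iff)
  qed
qed

lemma memoryless_clocks:
  assumes "finite J" and t: "0 \<le> t" and "F \<in> borel_measurable fresh_law"
  shows "(\<bbbE>w. (if \<forall>k\<in>J. drain z k * t < level z k w then F (elapse_on z J t w) else 0)) =
    ennreal (exp (- t * (\<Sum>k\<in>J. intensity z k))) * (\<bbbE>w. F w)"
  using assms(1,3)
proof (induction J arbitrary: F rule: finite_induct)
  case empty
  then show ?case by simp
next
  case (insert k J F)
  note [measurable] = insert.prems
  let ?c = "drain z k * t"
  let ?G = "\<lambda>w. if ?c < level z k w then F (put z k (level z k w - ?c) w) else 0"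
  have c: "0 \<le> ?c" using t drain_nonneg by simp
  have G: "?G \<in> borel_measurable fresh_law" by measurable
  have "(\<bbbE>w. (if \<forall>k\<in>insert k J. drain z k * t < level z k w then F (elapse_on z (insert k J) t w) else 0))
     = (\<bbbE>w. (if \<forall>k\<in>J. drain z k * t < level z k w then ?G (elapse_on z J t w) else 0))"
    using insert.hyps(2) by (intro nn_integral_cong) (auto simp: elapse_on_insert level_elapse_on)
  also have "\<dots> = ennreal (exp (- t * (\<Sum>k\<in>J. intensity z k))) * (\<bbbE>w. ?G w)"
    by (rule insert.IH[OF G])
  also have "\<dots> = ennreal (exp (- t * (\<Sum>k\<in>J. intensity z k))) * (ennreal (exp (- hazard k * ?c)) * (\<bbbE>w. F w))"
    by (subst memoryless_clock[OF insert.prems c]) simp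
  also have "\<dots> = ennreal (exp (- t * (\<Sum>k\<in>insert k J. intensity z k))) * (\<bbbE>w. F w)"
  proof -
    have "- t * (\<Sum>k\<in>insert k J. intensity z k) = - t * (\<Sum>k\<in>J. intensity z k) + - hazard k * ?c"
      using insert.hyps by (simp add: intensity_def algebra_simps)
    then have "exp (- t * (\<Sum>k\<in>insert k J. intensity z k)) = exp (- t * (\<Sum>k\<in>J. intensity z k)) * exp (- hazard k * ?c)"
      by (simp only: exp_add)
    then show ?thesis by (simp only: ennreal_mult'[OF exp_ge_zero] mult.assoc)
  qed
  finally show ?case .
qed

definition wins :: "config \<Rightarrow> (nat \<times> nat) option \<Rightarrow> (nat \<Rightarrow> mark) \<Rightarrow> bool" where
  "wins z k w \<longleftrightarrow> (\<forall>k'\<in>clocks z - {k}. ring_time z k w < ring_time z k' w)"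

lemma measurable_wins: "z \<in> configs \<Longrightarrow> Measurable.pred fresh_law (wins z k)"
  unfolding wins_def by (intro pred_intros_finite) (auto simp: finite_clocks)

lemma total_pos: "z \<in> configs \<Longrightarrow> 0 < total z"
proof -
  assume z: "z \<in> configs"
  have "intensity z None \<le> total z" unfolding total_def
    by (rule member_le_sum) (auto simp: clocks_def intensity_nonneg finite_copies[OF z])
  then show ?thesis using lam_pos by (simp add: intensity_def hazard_def drain_def)
qed

text \<open>
  Redraw the winning clock \<open>k\<close> first and fix its ringing time. Given that time, every other clock
  must exceed it, which costs an exponential factor and leaves a fresh residual
  (\<open>memoryless_clocks\<close>). Integrating these factors over the ringing time gives the winning
  probability. The residual of \<open>k\<close> itself is used up, so \<open>H\<close> must not depend on it.
\<close>

lemma race: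
  assumes z: "z \<in> configs" and k: "k \<in> clocks z" and H [measurable]: "H \<in> borel_measurable fresh_law"
    and dead: "\<And>y w. H (put z k y w) = H w"
  shows "(\<bbbE>w. (if wins z k w then H (elapse z (ring_time z k w) w) else 0)) =
     ennreal (intensity z k / total z) * (\<bbbE>w. H w)"
proof -
  let ?J = "clocks z - {k}" and ?D = "drain z k"
  let ?S = "\<Sum>k\<in>?J. intensity z k"
  have J: "finite ?J" using finite_clocks[OF z] by simp
  have D: "0 < ?D" by (rule drain_pos[OF k])
  note measurable_wins[OF z, measurable]
  have "(\<bbbE>w. (if wins z k w then H (elapse z (ring_time z k w) w) else 0)) =
    (\<integral>\<^sup>+y. (\<bbbE>w. (if wins z k (put z k y w) then H (elapse z (ring_time z k (put z k y w)) (put z k y w)) else 0))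
      \<partial>exp_law (hazard k))"
    by (rule resample_clock) measurable
  also have "\<dots> = (\<integral>\<^sup>+y. ennreal (exp (- y * (?S / ?D))) * (\<bbbE>w. H w) \<partial>exp_law (hazard k))"
  proof (rule nn_integral_cong_AE, use AE_exp_law_nonneg in eventually_elim)
    fix y :: real assume y: "0 \<le> y"
    have win: "wins z k (put z k y w) \<longleftrightarrow> (\<forall>k\<in>?J. drain z k * (y / ?D) < level z k w)" for w
      unfolding wins_def ring_time_def using drain_pos
      by (intro ball_cong) (auto simp: level_put_other field_simps)
    have "(\<bbbE>w. (if wins z k (put z k y w) then H (elapse z (ring_time z k (put z k y w)) (put z k y w)) else 0)) =
       (\<bbbE>w. (if \<forall>k\<in>?J. drain z k * (y / ?D) < level z k w then H (elapse_on z ?J (y / ?D) w) else 0))"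
      unfolding win elapse_put[OF k] unfolding ring_time_def level_put
      by (simp only: dead)
    also have "\<dots> = ennreal (exp (- (y / ?D) * ?S)) * (\<bbbE>w. H w)"
      using y D by (intro memoryless_clocks[OF J]) auto
    finally show "(\<bbbE>w. (if wins z k (put z k y w) then H (elapse z (ring_time z k (put z k y w)) (put z k y w)) else 0)) =
       ennreal (exp (- y * (?S / ?D))) * (\<bbbE>w. H w)"
      by simp
  qed
  also have "\<dots> = (\<integral>\<^sup>+y. ennreal (exp (- y * (?S / ?D))) \<partial>exp_law (hazard k)) * (\<bbbE>w. H w)"
    by (rule nn_integral_multc) measurable
  also have "(\<integral>\<^sup>+y. ennreal (exp (- y * (?S / ?D))) \<partial>exp_law (hazard k)) = ennreal (hazard k / (hazard k + ?S / ?D))"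
    using D by (intro nn_integral_exp_law_exp hazard_pos) (simp add: sum_nonneg intensity_nonneg)
  also have "hazard k / (hazard k + ?S / ?D) = intensity z k / total z"
  proof -
    have "total z = intensity z k + ?S"
      unfolding total_def using finite_clocks[OF z] k by (rule sum.remove)
    then show ?thesis using D total_pos[OF z] by (simp add: intensity_def field_simps)
  qed
  finally show ?thesis .
qed

lemma wins_unique: "k \<in> clocks z \<Longrightarrow> k' \<in> clocks z \<Longrightarrow> wins z k w \<Longrightarrow> wins z k' w \<Longrightarrow> k = k'"
  unfolding wins_def by (metis Diff_iff less_asym singletonD)

lemma sojourn_wins:
  assumes z: "z \<in> configs" and k: "k \<in> clocks z" and w: "wins z k w"
  shows "sojourn z w = ring_time z k w"
  unfolding sojourn_def using z k w
  by (intro Min_eqI) (auto simp: finite_clocks wins_def intro: less_imp_le)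

lemma follow_wins:
  assumes z: "z \<in> configs" and k: "k \<in> clocks z" and w: "wins z k w"
  shows "follow z w = outcome z k w"
proof (cases k)
  case None
  then show ?thesis using sojourn_wins[OF assms]
    by (simp add: follow_def outcome_def ring_time_def level_def drain_def)
next
  case (Some p)
  obtain j s where p: "p = (j, s)" by (cases p)
  have N: "None \<in> clocks z" by (simp add: clocks_def)
  have "sojourn z w \<noteq> interarrival (w (upcoming z))"
  proof -
    have "ring_time z k w < ring_time z None w" using w N Some by (auto simp: wins_def)
    then show ?thesis using sojourn_wins[OF assms] by (simp add: ring_time_def level_def drain_def)
  qed
  moreover have "finished z w = {j}"
  proof -
    have "(j', s') = (j, s)" if "(j', s') \<in> copies z" "ring_time z (Some (j', s')) w = sojourn z w" for j' s'
    proof (rule ccontr)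
      assume "(j', s') \<noteq> (j, s)"
      then have "Some (j', s') \<in> clocks z - {k}" using that(1) by (auto simp: clocks_def Some p)
      then have "ring_time z k w < ring_time z (Some (j', s')) w" using w by (auto simp: wins_def)
      then show False using that(2) sojourn_wins[OF assms] by simp
    qed
    moreover have "(j, s) \<in> copies z" "ring_time z (Some (j, s)) w = sojourn z w"
      using k sojourn_wins[OF assms] by (auto simp: clocks_def Some p)
    ultimately show ?thesis unfolding finished_def by blast
  qed
  ultimately show ?thesis by (simp add: follow_def outcome_def Some p)
qed

text \<open>
  Ties have probability 0, because the probabilities of the strict wins already sum up to 1.
\<close>

lemma AE_wins:
  assumes z: "z \<in> configs" shows "AE w in fresh_law. \<exists>k\<in>clocks z. wins z k w"
proof -
  note measurable_wins[OF z, measurable]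
  note fin = finite_clocks[OF z]
  let ?W = "{w \<in> space fresh_law. \<exists>k\<in>clocks z. wins z k w}"
  have W: "?W \<in> sets fresh_law" using fin by measurable
  have one: "(\<bbbE>w. (if wins z k w then 1 else 0)) = ennreal (intensity z k / total z)" if "k \<in> clocks z" for k
    using race[OF z that, of "\<lambda>_. 1"] P.emeasure_space_1 by simp
  have "emeasure fresh_law ?W = (\<bbbE>w. indicator ?W w)"
    using W by simp
  also have "\<dots> = (\<bbbE>w. (\<Sum>k\<in>clocks z. (if wins z k w then 1 else 0)))"
  proof (rule nn_integral_cong)
    fix w assume sp: "w \<in> space fresh_law"
    show "indicator ?W w = (\<Sum>k\<in>clocks z. (if wins z k w then 1 else 0::ennreal))"
    proof (cases "\<exists>k\<in>clocks z. wins z k w")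
      case True
      then obtain k where k: "k \<in> clocks z" "wins z k w" by blast
      have "(\<Sum>k'\<in>clocks z. (if wins z k' w then 1 else 0::ennreal)) = (\<Sum>k'\<in>clocks z. (if k' = k then 1 else 0))"
        using wins_unique k by (intro sum.cong) auto
      then show ?thesis using True sp k fin by simp
    next
      case False
      then show ?thesis by (auto simp: indicator_def intro!: sum.neutral[symmetric])
    qed
  qed
  also have "\<dots> = (\<Sum>k\<in>clocks z. ennreal (intensity z k / total z))"
    by (subst nn_integral_sum) (auto simp: one)
  also have "\<dots> = ennreal (\<Sum>k\<in>clocks z. intensity z k / total z)"
    using total_pos[OF z] intensity_nonneg by (intro sum_ennreal) simp
  also have "(\<Sum>k\<in>clocks z. intensity z k / total z) = 1"
    using total_pos[OF z] by (simp add: total_def sum_divide_distrib [symmetric])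
  finally have "emeasure fresh_law ?W = 1" by simp
  then have "P.prob ?W = 1" by (simp add: P.emeasure_eq_measure)
  then have "AE w in fresh_law. w \<in> ?W" by (rule P.AE_prob_1)
  then show ?thesis by auto
qed

lemma outcome_elapse: "outcome z k (elapse z t w) = outcome z k w"
  by (auto simp: outcome_def elapse_def split: option.split)

lemma outcome_put: "outcome z k (put z k' y w) = outcome z k w"
proof -
  have "drawn_type (put z k' y w j) = drawn_type (w j)" "choice_var (put z k' y w j) = choice_var (w j)" for j
    by (cases k'; auto simp: put_def split: prod.split)+
  then show ?thesis by (cases k) (simp_all add: outcome_def case_prod_beta)
qed

lemma agree_put: "z \<in> configs \<Longrightarrow> k \<in> clocks z \<Longrightarrow> agree (outcome z k w') (put z k y w) w"
  by (cases k) (auto simp: agree_def outcome_def admit_def discharge_def put_def clocks_def copies_def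
      rate_def configs_def split: if_splits)

lemma outcome_in_configs: "z \<in> configs \<Longrightarrow> w \<in> space fresh_law \<Longrightarrow> outcome z k w \<in> configs"
  unfolding outcome_def by (auto split: option.split intro: admit_configs discharge_configs drawn_type_space)

lemma observable_measurable: "observable F \<Longrightarrow> z \<in> configs \<Longrightarrow> F z \<in> borel_measurable fresh_law"
  by (simp add: observable_def)

lemma observable_agree: "observable F \<Longrightarrow> agree z w w' \<Longrightarrow> F z w = F z w'"
  unfolding observable_def by blast

lemma nn_integral_type_cong:
  "(\<And>c. c \<in> job_types K d \<Longrightarrow> f c = g c) \<Longrightarrow>
   (\<integral>\<^sup>+c. f c \<partial>type_law) = (\<integral>\<^sup>+c. g c \<partial>type_law)"
  by (intro nn_integral_cong) (simp add: space_uniform_count_measure)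

lemma nn_integral_drawn_type:
  shows "(\<bbbE>w. f (drawn_type (w i))) = (\<Sum>c\<in>job_types K d. f c) / of_nat (card (job_types K d))"
proof -
  have "(\<lambda>w. f (drawn_type (w i))) \<in> borel_measurable fresh_law"
    by (rule measurable_compose[OF measurable_compose[OF measurable_input_component[OF measurable_ident_sets[OF refl]] measurable_drawn_type]]) simp
  then have "(\<bbbE>w. f (drawn_type (w i))) = (\<integral>\<^sup>+c. f c \<partial>type_law)"
    by (subst nn_integral_resample_type[of _ i]) (simp_all add: P.emeasure_space_1)
  also have "\<dots> = (\<Sum>c\<in>job_types K d. f c) / of_nat (card (job_types K d))"
    using job_types_nonempty finite_job_types unfolding uniform_count_measure_def
    by (subst nn_integral_point_measure_finite)
       (simp_all add: sum_distrib_right[symmetric] sum_divide_distrib divide_ennreal_def ennreal_of_nat_eq_real_of_nat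
         inverse_ennreal card_gt_0_iff inverse_eq_divide mult.commute)
  finally show ?thesis .
qed

text \<open>
  The drawn type or the choice variables that decide the outcome are dead coordinates afterwards.
  They can therefore be redrawn without changing the functional, which separates the next
  configuration from the input that drives the rest of the path.
\<close>

lemma decouple_outcome:
  assumes F: "observable F" and z: "z \<in> configs" and k: "k \<in> clocks z"
  shows "(\<bbbE>w. F (outcome z k w) w) =
    (\<bbbE>w'. (\<bbbE>w. F (outcome z k w') w))"
proof -
  have meas: "(\<lambda>w. F (outcome z k w) w) \<in> borel_measurable fresh_law"
    by (rule measurable_config_compose[OF observable_measurable[OF F] measurable_outcome[OF z] measurable_ident_sets[OF refl]])
  have meas': "(\<lambda>w'. \<integral>\<^sup>+w. F (outcome z k w') w \<partial>fresh_law) \<in> borel_measurable fresh_law"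
    by (rule measurable_compose[OF measurable_outcome[OF z]]) simp
  show ?thesis
  proof (cases k)
    case None
    let ?n = "upcoming z"
    have a: "agree (admit z c) (w(?n := (interarrival (w ?n), c, requirement (w ?n), choice_var (w ?n)))) w" for c w
      by (auto simp: agree_def admit_def)
    have "(\<bbbE>w. F (outcome z k w) w) = (\<integral>\<^sup>+c. (\<bbbE>w. F (admit z c) w) \<partial>type_law)"
      using observable_agree[OF F a] None
      by (subst nn_integral_resample_type[OF meas, of ?n])
         (intro nn_integral_type_cong nn_integral_cong, simp add: outcome_def)
    also have "\<dots> = (\<bbbE>w'. (\<bbbE>w. F (outcome z k w') w))"
      by (subst nn_integral_resample_type[OF meas', of ?n]) (simp add: outcome_def None P.emeasure_space_1)
    finally show ?thesis .
  next
    case (Some p)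
    obtain j s where p: "p = (j, s)" by (cases p)
    let ?z = "\<lambda>m. discharge z {j} (\<lambda>_. choice_var m)"
    have o: "outcome z k w = ?z (w j)" for w
      unfolding outcome_def Some p option.case prod.case by (rule discharge_cong) simp
    have j: "j < upcoming z"
      using k z by (auto simp: Some p clocks_def copies_def rate_def configs_def split: if_splits)
    have a: "agree (?z m) (w(j := m)) w" for m w
      using j by (auto simp: agree_def discharge_def)
    have "(\<bbbE>w. F (outcome z k w) w) = (\<integral>\<^sup>+m. (\<bbbE>w. F (?z m) w) \<partial>fresh_mark)"
      using observable_agree[OF F a] unfolding o
      by (subst nn_integral_resample_mark[OF meas[unfolded o], of j]) simp
    also have "\<dots> = (\<bbbE>w'. (\<bbbE>w. F (outcome z k w') w))"
      unfolding o by (subst nn_integral_resample_mark[OF meas'[unfolded o], of j]) (simp add: P.emeasure_space_1)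
    finally show ?thesis .
  qed
qed

definition weight :: "config \<Rightarrow> (nat \<times> nat) option \<Rightarrow> real" where
  "weight z k = intensity z k / total z"

text \<open>
  The transition operator of the embedded jump chain.
\<close>

definition jump :: "(config \<Rightarrow> ennreal) \<Rightarrow> config \<Rightarrow> ennreal" where
  "jump f z = (\<Sum>k\<in>clocks z. ennreal (weight z k) * (\<bbbE>w. f (outcome z k w)))"

text \<open>
  Almost surely exactly one clock wins; \<open>race\<close> shows that the aged input is fresh and independent of
  the winner, and \<open>decouple_outcome\<close> that it is independent of the outcome.
\<close>

theorem markov_property:
  assumes F: "observable F" and z: "z \<in> configs"
  shows "(\<bbbE>w. F (follow z w) (elapse z (sojourn z w) w)) =
    jump (\<lambda>z'. \<integral>\<^sup>+w. F z' w \<partial>fresh_law) z"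
proof -
  let ?H = "\<lambda>k w. F (outcome z k w) w"
  let ?G = "\<lambda>k w. if wins z k w then ?H k (elapse z (ring_time z k w) w) else 0"
  have meas: "?H k \<in> borel_measurable fresh_law" for k
    by (rule measurable_config_compose[OF observable_measurable[OF F] measurable_outcome[OF z] measurable_ident_sets[OF refl]])
  have G: "?G k \<in> borel_measurable fresh_law" for k
    using measurable_wins[OF z, of k, measurable] measurable_compose[OF measurable_elapse[OF measurable_ring_time[OF measurable_ident_sets[OF refl]] measurable_ident_sets[OF refl]] meas]
    by (intro measurable_If) (simp_all add: pred_def)
  have "AE w in fresh_law. F (follow z w) (elapse z (sojourn z w) w) = (\<Sum>k\<in>clocks z. ?G k w)"
    using AE_wins[OF z]
  proof eventually_elim
    fix w assume "\<exists>k\<in>clocks z. wins z k w"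
    then obtain k where k: "k \<in> clocks z" "wins z k w" by blast
    have "(\<Sum>k'\<in>clocks z. ?G k' w) = (\<Sum>k'\<in>clocks z. if k' = k then ?G k w else 0)"
      using wins_unique k by (intro sum.cong) auto
    also have "\<dots> = ?G k w" using k finite_clocks[OF z] by simp
    also have "\<dots> = F (follow z w) (elapse z (sojourn z w) w)"
      using k by (simp add: follow_wins[OF z] sojourn_wins[OF z] outcome_elapse)
    finally show "F (follow z w) (elapse z (sojourn z w) w) = (\<Sum>k\<in>clocks z. ?G k w)" by simp
  qed
  then have "(\<bbbE>w. F (follow z w) (elapse z (sojourn z w) w)) = (\<bbbE>w. (\<Sum>k\<in>clocks z. ?G k w))"
    by (rule nn_integral_cong_AE)
  also have "\<dots> = (\<Sum>k\<in>clocks z. \<integral>\<^sup>+w. ?G k w \<partial>fresh_law)"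
    by (rule nn_integral_sum) (rule G)
  also have "\<dots> = jump (\<lambda>z'. \<integral>\<^sup>+w. F z' w \<partial>fresh_law) z"
    unfolding jump_def
  proof (rule sum.cong[OF refl])
    fix k assume k: "k \<in> clocks z"
    show "(\<bbbE>w. ?G k w) = ennreal (weight z k) * (\<bbbE>w. (\<bbbE>w'. F (outcome z k w) w'))"
      unfolding weight_def decouple_outcome[OF F z k, symmetric]
      by (rule race[OF z k meas]) (simp add: outcome_put observable_agree[OF F agree_put[OF z k]])
  qed
  finally show ?thesis .
qed

section \<open>A Foster criterion for the residual chain\<close>

text \<open>
  Under \<open>ROS\<close> a server is idle only if its queue is empty. The chain preserves this only almost
  surely: a choice variable outside \<open>[0, 1)\<close> may select a job that is not in the queue.
\<close>

definition valid :: "config \<Rightarrow> bool" where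
  "valid z \<longleftrightarrow> z \<in> configs \<and> (pol = ROS \<longrightarrow> (\<forall>s\<in>{1..K}. case head z s of
     None \<Rightarrow> line z s = [] | Some j \<Rightarrow> j \<in> set (line z s)))"

lemma valid_configs: "valid z \<Longrightarrow> z \<in> configs"
  by (simp add: valid_def)

lemma nn_integral_choice_var:
  assumes f [measurable]: "f \<in> borel_measurable borel"
  shows "(\<bbbE>w. f (choice_var (w j) s)) = (\<integral>\<^sup>+u. f u \<partial>uniform_measure lborel {0..<1})"
proof -
  have m: "(\<lambda>m. f (choice_var m s)) \<in> borel_measurable fresh_mark" by measurable
  have m': "(\<lambda>w. f (choice_var (w j) s)) \<in> borel_measurable fresh_law" by measurable
  have c: "(\<lambda>u. f (u s)) \<in> borel_measurable choice_law"
    by measurable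
  have "(\<bbbE>w. f (choice_var (w j) s)) = (\<integral>\<^sup>+m. f (choice_var m s) \<partial>fresh_mark)"
    by (subst nn_integral_resample_mark[OF m', of j]) (simp add: P.emeasure_space_1)
  also have "\<dots> = (\<integral>\<^sup>+u. f (u s) \<partial>choice_law)"
    by (subst nn_integral_fresh_mark[OF m])
       (simp add: A.emeasure_space_1[simplified] T.emeasure_space_1 R.emeasure_space_1)
  also have "\<dots> = (\<integral>\<^sup>+u. f u \<partial>uniform_measure lborel {0..<1})"
    by (subst nn_integral_PiM_resample[OF _ c, of s]) (simp_all add: prob_space_unif C.emeasure_space_1)
  finally show ?thesis .
qed

lemma AE_choice_var: "AE w in fresh_law. 0 \<le> choice_var (w j) s \<and> choice_var (w j) s < 1"
proof -
  let ?N = "{w \<in> space fresh_law. \<not> (0 \<le> choice_var (w j) s \<and> choice_var (w j) s < 1)}"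
  have N: "?N \<in> sets fresh_law" by measurable
  have "emeasure fresh_law ?N = (\<bbbE>w. indicator ?N w)" using N by simp
  also have "\<dots> = (\<bbbE>w. indicator (- {0..<1}) (choice_var (w j) s))"
    by (rule nn_integral_cong) (auto simp: indicator_def)
  also have "\<dots> = emeasure (uniform_measure lborel {0..<1::real}) (- {0..<1})"
    by (subst nn_integral_choice_var) auto
  also have "\<dots> = 0" by (subst emeasure_uniform_measure) auto
  finally show ?thesis using N by (auto intro!: AE_I[of _ _ ?N])
qed

lemma valid_admit:
  assumes z: "valid z" and c: "c \<in> job_types K d" shows "valid (admit z c)"
  unfolding valid_def
proof (intro conjI impI ballI)
  show "admit z c \<in> configs" using admit_configs valid_configs z c by blast
  fix s assume "pol = ROS" and s: "s \<in> {1..K}"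
  then have inv: "case head z s of None \<Rightarrow> line z s = [] | Some j \<Rightarrow> j \<in> set (line z s)"
    using z unfolding valid_def by blast
  have new: "\<not> upcoming z \<in> set (jobs z)" using valid_configs[OF z] by (auto simp: configs_def)
  then have l: "line (admit z c) s = (if s \<in> c then line z s @ [upcoming z] else line z s)"
    unfolding line_def admit_def by (auto intro!: filter_cong)
  show "case head (admit z c) s of None \<Rightarrow> line (admit z c) s = [] | Some j \<Rightarrow> j \<in> set (line (admit z c) s)"
    using inv unfolding l by (auto simp: admit_def split: option.splits)
qed

lemma valid_discharge:
  assumes z: "valid z" and u: "\<And>s. s \<in> {1..K} \<Longrightarrow> 0 \<le> u j s \<and> u j s < 1"
  shows "valid (discharge z {j} u)"
  unfolding valid_def
proof (intro conjI impI ballI)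
  show "discharge z {j} u \<in> configs" using discharge_configs valid_configs z by blast
  fix s assume "pol = ROS" and s: "s \<in> {1..K}"
  then have inv: "case head z s of None \<Rightarrow> line z s = [] | Some j \<Rightarrow> j \<in> set (line z s)"
    using z unfolding valid_def by blast
  let ?q = "filter (\<lambda>j. s \<in> kind z j) (filter (\<lambda>i. i \<notin> {j}) (jobs z))"
  have l: "line (discharge z {j} u) s = ?q" by (simp add: line_def discharge_def)
  have pick: "i \<in> set ?q" if "choose_from (u j s) ?q = Some i" for i
    using choose_from_mem[OF _ _ that] u[OF s] by simp
  have none: "?q = []" if "choose_from (u j s) ?q = None"
    using that by (auto simp: choose_from_def split: if_splits)
  show "case head (discharge z {j} u) s of None \<Rightarrow> line (discharge z {j} u) s = []
      | Some i \<Rightarrow> i \<in> set (line (discharge z {j} u) s)"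
  proof (cases "head z s")
    case None
    then show ?thesis using inv unfolding l by (auto simp: discharge_def line_def filter_empty_conv)
  next
    case (Some i)
    show ?thesis
    proof (cases "i = j")
      case True
      have h: "head (discharge z {j} u) s = choose_from (u j s) ?q"
        using Some True by (simp add: discharge_def)
      show ?thesis
      proof (cases "choose_from (u j s) ?q")
        case None
        show ?thesis unfolding h l None option.case by (rule none[OF None])
      next
        case (Some i')
        show ?thesis unfolding h l Some option.case by (rule pick[OF Some])
      qed
    next
      case False
      have h: "head (discharge z {j} u) s = Some i" using Some False by (simp add: discharge_def)
      show ?thesis unfolding h l using Some inv False by (simp add: line_def)
    qed
  qed
qed

lemma AE_valid_outcome:
  assumes z: "valid z" shows "AE w in fresh_law. valid (outcome z k w)"
proof (cases k)
  case None
  have "AE w in fresh_law. w \<in> space fresh_law" by (rule AE_space)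
  then show ?thesis
    by eventually_elim (simp add: outcome_def None valid_admit[OF z] drawn_type_space)
next
  case (Some p)
  obtain j s where p: "p = (j, s)" by (cases p)
  have "AE w in fresh_law. \<forall>s\<in>{1..K}. 0 \<le> choice_var (w j) s \<and> choice_var (w j) s < 1"
    by (rule AE_finite_allI[OF finite_atLeastAtMost]) (rule AE_choice_var)
  then show ?thesis
    by eventually_elim (unfold outcome_def Some p option.case prod.case, rule valid_discharge[OF z], blast)
qed

subsection \<open>The jump operator\<close>

lemma measurable_after_outcome: "z \<in> configs \<Longrightarrow> (\<lambda>w. f (outcome z k w)) \<in> borel_measurable fresh_law"
  for f :: "config \<Rightarrow> ennreal"
  by (rule measurable_compose[OF measurable_outcome]) simp_all

lemma weight_nonneg: "z \<in> configs \<Longrightarrow> 0 \<le> weight z k"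
  using total_pos[of z] intensity_nonneg[of z k] by (simp add: weight_def)

lemma weight_sum: "z \<in> configs \<Longrightarrow> (\<Sum>k\<in>clocks z. weight z k) = 1"
  using total_pos[of z] by (simp add: weight_def total_def sum_divide_distrib [symmetric])

lemma jump_mono_valid:
  assumes "valid z" "\<And>z'. valid z' \<Longrightarrow> f z' \<le> g z'"
  shows "jump f z \<le> jump g z"
  unfolding jump_def
proof (intro sum_mono mult_left_mono nn_integral_mono_AE)
  fix k show "AE w in fresh_law. f (outcome z k w) \<le> g (outcome z k w)"
    using AE_valid_outcome[OF assms(1)] by eventually_elim (rule assms(2))
qed simp

lemma jump_cong_configs:
  assumes "z \<in> configs" "\<And>z'. z' \<in> configs \<Longrightarrow> f z' = g z'"
  shows "jump f z = jump g z"
  unfolding jump_def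
  by (intro sum.cong refl arg_cong2[where f="(*)"] nn_integral_cong) (simp add: assms outcome_in_configs)

lemma jump_add: "z \<in> configs \<Longrightarrow> jump (\<lambda>z. f z + g z) z = jump f z + jump g z"
  unfolding jump_def
  by (simp add: nn_integral_add measurable_after_outcome sum.distrib distrib_left)

lemma jump_cmult: "z \<in> configs \<Longrightarrow> jump (\<lambda>z. c * f z) z = c * jump f z"
  unfolding jump_def
  by (simp add: nn_integral_cmult measurable_after_outcome sum_distrib_left mult.left_commute)

lemma jump_const: "z \<in> configs \<Longrightarrow> jump (\<lambda>_. c) z = c"
proof -
  assume z: "z \<in> configs"
  have "jump (\<lambda>_. c) z = ennreal (\<Sum>k\<in>clocks z. weight z k) * c"
    unfolding jump_def using weight_nonneg[OF z]
    by (simp add: P.emeasure_space_1 sum_distrib_right [symmetric] sum_ennreal)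
  then show ?thesis by (simp add: weight_sum[OF z])
qed

lemma jump_sum: "z \<in> configs \<Longrightarrow> jump (\<lambda>z. \<Sum>i\<in>I. f i z) z = (\<Sum>i\<in>I. jump (f i) z)"
  by (induction I rule: infinite_finite_induct) (simp_all add: jump_add jump_const)

subsection \<open>Hitting a prescribed population\<close>

definition counts :: "config \<Rightarrow> nat set \<Rightarrow> nat" where
  "counts z c = card {j \<in> set (jobs z). kind z j = c}"

text \<open>
  \<open>reach N k z\<close> is the probability that the chain started in \<open>z\<close> shows the population \<open>N\<close> within \<open>k\<close>
  steps, and \<open>miss N k z\<close> the complementary probability.
\<close>

primrec reach :: "(nat set \<Rightarrow> nat) \<Rightarrow> nat \<Rightarrow> config \<Rightarrow> ennreal" where
  "reach N 0 z = (if counts z = N then 1 else 0)"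
| "reach N (Suc k) z = (if counts z = N then 1 else jump (reach N k) z)"

primrec miss :: "(nat set \<Rightarrow> nat) \<Rightarrow> nat \<Rightarrow> config \<Rightarrow> ennreal" where
  "miss N 0 z = (if counts z = N then 0 else 1)"
| "miss N (Suc k) z = (if counts z = N then 0 else jump (miss N k) z)"

lemma reach_miss: "z \<in> configs \<Longrightarrow> miss N k z + reach N k z = 1"
proof (induction k arbitrary: z)
  case (Suc k)
  have "jump (miss N k) z + jump (reach N k) z = jump (\<lambda>_. 1) z"
    unfolding jump_add[OF Suc.prems, symmetric] by (rule jump_cong_configs[OF Suc.prems Suc.IH])
  then show ?case by (simp add: jump_const Suc.prems)
qed simp

text \<open>
  The duration of a step plus 1, so that a path which never hits its target has infinite cost even
  if its durations are summable. A step without duration is not seen by the continuous-time path;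
  its infinite cost makes every path of finite cost have strictly increasing epochs.
\<close>

definition cost :: "config \<Rightarrow> (nat \<Rightarrow> mark) \<Rightarrow> ennreal" where
  "cost z w = (if 0 < sojourn z w then ennreal (sojourn z w) + 1 else \<infinity>)"

text \<open>
  The cost up to and including the first configuration with population \<open>N\<close>, truncated after \<open>n\<close>
  steps. That configuration is charged too, because it must last for a positive time to be seen.
\<close>

primrec path_cost :: "(nat set \<Rightarrow> nat) \<Rightarrow> nat \<Rightarrow> config \<Rightarrow> (nat \<Rightarrow> mark) \<Rightarrow> ennreal" where
  "path_cost N 0 z w = 0"
| "path_cost N (Suc n) z w = cost z w +
     (if counts z = N then 0 else path_cost N n (follow z w) (elapse z (sojourn z w) w))"

lemma measurable_cost: "z \<in> configs \<Longrightarrow> cost z \<in> borel_measurable fresh_law"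
  using measurable_sojourn[of z, measurable] unfolding cost_def by measurable

lemma measurable_after_elapse:
  assumes "z \<in> configs" shows "(\<lambda>w. elapse z (sojourn z w) w) \<in> fresh_law \<rightarrow>\<^sub>M fresh_law"
  by (rule measurable_elapse[OF measurable_sojourn[OF assms] measurable_ident_sets[OF refl]])

lemma AE_level_pos: "AE w in fresh_law. 0 < level z k w"
proof -
  let ?A = "{w \<in> space fresh_law. 0 < level z k w}"
  have A: "?A \<in> sets fresh_law" by measurable
  have "emeasure fresh_law ?A = (\<bbbE>w. indicator ?A w)" using A by simp
  also have "\<dots> = (\<bbbE>w. (if 0 < level z k w then 1 else 0))"
    by (rule nn_integral_cong) (auto simp: indicator_def)
  also have "\<dots> = 1"
    using memoryless_clock[of "\<lambda>_. 1" 0 z k] by (simp add: P.emeasure_space_1)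
  finally have "P.prob ?A = 1" by (simp add: P.emeasure_eq_measure)
  then have "AE w in fresh_law. w \<in> ?A" by (rule P.AE_prob_1)
  then show ?thesis by auto
qed

text \<open>
  A residual is almost surely positive (\<open>memoryless_clock\<close> with \<open>c = 0\<close>), and finitely many clocks
  race.
\<close>

lemma AE_sojourn_pos:
  assumes z: "z \<in> configs" shows "AE w in fresh_law. 0 < sojourn z w"
proof -
  have "AE w in fresh_law. \<forall>k\<in>clocks z. 0 < level z k w"
    by (rule AE_finite_allI[OF finite_clocks[OF z]]) (rule AE_level_pos)
  then show ?thesis
  proof eventually_elim
    case (elim w)
    then show ?case unfolding sojourn_def
      using finite_clocks[OF z] drain_pos[of _ z] by (subst Min_gr_iff) (auto simp: ring_time_def clocks_def)
  qed
qed

text \<open>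
  The mean duration is at most the mean time to the next arrival.
\<close>

lemma nn_integral_cost:
  assumes z: "z \<in> configs" shows "(\<bbbE>w. cost z w) \<le> ennreal (1 / lam) + 1"
proof -
  let ?n = "upcoming z"
  have le: "sojourn z w \<le> interarrival (w ?n)" for w
  proof -
    have "sojourn z w \<le> ring_time z None w" unfolding sojourn_def
      using finite_clocks[OF z] by (intro Min_le) (auto simp: clocks_def)
    then show ?thesis by (simp add: ring_time_def level_def drain_def)
  qed
  have "(\<bbbE>w. cost z w) \<le> (\<bbbE>w. ennreal (interarrival (w ?n)) + 1)"
    by (rule nn_integral_mono_AE, use AE_sojourn_pos[OF z] in eventually_elim)
       (auto simp: cost_def intro!: add_right_mono ennreal_leI le)
  also have "\<dots> = (\<bbbE>w. ennreal (interarrival (w ?n))) + 1"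
    by (subst nn_integral_add) (simp_all add: P.emeasure_space_1)
  also have "(\<bbbE>w. ennreal (interarrival (w ?n))) = (\<integral>\<^sup>+y. ennreal y \<partial>exp_law lam)"
    by (subst nn_integral_resample_interarrival[of _ ?n]) (simp_all add: P.emeasure_space_1)
  finally show ?thesis by (simp add: nn_integral_exp_law_mean[OF lam_pos])
qed

lemma agree_path_cost: "agree z w w' \<Longrightarrow> path_cost N n z w = path_cost N n z w'"
proof (induction n arbitrary: z w w')
  case (Suc n)
  then show ?case
    using Suc.IH[OF agree_step[OF Suc.prems]] agree_follow[OF Suc.prems]
    by (simp add: cost_def agree_sojourn[OF Suc.prems])
qed simp

lemma measurable_path_cost: "z \<in> configs \<Longrightarrow> path_cost N n z \<in> borel_measurable fresh_law"
proof (induction n arbitrary: z)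
  case (Suc n)
  have "(\<lambda>w. path_cost N n (follow z w) (elapse z (sojourn z w) w)) \<in> borel_measurable fresh_law"
    by (rule measurable_config_compose[OF Suc.IH measurable_follow[OF Suc.prems] measurable_after_elapse[OF Suc.prems]])
  moreover have "path_cost N (Suc n) z = (\<lambda>w. cost z w +
     (if counts z = N then 0 else path_cost N n (follow z w) (elapse z (sojourn z w) w)))"
    by (simp add: fun_eq_iff)
  ultimately show ?case
    using measurable_cost[OF Suc.prems] by (cases "counts z = N") simp_all
next
  case 0
  have "path_cost N 0 z = (\<lambda>_. 0)" by (simp add: fun_eq_iff)
  then show ?case by simp
qed

lemma observable_path_cost: "observable (path_cost N n)"
  unfolding observable_def using measurable_path_cost agree_path_cost by blast

text \<open>
  The comparison principle for superharmonic functions: a function that pays for the cost of a step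
  and for its own mean after the step dominates the total cost up to hitting.
\<close>

theorem nn_integral_path_cost:
  assumes V: "\<And>z. valid z \<Longrightarrow> ennreal (1 / lam) + 1 + (if counts z = N then 0 else jump V z) \<le> V z"
  shows "valid z \<Longrightarrow> (\<bbbE>w. path_cost N n z w) \<le> V z"
proof (induction n arbitrary: z)
  case 0
  then show ?case by simp
next
  case (Suc n)
  note z = valid_configs[OF Suc.prems]
  have m: "(\<lambda>w. path_cost N n (follow z w) (elapse z (sojourn z w) w)) \<in> borel_measurable fresh_law"
    by (rule measurable_config_compose[OF observable_measurable[OF observable_path_cost] measurable_follow[OF z] measurable_after_elapse[OF z]])
  have "(\<bbbE>w. path_cost N (Suc n) z w) = (\<bbbE>w. cost z w) +
      (if counts z = N then 0 else (\<bbbE>w. path_cost N n (follow z w) (elapse z (sojourn z w) w)))"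
    using measurable_cost[OF z] m by (cases "counts z = N") (simp_all add: nn_integral_add)
  also have "\<dots> \<le> ennreal (1 / lam) + 1 + (if counts z = N then 0 else jump V z)"
    unfolding markov_property[OF observable_path_cost z]
    by (intro add_mono nn_integral_cost[OF z]) (simp add: jump_mono_valid[OF Suc.prems Suc.IH])
  also have "\<dots> \<le> V z" by (rule V[OF Suc.prems])
  finally show ?case .
qed

lemma miss_le_1: "z \<in> configs \<Longrightarrow> miss N k z \<le> 1"
  using reach_miss[of z N k] by (metis le_iff_add)

text \<open>
  The dominating function combines \<open>U\<close>, which decreases on average outside small populations, with
  \<open>g = (\<Sum>i<k. miss N i)\<close>, the expected number of steps before \<open>N\<close> is hit or \<open>k\<close> steps are over. Off
  the target \<open>g\<close> never increases on average, since its mean after a step is \<open>g - 1 + miss N k\<close>, and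
  on small populations it decreases by at least \<open>\<delta>\<close>, the minorising probability. A large enough
  multiple of \<open>g\<close> thus absorbs the bounded increase of \<open>U\<close> there.
\<close>

theorem foster:
  assumes U_fin: "\<And>z. U z < \<infinity>"
    and bounded: "\<And>z. valid z \<Longrightarrow> jump U z \<le> U z + ennreal C"
    and drift: "\<And>z. valid z \<Longrightarrow> L < length (jobs z) \<Longrightarrow> jump U z + ennreal e \<le> U z"
    and minor: "\<And>z. valid z \<Longrightarrow> length (jobs z) \<le> L \<Longrightarrow> ennreal \<delta> \<le> reach N k z"
    and pos: "0 < e" "0 < \<delta>" "0 \<le> C"
  obtains V where "\<And>z. valid z \<Longrightarrow> jump V z < \<infinity>"
    and "\<And>z. valid z \<Longrightarrow> ennreal (1 / lam) + 1 + (if counts z = N then 0 else jump V z) \<le> V z"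
proof -
  \<comment> \<open>\<open>a * e = c\<close> pays for a step by the drift of \<open>U\<close>, \<open>b * \<delta> = a * C + c\<close> by that of \<open>g\<close>.\<close>
  define c where "c = 1 / lam + 1"
  define a where "a = c / e"
  define b where "b = (a * C + c) / \<delta>"
  have c: "0 \<le> c" "ennreal (1 / lam) + 1 = ennreal c"
    using lam_pos by (simp_all add: c_def ennreal_plus)
  have a: "0 \<le> a" and b: "0 \<le> b" using c pos by (simp_all add: a_def b_def)
  define g where "g z = (\<Sum>i<k. miss N i z)" for z
  define V where "V z = ennreal c + (ennreal a * U z + ennreal b * g z)" for z
  have JV: "jump V z = ennreal c + (ennreal a * jump U z + ennreal b * jump g z)" if z: "z \<in> configs" for z
    unfolding V_def by (simp add: jump_add[OF z] jump_cmult[OF z] jump_const[OF z])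
  have g_le: "g z \<le> of_nat k" if z: "z \<in> configs" for z
  proof -
    have "g z \<le> (\<Sum>i<k. 1)" unfolding g_def by (intro sum_mono miss_le_1 z)
    then show ?thesis by simp
  qed
  have "jump V z < \<infinity>" if v: "valid z" for z
  proof -
    note z = valid_configs[OF v]
    have "jump g z \<le> jump (\<lambda>_. of_nat k) z"
      by (rule jump_mono_valid[OF v]) (rule g_le[OF valid_configs])
    then have "jump g z < \<infinity>" unfolding jump_const[OF z] by (auto simp: less_top [symmetric] top_unique)
    moreover have "jump U z < \<infinity>"
      using bounded[OF v] U_fin[of z] by (auto simp: less_top [symmetric] top_unique)
    ultimately show ?thesis unfolding JV[OF z] by (auto simp: ennreal_mult_less_top)
  qed
  moreover have "ennreal (1 / lam) + 1 + (if counts z = N then 0 else jump V z) \<le> V z" if v: "valid z" for z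
  proof (cases "counts z = N")
    case True
    then show ?thesis by (simp add: c V_def)
  next
    case False
    note z = valid_configs[OF v]
    have Jg: "jump g z + 1 = g z + miss N k z"
    proof -
      have "jump g z = (\<Sum>i<k. miss N (Suc i) z)"
        unfolding g_def using False by (simp add: jump_sum[OF z])
      then have "jump g z + 1 = (\<Sum>i<Suc k. miss N i z)"
        using False by (simp add: sum.lessThan_Suc_shift del: sum.lessThan_Suc miss.simps(2))
      then show ?thesis by (simp add: g_def)
    qed
    have mfin: "miss N k z < \<infinity>" and m1: "miss N k z \<le> 1"
    proof -
      show "miss N k z \<le> 1" by (rule miss_le_1[OF z])
      then show "miss N k z < \<infinity>" by (auto simp: less_top [symmetric] top_unique)
    qed
    have jg_le: "jump g z \<le> g z"
    proof -
      have "1 + jump g z \<le> 1 + g z" using add_left_mono[OF m1, of "g z"] Jg by (simp add: add.commute)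
      then show ?thesis by (simp add: ennreal_add_left_cancel_le)
    qed
    have key: "ennreal c + (ennreal a * jump U z + ennreal b * jump g z) \<le> ennreal a * U z + ennreal b * g z"
    proof (cases "L < length (jobs z)")
      case True
      have "ennreal c = ennreal a * ennreal e"
        using pos a by (simp add: a_def ennreal_mult' [symmetric])
      then have "ennreal c + (ennreal a * jump U z + ennreal b * jump g z)
        = ennreal a * (jump U z + ennreal e) + ennreal b * jump g z"
        by (simp add: distrib_left add_ac)
      also have "\<dots> \<le> ennreal a * U z + ennreal b * g z"
        by (intro add_mono mult_left_mono drift[OF v True] jg_le) simp_all
      finally show ?thesis .
    next
      case False
      then have r: "ennreal \<delta> \<le> reach N k z" using minor[OF v] by simp
      have "jump g z + ennreal \<delta> + miss N k z \<le> jump g z + (miss N k z + reach N k z)"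
        using r by (simp add: add_mono add_ac)
      also have "\<dots> = g z + miss N k z" unfolding reach_miss[OF z] by (rule Jg)
      finally have jg0: "jump g z + ennreal \<delta> + miss N k z \<le> g z + miss N k z" .
      have jg: "jump g z + ennreal \<delta> \<le> g z"
      proof -
        have "miss N k z + (jump g z + ennreal \<delta>) \<le> miss N k z + g z"
          using jg0 by (simp only: ac_simps)
        then show ?thesis using mfin by (auto simp: ennreal_add_left_cancel_le)
      qed
      have "ennreal a * ennreal C + ennreal c = ennreal b * ennreal \<delta>"
        using a b c pos by (simp add: b_def ennreal_mult' [symmetric] flip: ennreal_plus)
      then have "ennreal c + (ennreal a * (U z + ennreal C) + ennreal b * jump g z)
        = ennreal a * U z + ennreal b * (jump g z + ennreal \<delta>)"
        by (simp add: distrib_left add_ac)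
      also have "\<dots> \<le> ennreal a * U z + ennreal b * g z"
        by (intro add_mono mult_left_mono jg) simp_all
      finally have "ennreal c + (ennreal a * (U z + ennreal C) + ennreal b * jump g z) \<le> ennreal a * U z + ennreal b * g z" .
      moreover have "ennreal c + (ennreal a * jump U z + ennreal b * jump g z) \<le>
          ennreal c + (ennreal a * (U z + ennreal C) + ennreal b * jump g z)"
        using bounded[OF v] by (auto intro!: add_mono mult_left_mono)
      ultimately show ?thesis by (rule order_trans[rotated])
    qed
    have "ennreal c + jump V z \<le> V z"
      unfolding JV[OF z] V_def by (intro add_left_mono key)
    then show ?thesis using False by (simp add: c)
  qed
  ultimately show thesis by (rule that)
qed

section \<open>The quadratic Lyapunov function\<close>

text \<open>
  Given the configuration, the job in service under \<open>ROS\<close> is not uniform in its queue: it was when it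
  was chosen. If a job counts only until some server starts it, the counted departure happens at the
  moment of that uniform choice, and \<open>ROS\<close> obeys the same drift bound as \<open>PS\<close>.
\<close>

definition waiting :: "config \<Rightarrow> nat set" where
  "waiting z = (case pol of PS \<Rightarrow> set (jobs z)
     | ROS \<Rightarrow> {j \<in> set (jobs z). \<forall>s\<in>{1..K}. head z s \<noteq> Some j})"

definition waiting_at :: "config \<Rightarrow> nat \<Rightarrow> nat set" where
  "waiting_at z s = {j \<in> waiting z. s \<in> kind z j}"

definition quad :: "(nat \<Rightarrow> nat set) \<Rightarrow> nat set \<Rightarrow> real" where
  "quad \<kappa> W = (\<Sum>s\<in>{1..K}. (real (card {j \<in> W. s \<in> \<kappa> j}))\<^sup>2)"

definition energy :: "config \<Rightarrow> real" where
  "energy z = quad (kind z) (waiting z)"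

text \<open>
  Half the derivative of the energy in the direction of one more job of the type of \<open>j\<close>.
\<close>

definition pressure :: "config \<Rightarrow> nat \<Rightarrow> real" where
  "pressure z j = (\<Sum>s\<in>kind z j. real (card (waiting_at z s)))"

lemma waiting_PS: "pol = PS \<Longrightarrow> waiting z = set (jobs z)"
  unfolding waiting_def by simp

lemma waiting_ROS: "pol = ROS \<Longrightarrow> waiting z = {j \<in> set (jobs z). \<forall>s\<in>{1..K}. head z s \<noteq> Some j}"
  unfolding waiting_def by simp

lemma waiting_subset: "waiting z \<subseteq> set (jobs z)"
  by (auto simp: waiting_def split: policy.split)

lemma finite_waiting [simp]: "finite (waiting z)"
  by (rule finite_subset[OF waiting_subset]) simp

lemma finite_waiting_at [simp]: "finite (waiting_at z s)"
  by (simp add: waiting_at_def)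

lemma kind_type: "z \<in> configs \<Longrightarrow> j \<in> set (jobs z) \<Longrightarrow> kind z j \<in> job_types K d"
  by (auto simp: configs_def)

lemma waiting_kind:
  assumes "z \<in> configs" and "i \<in> waiting z"
  shows "kind z i \<subseteq> {1..K}" "card (kind z i) = d" "finite (kind z i)"
  using job_typeD[OF kind_type[OF assms(1)]] waiting_subset assms(2) by blast+

lemma quad_nonneg: "0 \<le> quad \<kappa> W"
  unfolding quad_def by (intro sum_nonneg) simp

lemma quad_mono: "finite W' \<Longrightarrow> W \<subseteq> W' \<Longrightarrow> quad \<kappa> W \<le> quad \<kappa> W'"
  unfolding quad_def by (intro sum_mono power_mono) (auto intro!: card_mono)

lemma quad_insert:
  assumes W: "finite W" "n \<notin> W" and c: "\<kappa> n \<subseteq> {1..K}"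
  shows "quad \<kappa> (insert n W) = quad \<kappa> W + (\<Sum>s\<in>\<kappa> n. 2 * real (card {j \<in> W. s \<in> \<kappa> j}) + 1)"
proof -
  let ?w = "\<lambda>s. real (card {j \<in> W. s \<in> \<kappa> j})"
  have card: "real (card {j \<in> insert n W. s \<in> \<kappa> j}) = ?w s + (if s \<in> \<kappa> n then 1 else 0)" for s
  proof (cases "s \<in> \<kappa> n")
    case True
    then have "{j \<in> insert n W. s \<in> \<kappa> j} = insert n {j \<in> W. s \<in> \<kappa> j}" by auto
    then show ?thesis using True W by simp
  next
    case False
    then have "{j \<in> insert n W. s \<in> \<kappa> j} = {j \<in> W. s \<in> \<kappa> j}" by auto
    then show ?thesis using False by simp
  qed
  have "quad \<kappa> (insert n W) = (\<Sum>s\<in>{1..K}. (?w s)\<^sup>2 + (if s \<in> \<kappa> n then 2 * ?w s + 1 else 0))"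
    unfolding quad_def card by (intro sum.cong) (auto simp: power2_eq_square algebra_simps)
  also have "\<dots> = quad \<kappa> W + (\<Sum>s\<in>{1..K} \<inter> \<kappa> n. 2 * ?w s + 1)"
    by (subst sum.distrib) (simp only: quad_def sum.inter_restrict[OF finite_atLeastAtMost])
  also have "{1..K} \<inter> \<kappa> n = \<kappa> n" using c by blast
  finally show ?thesis .
qed

lemma quad_cong: "(\<And>j. j \<in> W \<Longrightarrow> \<kappa> j = \<kappa>' j) \<Longrightarrow> quad \<kappa> W = quad \<kappa>' W"
  unfolding quad_def by (intro sum.cong refl arg_cong[where f="\<lambda>A. (real (card A))\<^sup>2"]) auto

lemma quad_remove:
  assumes z: "z \<in> configs" and i: "i \<in> waiting z"
  shows "quad (kind z) (waiting z - {i}) = energy z - (2 * pressure z i - real d)"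
proof -
  have t: "kind z i \<subseteq> {1..K}" "card (kind z i) = d" "finite (kind z i)"
    by (fact waiting_kind[OF z i])+
  have "energy z = quad (kind z) (waiting z - {i})
      + (\<Sum>s\<in>kind z i. 2 * real (card {j \<in> waiting z - {i}. s \<in> kind z j}) + 1)"
    unfolding energy_def using quad_insert[of "waiting z - {i}" i "kind z"] i t by (simp add: insert_absorb)
  also have "(\<Sum>s\<in>kind z i. 2 * real (card {j \<in> waiting z - {i}. s \<in> kind z j}) + 1)
      = (\<Sum>s\<in>kind z i. 2 * real (card (waiting_at z s)) - 1)"
  proof (rule sum.cong[OF refl])
    fix s assume s: "s \<in> kind z i"
    have "waiting_at z s = insert i {j \<in> waiting z - {i}. s \<in> kind z j}" using s i by (auto simp: waiting_at_def)
    then have "card (waiting_at z s) = Suc (card {j \<in> waiting z - {i}. s \<in> kind z j})" by simp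
    then show "2 * real (card {j \<in> waiting z - {i}. s \<in> kind z j}) + 1 = 2 * real (card (waiting_at z s)) - 1" by simp
  qed
  also have "\<dots> = 2 * pressure z i - real d"
    using t by (simp add: pressure_def sum_subtractf sum_distrib_left)
  finally show ?thesis by simp
qed

lemma pressure_ge:
  assumes z: "z \<in> configs" and i: "i \<in> waiting z"
  shows "real d \<le> pressure z i"
proof -
  have t: "card (kind z i) = d" "finite (kind z i)"
    by (fact waiting_kind[OF z i])+
  have "(\<Sum>s\<in>kind z i. 1) \<le> pressure z i"
    unfolding pressure_def
  proof (rule sum_mono)
    fix s assume "s \<in> kind z i"
    then have "waiting_at z s \<noteq> {}" using i by (auto simp: waiting_at_def)
    then have "0 < card (waiting_at z s)" by (simp add: card_gt_0_iff)
    then show "1 \<le> real (card (waiting_at z s))" by linarith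
  qed
  then show ?thesis using t by simp
qed

lemma sum_waiting_at:
  assumes z: "z \<in> configs"
  shows "(\<Sum>s\<in>{1..K}. \<Sum>i\<in>waiting_at z s. h i s) = (\<Sum>i\<in>waiting z. \<Sum>s\<in>kind z i. h i s)"
proof -
  have "(\<Sum>s\<in>{1..K}. \<Sum>i\<in>waiting_at z s. h i s) = (\<Sum>i\<in>waiting z. \<Sum>s\<in>{s\<in>{1..K}. s \<in> kind z i}. h i s)"
    unfolding waiting_at_def by (rule sum.swap_restrict) auto
  also have "\<dots> = (\<Sum>i\<in>waiting z. \<Sum>s\<in>kind z i. h i s)"
  proof (rule sum.cong[OF refl])
    fix i assume "i \<in> waiting z"
    then have "{s \<in> {1..K}. s \<in> kind z i} = kind z i" using waiting_kind(1)[OF z] by blast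
    then show "(\<Sum>s\<in>{s\<in>{1..K}. s \<in> kind z i}. h i s) = (\<Sum>s\<in>kind z i. h i s)" by simp
  qed
  finally show ?thesis .
qed

lemma sum_card_waiting_at:
  assumes z: "z \<in> configs"
  shows "(\<Sum>s\<in>{1..K}. real (card (waiting_at z s))) = real d * real (card (waiting z))"
proof -
  have "(\<Sum>s\<in>{1..K}. real (card (waiting_at z s))) = (\<Sum>s\<in>{1..K}. \<Sum>i\<in>waiting_at z s. 1)" by simp
  also have "\<dots> = (\<Sum>i\<in>waiting z. \<Sum>s\<in>kind z i. 1)" by (rule sum_waiting_at[OF z])
  also have "\<dots> = (\<Sum>i\<in>waiting z. real d)"
    using waiting_kind(2)[OF z] by (intro sum.cong) simp_all
  finally show ?thesis by (simp add: mult.commute)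
qed

subsection \<open>Effect of an arrival\<close>

lemma energy_admit:
  assumes z: "z \<in> configs" and c: "c \<in> job_types K d"
  shows "energy (admit z c) \<le> energy z + (\<Sum>s\<in>c. 2 * real (card (waiting_at z s)) + 1)"
proof -
  let ?n = "upcoming z" and ?\<kappa> = "(kind z)(upcoming z := c)"
  have new: "?n \<notin> waiting z" using z waiting_subset by (auto simp: configs_def)
  have "waiting (admit z c) \<subseteq> insert ?n (waiting z)"
    by (auto simp: waiting_def admit_def split: policy.splits)
  then have "energy (admit z c) \<le> quad ?\<kappa> (insert ?n (waiting z))"
    unfolding energy_def by (simp add: quad_mono admit_def)
  also have "\<dots> = quad ?\<kappa> (waiting z) + (\<Sum>s\<in>c. 2 * real (card {j \<in> waiting z. s \<in> ?\<kappa> j}) + 1)"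
    using quad_insert[of "waiting z" ?n ?\<kappa>] new job_typeD[OF c] by simp
  also have "quad ?\<kappa> (waiting z) = energy z"
    unfolding energy_def using new by (intro quad_cong) auto
  also have "(\<Sum>s\<in>c. 2 * real (card {j \<in> waiting z. s \<in> ?\<kappa> j}) + 1) = (\<Sum>s\<in>c. 2 * real (card (waiting_at z s)) + 1)"
  proof (rule sum.cong[OF refl])
    fix s
    have "{j \<in> waiting z. s \<in> ?\<kappa> j} = waiting_at z s" unfolding waiting_at_def using new by auto
    then show "2 * real (card {j \<in> waiting z. s \<in> ?\<kappa> j}) + 1 = 2 * real (card (waiting_at z s)) + 1" by simp
  qed
  finally show ?thesis .
qed

text \<open>
  The types that contain \<open>s\<close> arise from the \<open>(d - 1)\<close>-subsets of the other servers. In terms of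
  probabilities, a server belongs to a uniformly drawn type with probability \<open>d / K\<close>.
\<close>

lemma card_types_containing:
  assumes s: "s \<in> {1..K}"
  shows "K * card {c \<in> job_types K d. s \<in> c} = d * card (job_types K d)"
proof -
  let ?S = "{c. c \<subseteq> {1..K} - {s} \<and> card c = d - 1}"
  have "{c \<in> job_types K d. s \<in> c} = insert s ` ?S"
  proof (intro equalityI subsetI)
    fix c assume c: "c \<in> {c \<in> job_types K d. s \<in> c}"
    then have "c - {s} \<in> ?S" using job_typeD by fastforce
    moreover have "c = insert s (c - {s})" using c by auto
    ultimately show "c \<in> insert s ` ?S" by blast
  next
    fix c assume "c \<in> insert s ` ?S"
    then obtain b where b: "b \<subseteq> {1..K} - {s}" "card b = d - 1" "c = insert s b" by auto
    then have "finite b" "s \<notin> b" by (auto intro: finite_subset)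
    then show "c \<in> {c \<in> job_types K d. s \<in> c}"
      using b s d_pos by (auto simp: job_types_def)
  qed
  moreover have "inj_on (insert s) ?S"
    by (intro inj_onI) (metis (no_types, lifting) Diff_insert_absorb mem_Collect_eq subset_Diff_insert)
  ultimately have "card {c \<in> job_types K d. s \<in> c} = card ?S" by (simp add: card_image)
  also have "\<dots> = (K - 1) choose (d - 1)"
    using n_subsets[of "{1..K} - {s}" "d - 1"] s by simp
  moreover have "card (job_types K d) = K choose d"
    using n_subsets[of "{1..K}" d] by (simp add: job_types_def)
  ultimately show ?thesis using times_binomial_minus1_eq[of d K] d_pos by simp
qed

lemma average_over_types:
  fixes h :: "nat \<Rightarrow> real"
  shows "(\<Sum>c\<in>job_types K d. \<Sum>s\<in>c. h s) / real (card (job_types K d)) = real d / real K * (\<Sum>s\<in>{1..K}. h s)"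
proof -
  have K: "0 < K" using d_pos d_le by simp
  have "(\<Sum>c\<in>job_types K d. \<Sum>s\<in>c. h s) = (\<Sum>c\<in>job_types K d. \<Sum>s\<in>{s\<in>{1..K}. s \<in> c}. h s)"
  proof (rule sum.cong[OF refl])
    fix c assume "c \<in> job_types K d"
    then have "{s \<in> {1..K}. s \<in> c} = c" using job_typeD by blast
    then show "(\<Sum>s\<in>c. h s) = (\<Sum>s\<in>{s\<in>{1..K}. s \<in> c}. h s)" by simp
  qed
  also have "\<dots> = (\<Sum>s\<in>{1..K}. \<Sum>c\<in>{c\<in>job_types K d. s \<in> c}. h s)"
    by (rule sum.swap_restrict) (auto simp: finite_job_types)
  also have "\<dots> = (\<Sum>s\<in>{1..K}. real d * real (card (job_types K d)) / real K * h s)"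
  proof (rule sum.cong[OF refl])
    fix s assume "s \<in> {1..K}"
    then have "real K * real (card {c \<in> job_types K d. s \<in> c}) = real d * real (card (job_types K d))"
      using card_types_containing by (metis of_nat_mult)
    then show "(\<Sum>c\<in>{c\<in>job_types K d. s \<in> c}. h s) = real d * real (card (job_types K d)) / real K * h s"
      using K by (simp add: field_simps)
  qed
  also have "\<dots> = real d * real (card (job_types K d)) / real K * (\<Sum>s\<in>{1..K}. h s)"
    by (simp add: sum_distrib_left)
  moreover have "0 < card (job_types K d)"
    using job_types_nonempty finite_job_types by (simp add: card_gt_0_iff)
  ultimately show ?thesis by simp
qed

text \<open>
  An arrival of type \<open>c\<close> raises the energy by at most \<open>\<Sum>s\<in>c. 2 * W\<^sub>s + 1\<close>; this is the average of
  that bound over \<open>c\<close>.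
\<close>

definition arrival_gain :: "config \<Rightarrow> real" where
  "arrival_gain z = 2 * (real d)\<^sup>2 / real K * real (card (waiting z)) + real d"

lemma energy_arrival:
  assumes z: "z \<in> configs"
  shows "(\<bbbE>w. ennreal (energy (outcome z None w))) \<le> ennreal (energy z + arrival_gain z)"
proof -
  have K: "0 < K" using d_pos d_le by simp
  have n: "0 < card (job_types K d)"
    using job_types_nonempty finite_job_types by (simp add: card_gt_0_iff)
  let ?h = "\<lambda>c. energy z + (\<Sum>s\<in>c. 2 * real (card (waiting_at z s)) + 1)"
  have pos: "0 \<le> ?h c" for c
    using quad_nonneg by (intro add_nonneg_nonneg sum_nonneg) (auto simp: energy_def)
  have "(\<bbbE>w. ennreal (energy (outcome z None w)))
      = (\<Sum>c\<in>job_types K d. ennreal (energy (admit z c))) / of_nat (card (job_types K d))"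
    unfolding outcome_def option.case by (rule nn_integral_drawn_type)
  also have "\<dots> \<le> (\<Sum>c\<in>job_types K d. ennreal (?h c)) / of_nat (card (job_types K d))"
    by (intro divide_right_mono_ennreal sum_mono ennreal_leI energy_admit[OF z])
  also have "\<dots> = ennreal ((\<Sum>c\<in>job_types K d. ?h c) / real (card (job_types K d)))"
    using pos n by (simp add: sum_ennreal divide_ennreal ennreal_of_nat_eq_real_of_nat sum_nonneg)
  also have "(\<Sum>c\<in>job_types K d. ?h c) / real (card (job_types K d))
     = energy z + real d / real K * (\<Sum>s\<in>{1..K}. 2 * real (card (waiting_at z s)) + 1)"
    unfolding sum.distrib[of "\<lambda>_. energy z"] add_divide_distrib average_over_types using n by simp
  also have "(\<Sum>s\<in>{1..K}. 2 * real (card (waiting_at z s)) + 1) = 2 * (real d * real (card (waiting z))) + real K"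
    unfolding sum_card_waiting_at[OF z, symmetric] by (simp add: sum.distrib sum_distrib_left)
  also have "energy z + real d / real K * (2 * (real d * real (card (waiting z))) + real K) = energy z + arrival_gain z"
    using K by (simp add: arrival_gain_def field_simps power2_eq_square)
  finally show ?thesis .
qed

subsection \<open>Effect of a completion\<close>

text \<open>
  The unit interval splits into \<open>length q\<close> intervals of equal length on which the choice is constant.
\<close>

lemma nn_integral_choose_from:
  fixes \<phi> :: "nat option \<Rightarrow> ennreal"
  assumes q: "q \<noteq> []"
  shows "(\<integral>\<^sup>+u. \<phi> (choose_from u q) \<partial>uniform_measure lborel {0..<1}) =
    (\<Sum>i<length q. \<phi> (Some (q ! i))) / of_nat (length q)"
proof -
  let ?n = "real (length q)"
  have n: "0 < ?n" using q by simp
  let ?I = "\<lambda>i. {real i / ?n ..< real (Suc i) / ?n}"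
  have m: "(\<lambda>u. \<phi> (choose_from u q)) \<in> borel_measurable borel"
    by (rule measurable_compose[OF measurable_choose_from]) simp
  have "(\<integral>\<^sup>+u. \<phi> (choose_from u q) \<partial>uniform_measure lborel {0..<1}) =
     (\<integral>\<^sup>+u. \<phi> (choose_from u q) * indicator {0..<1} u \<partial>lborel)"
    using m by (subst nn_integral_uniform_measure) (auto simp: divide_ennreal_def)
  also have "\<dots> = (\<integral>\<^sup>+u. (\<Sum>i<length q. \<phi> (Some (q ! i)) * indicator (?I i) u) \<partial>lborel)"
  proof (rule nn_integral_cong)
    fix u :: real
    show "\<phi> (choose_from u q) * indicator {0..<1} u = (\<Sum>i<length q. \<phi> (Some (q ! i)) * indicator (?I i) u)"
    proof (cases "u \<in> {0..<1}")
      case True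
      let ?k = "nat \<lfloor>u * ?n\<rfloor>"
      have un: "0 \<le> u * ?n" "u * ?n < ?n" using True n by auto
      have k: "?k < length q" using un by (simp add: nat_less_iff floor_less_iff)
      have mem: "u \<in> ?I i \<longleftrightarrow> i = ?k" for i
      proof -
        have "u \<in> ?I i \<longleftrightarrow> real i \<le> u * ?n \<and> u * ?n < real i + 1" using n by (auto simp: field_simps)
        also have "\<dots> \<longleftrightarrow> \<lfloor>u * ?n\<rfloor> = int i" by (simp add: floor_eq_iff)
        also have "\<dots> \<longleftrightarrow> i = ?k" using un by auto
        finally show ?thesis .
      qed
      have "(\<Sum>i<length q. \<phi> (Some (q ! i)) * indicator (?I i) u) = (\<Sum>i<length q. if i = ?k then \<phi> (Some (q ! ?k)) else 0)"
        by (intro sum.cong refl) (simp only: indicator_def mem, simp)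
      also have "\<dots> = \<phi> (Some (q ! ?k))" using k by simp
      also have "\<dots> = \<phi> (choose_from u q) * indicator {0..<1} u" using True q by (simp add: choose_from_def)
      finally show ?thesis by simp
    next
      case False
      have "u \<notin> ?I i" if "i < length q" for i
      proof
        assume u: "u \<in> ?I i"
        have "0 \<le> real i / ?n" by simp
        moreover have "real (Suc i) / ?n \<le> 1" using that n by simp
        ultimately show False using u False unfolding atLeastLessThan_iff by linarith
      qed
      then have "(\<Sum>i<length q. \<phi> (Some (q ! i)) * indicator (?I i) u) = 0"
        by (intro sum.neutral) (simp add: indicator_def)
      then show ?thesis using False by simp
    qed
  qed
  also have "\<dots> = (\<Sum>i<length q. \<phi> (Some (q ! i)) * emeasure lborel (?I i))"
  proof (subst nn_integral_sum)
    show "(\<Sum>i<length q. \<integral>\<^sup>+u. \<phi> (Some (q ! i)) * indicator (?I i) u \<partial>lborel)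
        = (\<Sum>i<length q. \<phi> (Some (q ! i)) * emeasure lborel (?I i))"
      by (intro sum.cong refl nn_integral_cmult_indicator) simp
  qed simp
  also have "\<dots> = (\<Sum>i<length q. \<phi> (Some (q ! i)) / of_nat (length q))"
  proof (rule sum.cong[OF refl])
    fix i
    have "emeasure lborel (?I i) = ennreal (1 / ?n)"
      using n by (simp add: divide_right_mono add_divide_distrib)
    also have "\<dots> = inverse (of_nat (length q))"
      using n by (simp add: ennreal_of_nat_eq_real_of_nat inverse_ennreal inverse_eq_divide)
    finally show "\<phi> (Some (q ! i)) * emeasure lborel (?I i) = \<phi> (Some (q ! i)) / of_nat (length q)"
      by (simp add: divide_ennreal_def)
  qed
  finally show ?thesis by (simp add: divide_ennreal_def sum_distrib_right)
qed

lemma waiting_discharge: "waiting (discharge z {j} u) \<subseteq> waiting z - {j}"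
proof
  fix i assume i: "i \<in> waiting (discharge z {j} u)"
  show "i \<in> waiting z - {j}"
  proof (cases pol)
    case PS
    have "jobs (discharge z {j} u) = filter (\<lambda>i. i \<notin> {j}) (jobs z)" by (simp add: discharge_def)
    then show ?thesis using i unfolding waiting_PS[OF PS] by auto
  next
    case ROS
    have ij: "i \<in> set (jobs z)" "i \<noteq> j"
      and h: "\<And>s. s \<in> {1..K} \<Longrightarrow> head (discharge z {j} u) s \<noteq> Some i"
      using i unfolding waiting_ROS[OF ROS] by (auto simp: discharge_def)
    have "head z s \<noteq> Some i" if "s \<in> {1..K}" for s
      using h[OF that] ij by (auto simp: discharge_def)
    then show ?thesis using ij unfolding waiting_ROS[OF ROS] by blast
  qed
qed

definition relief :: "config \<Rightarrow> nat \<Rightarrow> real" where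
  "relief z i = 2 * pressure z i - real d"

text \<open>
  A lower bound for the mean decrease of the energy when the copy of job \<open>j\<close> in server \<open>s\<close> completes.
  Under \<open>PS\<close> job \<open>j\<close> itself stops waiting. Under \<open>ROS\<close> it does not wait, but server \<open>s\<close> then chooses
  uniformly among the other jobs of its queue; those already in service contribute nothing.
\<close>

definition mean_relief :: "config \<Rightarrow> nat \<Rightarrow> nat \<Rightarrow> real" where
  "mean_relief z j s = (case pol of PS \<Rightarrow> relief z j
     | ROS \<Rightarrow> (\<Sum>i\<in>waiting_at z s. relief z i) / real (length (line z s) - 1))"

lemma relief_nonneg: "z \<in> configs \<Longrightarrow> i \<in> waiting z \<Longrightarrow> 0 \<le> relief z i"
  using pressure_ge[of z i] by (simp add: relief_def)

lemma energy_without: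
  assumes z: "z \<in> configs" and i: "i \<in> waiting z" and W: "waiting z' \<subseteq> waiting z - {i}" and "kind z' = kind z"
  shows "energy z' \<le> energy z - relief z i"
proof -
  have "energy z' \<le> quad (kind z) (waiting z - {i})"
    unfolding energy_def assms(4) by (intro quad_mono W) simp
  then show ?thesis by (simp add: quad_remove[OF z i] relief_def)
qed

lemma relief_le: "z \<in> configs \<Longrightarrow> i \<in> waiting z \<Longrightarrow> relief z i \<le> energy z"
  using quad_remove[of z i] quad_nonneg[of "kind z" "waiting z - {i}"] by (simp add: relief_def)

lemma copies_ROS: "pol = ROS \<Longrightarrow> (j, s) \<in> copies z \<longleftrightarrow> j \<in> set (line z s) \<and> head z s = Some j"
  unfolding copies_def rate_def line_def by auto

lemma copies_PS: "pol = PS \<Longrightarrow> (j, s) \<in> copies z \<longleftrightarrow> j \<in> set (line z s)"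
  unfolding copies_def rate_def line_def by (auto simp: filter_empty_conv)

lemma mean_relief_PS: "pol = PS \<Longrightarrow> mean_relief z j s = relief z j"
  unfolding mean_relief_def by simp

lemma mean_relief_ROS: "pol = ROS \<Longrightarrow> mean_relief z j s = (\<Sum>i\<in>waiting_at z s. relief z i) / real (length (line z s) - 1)"
  unfolding mean_relief_def by simp

text \<open>
  Under \<open>ROS\<close> several servers may choose a new job at the same time, namely all that were serving
  \<open>j\<close>. Only the choice of server \<open>s\<close> is taken into account: the energy is monotone in the set of waiting
  jobs, so the other choices can only lower it further.
\<close>

lemma energy_completion:
  assumes z: "z \<in> configs" and js: "(j, s) \<in> copies z"
  shows "(\<bbbE>w. ennreal (energy (outcome z (Some (j, s)) w))) \<le> ennreal (energy z - mean_relief z j s)"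
    and "mean_relief z j s \<le> energy z"
proof -
  have s: "s \<in> {1..K}" and j: "j \<in> set (jobs z)" "s \<in> kind z j"
    using finite_copies(2)[OF z] js by (auto simp: copies_def rate_def split: if_splits)
  have out: "outcome z (Some (j, s)) w = discharge z {j} (\<lambda>j. choice_var (w j))" for w
    by (simp add: outcome_def)
  have "(\<bbbE>w. ennreal (energy (outcome z (Some (j, s)) w))) \<le> ennreal (energy z - mean_relief z j s) \<and> mean_relief z j s \<le> energy z"
  proof (cases pol)
    case PS
    have jw: "j \<in> waiting z" using j unfolding waiting_PS[OF PS] by blast
    have "energy (outcome z (Some (j, s)) w) \<le> energy z - mean_relief z j s" for w
      unfolding out mean_relief_PS[OF PS] by (rule energy_without[OF z jw waiting_discharge]) (simp add: discharge_def)
    then have "(\<bbbE>w. ennreal (energy (outcome z (Some (j, s)) w))) \<le> (\<bbbE>w. ennreal (energy z - mean_relief z j s))"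
      by (intro nn_integral_mono ennreal_leI)
    then show ?thesis using relief_le[OF z jw] by (simp add: P.emeasure_space_1 mean_relief_PS[OF PS])
  next
    case ROS
    have h: "head z s = Some j" using js copies_ROS[OF ROS] by blast
    define q where "q = filter (\<lambda>i. s \<in> kind z i) (filter (\<lambda>i. i \<notin> {j}) (jobs z))"
    have dist: "distinct (jobs z)" using z by (simp add: configs_def)
    have dq: "distinct q" using dist by (simp add: q_def)
    have "line z s = filter (\<lambda>i. s \<in> kind z i) (jobs z)" by (simp add: line_def)
    moreover have "q = removeAll j (line z s)" unfolding q_def line_def removeAll_filter_not_eq
      by (auto intro!: filter_cong)
    ultimately have lq: "length q = length (line z s) - 1" 
      using j dist by (simp add: distinct_remove1_removeAll[symmetric] length_remove1)
    have setq: "set q = {i \<in> set (jobs z). s \<in> kind z i \<and> i \<noteq> j}" by (auto simp: q_def)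
    have jnw: "j \<notin> waiting z" using h s unfolding waiting_ROS[OF ROS] by blast
    have wq: "waiting_at z s \<subseteq> set q" unfolding setq waiting_at_def using waiting_subset jnw by auto
    define g where "g i = (if i \<in> waiting z then relief z i else 0)" for i
    have g: "0 \<le> g i" "g i \<le> energy z" for i
      using relief_nonneg[OF z] relief_le[OF z] quad_nonneg by (auto simp: g_def energy_def)
    have sumg: "(\<Sum>i\<in>set q. g i) = (\<Sum>i\<in>waiting_at z s. relief z i)"
    proof -
      have "(\<Sum>i\<in>set q. g i) = (\<Sum>i\<in>waiting_at z s. g i)"
        using wq by (intro sum.mono_neutral_right) (auto simp: g_def waiting_at_def setq)
      then show ?thesis by (simp add: g_def waiting_at_def)
    qed
    define \<phi> where "\<phi> v = (case v of None \<Rightarrow> ennreal (energy z) | Some i \<Rightarrow> ennreal (energy z - g i))" for v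
    have le: "ennreal (energy (outcome z (Some (j, s)) w)) \<le> \<phi> (choose_from (choice_var (w j) s) q)" for w
    proof -
      let ?z' = "discharge z {j} (\<lambda>j. choice_var (w j))"
      have k: "kind ?z' = kind z" by (simp add: discharge_def)
      have base: "energy ?z' \<le> energy z"
        unfolding energy_def k using waiting_discharge by (intro quad_mono) auto
      show ?thesis
      proof (cases "choose_from (choice_var (w j) s) q")
        case None
        then show ?thesis using base by (simp add: \<phi>_def out ennreal_leI)
      next
        case (Some i)
        have "head ?z' s = Some i" using Some h by (simp add: discharge_def q_def)
        then have "i \<notin> waiting ?z'" using s unfolding waiting_ROS[OF ROS] by blast
        then have "waiting ?z' \<subseteq> waiting z - {i}" using waiting_discharge by blast
        then have "energy ?z' \<le> energy z - g i"
          using energy_without[OF z _ _ k] base by (auto simp: g_def)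
        then show ?thesis by (simp add: \<phi>_def out Some ennreal_leI)
      qed
    qed
    have "(\<bbbE>w. ennreal (energy (outcome z (Some (j, s)) w)))
        \<le> (\<bbbE>w. \<phi> (choose_from (choice_var (w j) s) q))"
      by (intro nn_integral_mono le)
    also have "\<dots> = (\<integral>\<^sup>+u. \<phi> (choose_from u q) \<partial>uniform_measure lborel {0..<1})"
      by (rule nn_integral_choice_var) (rule measurable_compose[OF measurable_choose_from], simp)
    also have "\<dots> = ennreal (energy z - mean_relief z j s)"
    proof (cases "q = []")
      case True
      then show ?thesis using lq prob_space.emeasure_space_1[OF prob_space_unif]
        by (simp add: choose_from_def \<phi>_def mean_relief_ROS[OF ROS])
    next
      case False
      have "(\<Sum>i<length q. \<phi> (Some (q ! i))) = (\<Sum>i<length q. ennreal (energy z - g (q ! i)))"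
        by (simp add: \<phi>_def)
      also have "\<dots> = (\<Sum>i\<in>set q. ennreal (energy z - g i))"
        by (rule sum.reindex_bij_betw[OF bij_betw_nth[OF dq]]) auto
      also have "\<dots> = ennreal (\<Sum>i\<in>set q. energy z - g i)"
        using g by (intro sum_ennreal) simp
      also have "(\<Sum>i\<in>set q. energy z - g i) = real (length q) * energy z - (\<Sum>i\<in>waiting_at z s. relief z i)"
        using dq by (simp add: sum_subtractf sumg distinct_card)
      finally have "(\<Sum>i<length q. \<phi> (Some (q ! i))) = ennreal (real (length q) * energy z - (\<Sum>i\<in>waiting_at z s. relief z i))" .
      moreover have nn: "0 \<le> real (length q) * energy z - (\<Sum>i\<in>waiting_at z s. relief z i)"
      proof -
        have "(\<Sum>i\<in>set q. g i) \<le> (\<Sum>i\<in>set q. energy z)" by (intro sum_mono g)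
        then show ?thesis using dq by (simp add: sumg distinct_card)
      qed
      moreover have n: "0 < real (length q)" using False by simp
      ultimately have "(\<integral>\<^sup>+u. \<phi> (choose_from u q) \<partial>uniform_measure lborel {0..<1})
          = ennreal ((real (length q) * energy z - (\<Sum>i\<in>waiting_at z s. relief z i)) / real (length q))"
        unfolding nn_integral_choose_from[OF False] by (simp only: ennreal_of_nat_eq_real_of_nat divide_ennreal)
      also have "(real (length q) * energy z - (\<Sum>i\<in>waiting_at z s. relief z i)) / real (length q) = energy z - mean_relief z j s"
        using n unfolding mean_relief_ROS[OF ROS] lq[symmetric] by (simp add: field_simps)
      finally show ?thesis .
    qed
    finally have 1: "(\<bbbE>w. ennreal (energy (outcome z (Some (j, s)) w))) \<le> ennreal (energy z - mean_relief z j s)" .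
    have "mean_relief z j s \<le> energy z"
    proof (cases "q = []")
      case True
      then show ?thesis using lq quad_nonneg by (simp add: mean_relief_ROS[OF ROS] energy_def)
    next
      case False
      have "(\<Sum>i\<in>set q. g i) \<le> (\<Sum>i\<in>set q. energy z)" by (intro sum_mono g)
      then have "(\<Sum>i\<in>waiting_at z s. relief z i) \<le> real (length q) * energy z"
        using dq by (simp add: sumg distinct_card)
      moreover have "0 < real (length q)" using False by simp
      ultimately show ?thesis unfolding mean_relief_ROS[OF ROS] lq[symmetric] by (simp add: field_simps)
    qed
    with 1 show ?thesis by blast
  qed
  then show "(\<bbbE>w. ennreal (energy (outcome z (Some (j, s)) w))) \<le> ennreal (energy z - mean_relief z j s)"
    and "mean_relief z j s \<le> energy z" by blast+
qed

subsection \<open>The drift\<close>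

text \<open>
  The rate of decrease of the energy caused by server \<open>s\<close>, per unit of \<open>mu\<close>, in a form common to both
  policies: the job that stops waiting is uniform among at most \<open>card (waiting_at z s) + K\<close> jobs.
\<close>

definition gain :: "config \<Rightarrow> nat \<Rightarrow> real" where
  "gain z s = (\<Sum>i\<in>waiting_at z s. relief z i) / real (card (waiting_at z s) + K)"

definition served :: "config \<Rightarrow> nat \<Rightarrow> nat set" where
  "served z s = {j. (j, s) \<in> copies z}"

lemma finite_served:
  assumes "z \<in> configs" shows "finite (served z s)"
proof (rule finite_subset)
  show "served z s \<subseteq> fst ` copies z" unfolding served_def by (force intro: rev_image_eqI)
  show "finite (fst ` copies z)" using finite_copies(1)[OF assms] by simp
qed

lemma served_PS: "pol = PS \<Longrightarrow> served z s = set (line z s)"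
  unfolding served_def using copies_PS by blast

lemma served_ROS:
  assumes "pol = ROS" "valid z" "s \<in> {1..K}"
  shows "served z s = (case head z s of None \<Rightarrow> {} | Some j \<Rightarrow> {j})"
proof -
  have "case head z s of None \<Rightarrow> line z s = [] | Some j \<Rightarrow> j \<in> set (line z s)"
    using assms unfolding valid_def by blast
  then show ?thesis
    unfolding served_def by (auto simp: copies_ROS[OF assms(1)] split: option.splits)
qed

lemma rate_PS: "pol = PS \<Longrightarrow> j \<in> set (line z s) \<Longrightarrow> rate z j s = 1 / real (length (line z s))"
  unfolding rate_def by (simp add: line_def)

lemma rate_ROS: "pol = ROS \<Longrightarrow> (j, s) \<in> copies z \<Longrightarrow> rate z j s = 1"
  unfolding copies_def rate_def by (auto split: if_splits)

lemma sum_rate: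
  assumes z: "valid z" and s: "s \<in> {1..K}"
  shows "(\<Sum>j\<in>served z s. rate z j s) = (if line z s = [] then 0 else 1)"
proof (cases pol)
  case PS
  have d: "distinct (line z s)" using valid_configs[OF z] by (simp add: configs_def line_def)
  have "(\<Sum>j\<in>served z s. rate z j s) = (\<Sum>j\<in>set (line z s). 1 / real (length (line z s)))"
    unfolding served_PS[OF PS] by (intro sum.cong refl rate_PS[OF PS])
  then show ?thesis by (simp add: distinct_card[OF d])
next
  case ROS
  have v: "case head z s of None \<Rightarrow> line z s = [] | Some j \<Rightarrow> j \<in> set (line z s)"
    using ROS z s unfolding valid_def by blast
  show ?thesis
  proof (cases "head z s")
    case None
    then show ?thesis using v by (simp add: served_ROS[OF ROS z s])
  next
    case (Some j)
    then have "(j, s) \<in> copies z" using v by (simp add: copies_ROS[OF ROS])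
    then show ?thesis using v Some rate_ROS[OF ROS] by (auto simp: served_ROS[OF ROS z s])
  qed
qed

text \<open>
  Each of the \<open>K\<close> servers keeps at most one job from waiting.
\<close>

lemma card_le_waiting:
  assumes J: "J \<subseteq> set (jobs z)"
  shows "card J \<le> card (J \<inter> waiting z) + K"
proof -
  have "J \<subseteq> (J \<inter> waiting z) \<union> (the \<circ> head z) ` {1..K}"
  proof
    fix j assume j: "j \<in> J"
    show "j \<in> (J \<inter> waiting z) \<union> (the \<circ> head z) ` {1..K}"
    proof (cases "j \<in> waiting z")
      case False
      then obtain s where "s \<in> {1..K}" "head z s = Some j"
        using j J by (auto simp: waiting_def split: policy.splits)
      then have "j \<in> (the \<circ> head z) ` {1..K}" by force
      then show ?thesis by blast
    qed (use j in simp)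
  qed
  then have "card J \<le> card ((J \<inter> waiting z) \<union> (the \<circ> head z) ` {1..K})"
    by (intro card_mono) auto
  also have "\<dots> \<le> card (J \<inter> waiting z) + card ((the \<circ> head z) ` {1..K})" by (rule card_Un_le)
  also have "card ((the \<circ> head z) ` {1..K}) \<le> K"
    using card_image_le[of "{1..K}" "the \<circ> head z"] by simp
  finally show ?thesis by simp
qed

lemma length_line:
  assumes z: "z \<in> configs" shows "length (line z s) \<le> card (waiting_at z s) + K"
proof -
  have "distinct (line z s)" using z by (simp add: configs_def line_def)
  moreover have "set (line z s) \<inter> waiting z = waiting_at z s" "set (line z s) \<subseteq> set (jobs z)"
    using waiting_subset by (auto simp: waiting_at_def line_def)
  ultimately show ?thesis using card_le_waiting[of "set (line z s)" z] by (simp add: distinct_card)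
qed

lemma length_jobs:
  assumes z: "z \<in> configs" shows "length (jobs z) \<le> card (waiting z) + K"
proof -
  have "distinct (jobs z)" using z by (simp add: configs_def)
  then show ?thesis
    using card_le_waiting[of "set (jobs z)" z] by (simp add: distinct_card Int_absorb1[OF waiting_subset])
qed

text \<open>
  A busy server works at total rate 1; under \<open>PS\<close> the rate is split evenly over its queue, under \<open>ROS\<close>
  the chosen job is uniform in the queue. Both replace the true queue length by the larger
  denominator of \<open>gain\<close>.
\<close>

lemma gain_le_sum_mean_relief:
  assumes z: "valid z" and s: "s \<in> {1..K}"
  shows "gain z s \<le> (\<Sum>j\<in>served z s. rate z j s * mean_relief z j s)"
proof -
  have zc: "z \<in> configs" by (rule valid_configs[OF z])
  have K: "0 < K" using d_pos d_le by simp
  have R: "0 \<le> (\<Sum>i\<in>waiting_at z s. relief z i)"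
    using relief_nonneg[OF zc] by (intro sum_nonneg) (auto simp: waiting_at_def)
  have wl: "waiting_at z s \<subseteq> set (line z s)" using waiting_subset by (auto simp: waiting_at_def line_def)
  show ?thesis
  proof (cases "waiting_at z s = {}")
    case True
    have "0 \<le> rate z j s * mean_relief z j s" if j: "j \<in> served z s" for j
    proof (cases pol)
      case PS
      have "j \<in> waiting_at z s" using j
        unfolding served_PS[OF PS] waiting_at_def waiting_PS[OF PS] by (simp add: line_def)
      then show ?thesis using True by simp
    next
      case ROS
      show ?thesis unfolding mean_relief_ROS[OF ROS] True by simp
    qed
    then show ?thesis using True by (simp add: gain_def sum_nonneg)
  next
    case False
    show ?thesis
    proof (cases pol)
      case PS
      have eq: "set (line z s) = waiting_at z s" by (auto simp: waiting_at_def line_def waiting_PS[OF PS])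
      have d: "distinct (line z s)" using zc by (simp add: configs_def line_def)
      have n: "length (line z s) = card (waiting_at z s)" using distinct_card[OF d] eq by simp
      have c: "0 < card (waiting_at z s)" using False by (simp add: card_gt_0_iff)
      have "(\<Sum>j\<in>served z s. rate z j s * mean_relief z j s) = (\<Sum>i\<in>waiting_at z s. relief z i) / real (card (waiting_at z s))"
        unfolding served_PS[OF PS] eq sum_divide_distrib
        by (intro sum.cong refl) (simp add: rate_PS[OF PS] eq n mean_relief_PS[OF PS])
      moreover have "gain z s \<le> (\<Sum>i\<in>waiting_at z s. relief z i) / real (card (waiting_at z s))"
        unfolding gain_def using R c by (intro divide_left_mono) auto
      ultimately show ?thesis by simp
    next
      case ROS
      have v: "case head z s of None \<Rightarrow> line z s = [] | Some j \<Rightarrow> j \<in> set (line z s)"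
        using ROS z s unfolding valid_def by blast
      obtain i where i: "i \<in> waiting_at z s" using False by blast
      have "line z s \<noteq> []" using i wl by auto
      then obtain j where h: "head z s = Some j" using v by (auto split: option.splits)
      then have j: "j \<in> set (line z s)" using v by simp
      have "(j, s) \<in> copies z" using h j by (simp add: copies_ROS[OF ROS])
      then have eq: "(\<Sum>j\<in>served z s. rate z j s * mean_relief z j s) = mean_relief z j s"
        using h by (simp add: served_ROS[OF ROS z s] rate_ROS[OF ROS])
      have "i \<noteq> j" using i h s unfolding waiting_at_def waiting_ROS[OF ROS] by blast
      then have "{i, j} \<subseteq> set (line z s)" "card {i, j} = 2" using i j wl by auto
      then have "2 \<le> card (set (line z s))" by (metis card_mono finite_set)
      then have l: "2 \<le> length (line z s)" using card_length[of "line z s"] by linarith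
      have "gain z s \<le> mean_relief z j s"
        unfolding gain_def mean_relief_ROS[OF ROS] using R l length_line[OF zc, of s]
        by (intro divide_left_mono) auto
      then show ?thesis by (simp add: eq)
    qed
  qed
qed

lemma sum_times_sum_inverse:
  fixes a :: "'a \<Rightarrow> real"
  assumes "finite A" and pos: "\<And>x. x \<in> A \<Longrightarrow> 0 < a x"
  shows "(real (card A))\<^sup>2 \<le> (\<Sum>x\<in>A. a x) * (\<Sum>x\<in>A. 1 / a x)"
proof -
  have "(\<Sum>x\<in>A. sqrt (a x) * sqrt (1 / a x))\<^sup>2 \<le> (\<Sum>x\<in>A. (sqrt (a x))\<^sup>2) * (\<Sum>x\<in>A. (sqrt (1 / a x))\<^sup>2)"
    by (rule Cauchy_Schwarz_ineq_sum)
  moreover have "(\<Sum>x\<in>A. sqrt (a x) * sqrt (1 / a x)) = real (card A)"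
  proof -
    have "sqrt (a x) * sqrt (1 / a x) = 1" if "x \<in> A" for x
      using pos[OF that] by (simp add: real_sqrt_mult [symmetric])
    then show ?thesis by simp
  qed
  moreover have "(\<Sum>x\<in>A. (sqrt (a x))\<^sup>2) = (\<Sum>x\<in>A. a x)"
    using pos by (intro sum.cong) (auto simp: less_imp_le)
  moreover have "(\<Sum>x\<in>A. (sqrt (1 / a x))\<^sup>2) = (\<Sum>x\<in>A. 1 / a x)"
    using pos by (intro sum.cong refl real_sqrt_pow2) (simp add: less_imp_le)
  ultimately show ?thesis by simp
qed

text \<open>
  The price for the \<open>K\<close> in the denominators and for the second-order terms \<open>d\<close> in \<open>relief\<close>.
\<close>

definition slack :: real where
  "slack = 2 * real d * (real K)\<^sup>2 + real d * real K"

text \<open>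
  Exchange the sums over servers and waiting jobs. A waiting job \<open>i\<close> contributes twice its pressure
  times \<open>\<Sum>s\<in>kind z i. 1 / (W\<^sub>s + K)\<close>. Up to the shift by \<open>K\<close> the two factors are a sum and the sum of
  the reciprocals of the same \<open>d\<close> numbers, whose product is at least \<open>d\<^sup>2\<close>.
\<close>

lemma total_gain:
  assumes z: "z \<in> configs"
  shows "2 * (real d)\<^sup>2 * real (card (waiting z)) - slack \<le> (\<Sum>s\<in>{1..K}. gain z s)"
proof -
  have K: "0 < K" using d_pos d_le by simp
  define a where "a s = real (card (waiting_at z s) + K)" for s
  have a: "0 < a s" for s using K by (simp add: a_def)
  have frac: "(\<Sum>s\<in>{1..K}. real (card (waiting_at z s)) / a s) \<le> real K"
  proof -
    have "(\<Sum>s\<in>{1..K}. real (card (waiting_at z s)) / a s) \<le> (\<Sum>s\<in>{1..K}. 1)"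
      using a by (intro sum_mono) (simp add: a_def)
    then show ?thesis by simp
  qed
  have press: "(real d)\<^sup>2 - real d * real K * (\<Sum>s\<in>kind z i. 1 / a s) \<le> pressure z i * (\<Sum>s\<in>kind z i. 1 / a s)"
    if i: "i \<in> waiting z" for i
  proof -
    note t = waiting_kind[OF z i]
    have "pressure z i = (\<Sum>s\<in>kind z i. a s) - real d * real K"
      using t by (simp add: pressure_def a_def sum.distrib)
    moreover have "(real d)\<^sup>2 \<le> (\<Sum>s\<in>kind z i. a s) * (\<Sum>s\<in>kind z i. 1 / a s)"
      using sum_times_sum_inverse[OF t(3), of a] a t by simp
    ultimately show ?thesis by (simp add: left_diff_distrib)
  qed
  have inv: "(\<Sum>i\<in>waiting z. \<Sum>s\<in>kind z i. 1 / a s) = (\<Sum>s\<in>{1..K}. real (card (waiting_at z s)) / a s)"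
    by (simp add: sum_waiting_at[OF z, of "\<lambda>_ s. 1 / a s", symmetric])
  have "(\<Sum>s\<in>{1..K}. gain z s) = (\<Sum>s\<in>{1..K}. \<Sum>i\<in>waiting_at z s. relief z i * (1 / a s))"
    by (simp add: gain_def a_def sum_divide_distrib)
  also have "\<dots> = (\<Sum>i\<in>waiting z. \<Sum>s\<in>kind z i. relief z i * (1 / a s))"
    by (rule sum_waiting_at[OF z])
  also have "\<dots> = (\<Sum>i\<in>waiting z. relief z i * (\<Sum>s\<in>kind z i. 1 / a s))"
    by (simp add: sum_distrib_left)
  also have "\<dots> \<ge> (\<Sum>i\<in>waiting z. 2 * (real d)\<^sup>2 - (2 * real d * real K + real d) * (\<Sum>s\<in>kind z i. 1 / a s))"
  proof (rule sum_mono)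
    fix i assume i: "i \<in> waiting z"
    show "2 * (real d)\<^sup>2 - (2 * real d * real K + real d) * (\<Sum>s\<in>kind z i. 1 / a s) \<le> relief z i * (\<Sum>s\<in>kind z i. 1 / a s)"
      using press[OF i] by (simp add: relief_def algebra_simps)
  qed
  moreover have "(\<Sum>i\<in>waiting z. 2 * (real d)\<^sup>2 - (2 * real d * real K + real d) * (\<Sum>s\<in>kind z i. 1 / a s))
     = 2 * (real d)\<^sup>2 * real (card (waiting z)) - (2 * real d * real K + real d) * (\<Sum>s\<in>{1..K}. real (card (waiting_at z s)) / a s)"
    by (simp add: sum_subtractf sum_distrib_left[symmetric] inv)
  moreover have "(2 * real d * real K + real d) * (\<Sum>s\<in>{1..K}. real (card (waiting_at z s)) / a s) \<le> (2 * real d * real K + real d) * real K"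
    using frac by (intro mult_left_mono) auto
  ultimately show ?thesis by (simp add: slack_def power2_eq_square algebra_simps)
qed

lemma sum_copies:
  assumes z: "z \<in> configs"
  shows "(\<Sum>p\<in>copies z. h (fst p) (snd p)) = (\<Sum>s\<in>{1..K}. \<Sum>j\<in>served z s. h j s)"
proof -
  have "(\<Sum>s\<in>{1..K}. \<Sum>j\<in>served z s. h j s) = (\<Sum>q\<in>Sigma {1..K} (served z). h (snd q) (fst q))"
    by (subst sum.Sigma) (auto simp: finite_served[OF z] case_prod_beta)
  also have "\<dots> = (\<Sum>p\<in>copies z. h (fst p) (snd p))"
    using finite_copies(2)[OF z]
    by (intro sum.reindex_bij_witness[of _ "\<lambda>p. (snd p, fst p)" "\<lambda>q. (snd q, fst q)"])
       (auto simp: served_def)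
  finally show ?thesis by simp
qed

lemma sum_clocks:
  assumes z: "z \<in> configs"
  shows "(\<Sum>k\<in>clocks z. h k) = h None + (\<Sum>p\<in>copies z. h (Some p))"
  unfolding clocks_def by (simp add: finite_copies[OF z] sum.reindex)

lemma total_eq:
  assumes z: "z \<in> configs"
  shows "total z = lam + mu * (\<Sum>s\<in>{1..K}. \<Sum>j\<in>served z s. rate z j s)"
  unfolding total_def sum_clocks[OF z] sum_copies[OF z, symmetric]
  by (simp add: intensity_def hazard_def drain_def case_prod_beta sum_distrib_left)

lemma total_le:
  assumes z: "valid z" shows "total z \<le> lam + mu * real K" "lam \<le> total z"
proof -
  have "(\<Sum>s\<in>{1..K}. \<Sum>j\<in>served z s. rate z j s) \<le> (\<Sum>s\<in>{1..K}. 1)"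
    by (intro sum_mono) (simp add: sum_rate[OF z])
  then show "total z \<le> lam + mu * real K"
    unfolding total_eq[OF valid_configs[OF z]] using mu_pos by simp
  show "lam \<le> total z"
    unfolding total_eq[OF valid_configs[OF z]] using mu_pos
    by (simp add: sum_nonneg rate_nonneg)
qed

text \<open>
  Arrivals contribute at most \<open>lam * arrival_gain z\<close> and departures at most
  \<open>- mu * (\<Sum>s\<in>{1..K}. gain z s)\<close>. Both are bounded by linear functions of the number of waiting jobs,
  with slopes \<open>2 * d\<^sup>2 * lam / K\<close> and \<open>- 2 * d\<^sup>2 * mu\<close>; \<open>total z\<close> converts rates into means per step.
\<close>

lemma jump_energy:
  assumes z: "valid z"
  shows "jump (\<lambda>z. ennreal (energy z)) z \<le> ennreal (energy z +
     (lam * real d + mu * slack - 2 * (real d)\<^sup>2 * (mu - lam / real K) * real (card (waiting z))) / total z)"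
      (is "_ \<le> ennreal ?x")
    and "0 \<le> energy z +
     (lam * real d + mu * slack - 2 * (real d)\<^sup>2 * (mu - lam / real K) * real (card (waiting z))) / total z"
proof -
  have zc: "z \<in> configs" by (rule valid_configs[OF z])
  have T: "0 < total z" by (rule total_pos[OF zc])
  define e where "e k = (case k of None \<Rightarrow> arrival_gain z | Some (j, s) \<Rightarrow> - mean_relief z j s)" for k
  have step: "(\<bbbE>w. ennreal (energy (outcome z k w))) \<le> ennreal (energy z + e k)" "0 \<le> energy z + e k"
    if k: "k \<in> clocks z" for k
    using k energy_arrival[OF zc] energy_completion[OF zc] quad_nonneg
    by (auto simp: clocks_def e_def arrival_gain_def energy_def)
  have "jump (\<lambda>z. ennreal (energy z)) z \<le> (\<Sum>k\<in>clocks z. ennreal (weight z k) * ennreal (energy z + e k))"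
    unfolding jump_def by (intro sum_mono mult_left_mono step) auto
  also have "\<dots> = (\<Sum>k\<in>clocks z. ennreal (weight z k * (energy z + e k)))"
    using weight_nonneg[OF zc] by (intro sum.cong refl) (simp add: ennreal_mult')
  also have "\<dots> = ennreal (\<Sum>k\<in>clocks z. weight z k * (energy z + e k))"
    using weight_nonneg[OF zc] step by (intro sum_ennreal) simp
  finally have 1: "jump (\<lambda>z. ennreal (energy z)) z \<le> ennreal (\<Sum>k\<in>clocks z. weight z k * (energy z + e k))" .
  have 2: "0 \<le> (\<Sum>k\<in>clocks z. weight z k * (energy z + e k))"
    using weight_nonneg[OF zc] step by (intro sum_nonneg) simp
  have "(\<Sum>k\<in>clocks z. weight z k * (energy z + e k)) = (\<Sum>k\<in>clocks z. weight z k) * energy z + (\<Sum>k\<in>clocks z. intensity z k / total z * e k)"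
    by (simp add: distrib_left sum.distrib sum_distrib_right weight_def)
  also have "\<dots> = energy z + (\<Sum>k\<in>clocks z. intensity z k * e k) / total z"
    by (simp add: weight_sum[OF zc] sum_divide_distrib)
  also have "(\<Sum>k\<in>clocks z. intensity z k * e k) = lam * arrival_gain z - mu * (\<Sum>s\<in>{1..K}. \<Sum>j\<in>served z s. rate z j s * mean_relief z j s)"
    unfolding sum_clocks[OF zc] sum_copies[OF zc, symmetric]
    by (simp add: intensity_def hazard_def drain_def e_def case_prod_beta sum_distrib_left sum_negf mult.assoc)
  also have "energy z + (lam * arrival_gain z - mu * (\<Sum>s\<in>{1..K}. \<Sum>j\<in>served z s. rate z j s * mean_relief z j s)) / total z \<le> ?x"
  proof (intro add_left_mono divide_right_mono)
    have "(\<Sum>s\<in>{1..K}. gain z s) \<le> (\<Sum>s\<in>{1..K}. \<Sum>j\<in>served z s. rate z j s * mean_relief z j s)"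
      by (intro sum_mono gain_le_sum_mean_relief[OF z])
    with total_gain[OF zc] have "2 * (real d)\<^sup>2 * real (card (waiting z)) - slack \<le> (\<Sum>s\<in>{1..K}. \<Sum>j\<in>served z s. rate z j s * mean_relief z j s)"
      by linarith
    then have "mu * (2 * (real d)\<^sup>2 * real (card (waiting z)) - slack) \<le> mu * (\<Sum>s\<in>{1..K}. \<Sum>j\<in>served z s. rate z j s * mean_relief z j s)"
      using mu_pos by (intro mult_left_mono) auto
    then show "lam * arrival_gain z - mu * (\<Sum>s\<in>{1..K}. \<Sum>j\<in>served z s. rate z j s * mean_relief z j s)
       \<le> lam * real d + mu * slack - 2 * (real d)\<^sup>2 * (mu - lam / real K) * real (card (waiting z))"
      by (simp add: arrival_gain_def algebra_simps)
    show "0 \<le> total z" using T by simp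
  qed
  finally have 3: "(\<Sum>k\<in>clocks z. weight z k * (energy z + e k)) \<le> ?x" .
  show "jump (\<lambda>z. ennreal (energy z)) z \<le> ennreal ?x"
    using 1 ennreal_leI[OF 3] by (rule order_trans)
  show "0 \<le> ?x" using 2 3 by (rule order_trans)
qed

lemma drift:
  assumes load: "lam < mu * real K"
  obtains C L e where "0 \<le> C" "0 < e"
    "\<And>z. valid z \<Longrightarrow> jump (\<lambda>z. ennreal (energy z)) z \<le> ennreal (energy z) + ennreal C"
    "\<And>z. valid z \<Longrightarrow> L < length (jobs z) \<Longrightarrow> jump (\<lambda>z. ennreal (energy z)) z + ennreal e \<le> ennreal (energy z)"
proof -
  have K: "0 < real K" "1 \<le> real d" using d_pos d_le by simp_all
  define \<gamma> where "\<gamma> = mu - lam / real K"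
  define C0 where "C0 = lam * real d + mu * slack"
  \<comment> \<open>From \<open>B\<close> waiting jobs on, the linear term exceeds the constant \<open>C0\<close> by at least 1.\<close>
  define B where "B = (C0 + 1) / (2 * \<gamma>)"
  have \<gamma>: "0 < \<gamma>" using load K by (simp add: \<gamma>_def field_simps)
  have C0: "0 \<le> C0" using lam_pos mu_pos by (simp add: C0_def slack_def)
  have q: "0 < lam + mu * real K" using lam_pos mu_pos K by (simp add: add_pos_pos)
  have nn: "0 \<le> energy z" for z by (simp add: energy_def quad_nonneg)
  show thesis
  proof (rule that[of "C0 / lam" "1 / (lam + mu * real K)" "nat \<lceil>B\<rceil> + K"])
    show "0 \<le> C0 / lam" "0 < 1 / (lam + mu * real K)" using C0 lam_pos q by simp_all
  next
    fix z assume z: "valid z"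
    note T = total_le[OF z]
    have "jump (\<lambda>z. ennreal (energy z)) z \<le> ennreal (energy z + (C0 - 2 * (real d)\<^sup>2 * \<gamma> * real (card (waiting z))) / total z)"
      using jump_energy(1)[OF z] by (simp add: C0_def \<gamma>_def)
    also have "\<dots> \<le> ennreal (energy z + C0 / lam)"
    proof (intro ennreal_leI add_left_mono)
      have "(C0 - 2 * (real d)\<^sup>2 * \<gamma> * real (card (waiting z))) / total z \<le> C0 / total z"
        using T lam_pos \<gamma> by (intro divide_right_mono) auto
      also have "\<dots> \<le> C0 / lam" using T lam_pos C0 by (intro divide_left_mono) auto
      finally show "(C0 - 2 * (real d)\<^sup>2 * \<gamma> * real (card (waiting z))) / total z \<le> C0 / lam" .
    qed
    also have "\<dots> = ennreal (energy z) + ennreal (C0 / lam)"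
      using nn C0 lam_pos by (intro ennreal_plus) auto
    finally show "jump (\<lambda>z. ennreal (energy z)) z \<le> ennreal (energy z) + ennreal (C0 / lam)" .
  next
    fix z assume z: "valid z" and L: "nat \<lceil>B\<rceil> + K < length (jobs z)"
    note T = total_le[OF z]
    let ?W = "real (card (waiting z))"
    have "B \<le> ?W" using L length_jobs[OF valid_configs[OF z]] by linarith
    then have "C0 + 1 \<le> 2 * \<gamma> * ?W" using \<gamma> by (simp add: B_def field_simps)
    also have "\<dots> \<le> (real d)\<^sup>2 * (2 * \<gamma> * ?W)"
    proof -
      have "1 \<le> (real d)\<^sup>2" using K by (intro one_le_power)
      moreover have "0 \<le> 2 * \<gamma> * ?W" using \<gamma> by simp
      ultimately show ?thesis using mult_right_mono[of 1 "(real d)\<^sup>2" "2 * \<gamma> * ?W"] by simp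
    qed
    finally have W: "C0 - 2 * (real d)\<^sup>2 * \<gamma> * ?W \<le> - 1" by (simp add: algebra_simps)
    have "(C0 - 2 * (real d)\<^sup>2 * \<gamma> * ?W) / total z \<le> - 1 / total z"
      using W T lam_pos by (intro divide_right_mono) auto
    also have "\<dots> \<le> - (1 / (lam + mu * real K))"
      using T lam_pos q by (simp add: frac_le)
    finally have le: "(C0 - 2 * (real d)\<^sup>2 * \<gamma> * ?W) / total z \<le> - (1 / (lam + mu * real K))" .
    let ?x = "energy z + (C0 - 2 * (real d)\<^sup>2 * \<gamma> * ?W) / total z"
    have j: "jump (\<lambda>z. ennreal (energy z)) z \<le> ennreal ?x"
      using jump_energy(1)[OF z] by (simp add: C0_def \<gamma>_def)
    have gap: "0 < 1 / (lam + mu * real K)" using q by simp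
    show "jump (\<lambda>z. ennreal (energy z)) z + ennreal (1 / (lam + mu * real K)) \<le> ennreal (energy z)"
    proof -
      have x: "0 \<le> ?x" using jump_energy(2)[OF z] by (simp add: C0_def \<gamma>_def)
      have "jump (\<lambda>z. ennreal (energy z)) z + ennreal (1 / (lam + mu * real K)) \<le> ennreal ?x + ennreal (1 / (lam + mu * real K))"
        by (intro add_right_mono j)
      also have "\<dots> = ennreal (?x + 1 / (lam + mu * real K))"
        using x gap by (intro ennreal_plus[symmetric]) auto
      also have "\<dots> \<le> ennreal (energy z)" using le by (intro ennreal_leI) linarith
      finally show ?thesis .
    qed
  qed
qed

section \<open>Reaching a prescribed population\<close>

lemma jump_ge_term:
  assumes "z \<in> configs" "k \<in> clocks z"
  shows "ennreal (weight z k) * (\<bbbE>w. f (outcome z k w)) \<le> jump f z"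
  unfolding jump_def using finite_clocks[OF assms(1)] assms(2)
  by (intro member_le_sum) auto

lemma reach_mono: "valid z \<Longrightarrow> reach N k z \<le> reach N (Suc k) z"
proof (induction k arbitrary: z)
  case 0
  then show ?case by simp
next
  case (Suc k)
  have "jump (reach N k) z \<le> jump (reach N (Suc k)) z"
    by (rule jump_mono_valid[OF Suc.prems Suc.IH])
  then show ?case by simp
qed

lemma reach_mono_le: "valid z \<Longrightarrow> i \<le> k \<Longrightarrow> reach N i z \<le> reach N k z"
proof (induction k)
  case (Suc k)
  show ?case
  proof (cases "i = Suc k")
    case False
    then have "reach N i z \<le> reach N k z" using Suc by simp
    also have "\<dots> \<le> reach N (Suc k) z" by (rule reach_mono[OF Suc.prems(1)])
    finally show ?thesis .
  qed simp
qed simp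

text \<open>
  A lower bound both for the probability that the next event is the arrival of a job of a given type
  and, in a nonempty system, for the probability that it is a completion.
\<close>

definition step_prob :: real where
  "step_prob = min lam mu / ((lam + mu * real K) * real (card (job_types K d)))"

lemma card_types_ge_1: "1 \<le> real (card (job_types K d))"
  using job_types_nonempty finite_job_types by (simp add: Suc_le_eq card_gt_0_iff)

lemma step_prob_pos: "0 < step_prob"
  using lam_pos mu_pos card_types_ge_1 by (auto simp: step_prob_def intro!: divide_pos_pos mult_pos_pos add_pos_nonneg)

lemma step_prob_le_1: "step_prob \<le> 1"
proof -
  have "min lam mu \<le> lam" by simp
  also have "\<dots> \<le> (lam + mu * real K) * 1" using mu_pos by simp
  also have "\<dots> \<le> (lam + mu * real K) * real (card (job_types K d))"
    using card_types_ge_1 lam_pos mu_pos by (intro mult_left_mono) auto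
  finally show ?thesis
    using lam_pos mu_pos card_types_ge_1 unfolding step_prob_def by (intro divide_le_eq_1[THEN iffD2]) auto
qed

lemma jump_ge_admit:
  assumes z: "valid z" and c: "c \<in> job_types K d"
  shows "ennreal step_prob * f (admit z c) \<le> jump f z"
proof -
  note zc = valid_configs[OF z]
  let ?n = "real (card (job_types K d))"
  have n: "0 < ?n" using card_types_ge_1 by linarith
  have q: "0 < lam + mu * real K" using lam_pos mu_pos by (intro add_pos_nonneg) auto
  have "step_prob \<le> weight z None * (1 / ?n)"
  proof -
    have "step_prob \<le> lam / ((lam + mu * real K) * ?n)"
      unfolding step_prob_def using q n by (intro divide_right_mono) auto
    also have "\<dots> \<le> lam / (total z * ?n)"
      using total_le[OF z] lam_pos n q by (intro divide_left_mono mult_right_mono mult_pos_pos) auto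
    finally show ?thesis by (simp add: weight_def intensity_def hazard_def drain_def)
  qed
  then have "ennreal step_prob * f (admit z c) \<le> ennreal (weight z None * (1 / ?n)) * f (admit z c)"
    by (intro mult_right_mono ennreal_leI) auto
  also have "\<dots> = ennreal (weight z None) * (f (admit z c) / of_nat (card (job_types K d)))"
  proof -
    have "ennreal (1 / ?n) = inverse (of_nat (card (job_types K d)))"
      using n by (simp add: ennreal_of_nat_eq_real_of_nat inverse_ennreal inverse_eq_divide)
    then show ?thesis
      unfolding ennreal_mult'[OF weight_nonneg[OF zc]] divide_ennreal_def by (simp add: mult_ac)
  qed
  also have "\<dots> \<le> ennreal (weight z None) * ((\<Sum>c\<in>job_types K d. f (admit z c)) / of_nat (card (job_types K d)))"
    using finite_job_types c by (intro mult_left_mono divide_right_mono_ennreal member_le_sum) auto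
  also have "\<dots> = ennreal (weight z None) * (\<bbbE>w. f (outcome z None w))"
    unfolding outcome_def option.case nn_integral_drawn_type[of "\<lambda>c. f (admit z c)"] ..
  also have "\<dots> \<le> jump f z"
    by (rule jump_ge_term[OF zc]) (simp add: clocks_def)
  finally show ?thesis .
qed

lemma counts_admit:
  assumes z: "z \<in> configs"
  shows "counts (admit z c) = (counts z)(c := Suc (counts z c))"
proof
  fix b
  have new: "upcoming z \<notin> set (jobs z)" using z by (auto simp: configs_def)
  have "{j \<in> set (jobs (admit z c)). kind (admit z c) j = b} =
     (if b = c then insert (upcoming z) {j \<in> set (jobs z). kind z j = b} else {j \<in> set (jobs z). kind z j = b})"
    using new by (auto simp: admit_def)
  then show "counts (admit z c) b = ((counts z)(c := Suc (counts z c))) b"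
    using new by (simp add: counts_def)
qed

lemma reach_by_arrivals:
  assumes "valid z" "set cs \<subseteq> job_types K d" "\<And>c. counts z c + count_list cs c = N c"
  shows "ennreal (step_prob ^ length cs) \<le> reach N (length cs) z"
  using assms
proof (induction cs arbitrary: z)
  case Nil
  then have "counts z = N" by (auto simp: fun_eq_iff)
  then show ?case by simp
next
  case (Cons c cs)
  have c: "c \<in> job_types K d" using Cons.prems(2) by simp
  have "ennreal (step_prob ^ length cs) \<le> reach N (length cs) (admit z c)"
  proof (rule Cons.IH)
    show "valid (admit z c)" by (rule valid_admit[OF Cons.prems(1) c])
    show "set cs \<subseteq> job_types K d" using Cons.prems(2) by simp
    show "counts (admit z c) b + count_list cs b = N b" for b
      using Cons.prems(3)[of b] valid_configs[OF Cons.prems(1)] by (auto simp: counts_admit split: if_splits)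
  qed
  then have "ennreal step_prob * ennreal (step_prob ^ length cs) \<le> ennreal step_prob * reach N (length cs) (admit z c)"
    by (rule mult_left_mono) simp
  also have "\<dots> \<le> jump (reach N (length cs)) z" by (rule jump_ge_admit[OF Cons.prems(1) c])
  finally have *: "ennreal (step_prob ^ length (c # cs)) \<le> jump (reach N (length cs)) z"
    using step_prob_pos by (simp add: ennreal_mult')
  have "ennreal (step_prob ^ length (c # cs)) \<le> 1"
    using step_prob_pos step_prob_le_1 power_le_one[of step_prob "length (c # cs)"] by (simp only: ennreal_le_1)
  with * show ?case by simp
qed

text \<open>
  In a nonempty system some server is busy, so completions occur at rate at least \<open>mu\<close>; each removes
  exactly one job.
\<close>

lemma jump_ge_departures:
  assumes z: "valid z" and busy: "jobs z \<noteq> []"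
    and f: "\<And>z'. valid z' \<Longrightarrow> length (jobs z') = length (jobs z) - 1 \<Longrightarrow> ennreal b \<le> f z'" and b: "0 \<le> b"
  shows "ennreal (step_prob * b) \<le> jump f z"
proof -
  note zc = valid_configs[OF z]
  have dist: "distinct (jobs z)" using zc by (simp add: configs_def)
  have q: "0 < lam + mu * real K" using lam_pos mu_pos by (intro add_pos_nonneg) auto
  obtain j0 where j0: "j0 \<in> set (jobs z)" using busy by (meson hd_in_set)
  then have t: "kind z j0 \<in> job_types K d" using zc by (auto simp: configs_def)
  then have "kind z j0 \<noteq> {}" using d_pos job_typeD by fastforce
  then obtain s0 where s0: "s0 \<in> kind z j0" by blast
  then have s0K: "s0 \<in> {1..K}" using t job_typeD by blast
  have l: "line z s0 \<noteq> []" using j0 s0 by (auto simp: line_def filter_empty_conv)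
  have tm: "ennreal b \<le> (\<bbbE>w. f (outcome z (Some p) w))" if p: "p \<in> copies z" for p
  proof -
    obtain j s where js: "p = (j, s)" by (cases p)
    have j: "j \<in> set (jobs z)" using p js finite_copies(2)[OF zc] by auto
    have "length (jobs (outcome z (Some p) w)) = length (jobs z) - 1" for w
    proof -
      have "jobs (outcome z (Some p) w) = removeAll j (jobs z)"
        by (simp add: outcome_def js discharge_def removeAll_filter_not_eq) (auto intro: filter_cong)
      then show ?thesis using j dist by (simp add: distinct_remove1_removeAll[symmetric] length_remove1)
    qed
    then have "AE w in fresh_law. ennreal b \<le> f (outcome z (Some p) w)"
      using AE_valid_outcome[OF z, of "Some p"] by (auto elim!: eventually_mono intro: f)
    then have "(\<bbbE>w. ennreal b) \<le> (\<bbbE>w. f (outcome z (Some p) w))"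
      by (rule nn_integral_mono_AE)
    then show ?thesis by (simp add: P.emeasure_space_1)
  qed
  have T: "0 < total z" by (rule total_pos[OF zc])
  have "step_prob \<le> (\<Sum>p\<in>copies z. weight z (Some p))"
  proof -
    have "step_prob \<le> mu / ((lam + mu * real K) * real (card (job_types K d)))"
      unfolding step_prob_def using q by (intro divide_right_mono) auto
    also have "\<dots> \<le> mu / (total z * 1)"
      using total_le[OF z] mu_pos T card_types_ge_1 q by (intro divide_left_mono mult_mono mult_pos_pos) auto
    also have "\<dots> = mu * 1 / total z" by simp
    also have "\<dots> \<le> mu * (\<Sum>s\<in>{1..K}. \<Sum>j\<in>served z s. rate z j s) / total z"
    proof (intro divide_right_mono mult_left_mono)
      have "(\<Sum>j\<in>served z s0. rate z j s0) \<le> (\<Sum>s\<in>{1..K}. \<Sum>j\<in>served z s. rate z j s)"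
        using s0K by (intro member_le_sum sum_nonneg rate_nonneg) auto
      then show "1 \<le> (\<Sum>s\<in>{1..K}. \<Sum>j\<in>served z s. rate z j s)"
        using sum_rate[OF z s0K] l by simp
    qed (use mu_pos T in auto)
    also have "\<dots> = (\<Sum>p\<in>copies z. weight z (Some p))"
      unfolding sum_copies[OF zc, symmetric]
      by (simp add: weight_def intensity_def hazard_def drain_def case_prod_beta sum_distrib_left sum_divide_distrib)
    finally show ?thesis .
  qed
  then have "ennreal (step_prob * b) \<le> ennreal ((\<Sum>p\<in>copies z. weight z (Some p)) * b)"
    using b by (intro ennreal_leI mult_right_mono)
  also have "\<dots> = (\<Sum>p\<in>copies z. ennreal (weight z (Some p)) * ennreal b)"
    using weight_nonneg[OF zc] b
    by (simp add: sum_distrib_right sum_ennreal[symmetric] ennreal_mult')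
  also have "\<dots> \<le> (\<Sum>p\<in>copies z. ennreal (weight z (Some p)) * (\<bbbE>w. f (outcome z (Some p) w)))"
    by (intro sum_mono mult_left_mono tm) auto
  also have "\<dots> \<le> jump f z"
    unfolding jump_def sum_clocks[OF zc] by simp
  finally show ?thesis .
qed

text \<open>
  First all \<open>m\<close> jobs depart, then jobs with the types in \<open>cs\<close> arrive in this order. The population
  may hit the target earlier, which only helps.
\<close>

lemma reach_by_emptying:
  assumes cs: "set cs \<subseteq> job_types K d"
  shows "valid z \<Longrightarrow> length (jobs z) = m \<Longrightarrow>
    ennreal (step_prob ^ (m + length cs)) \<le> reach (count_list cs) (m + length cs) z"
proof (induction m arbitrary: z)
  case 0
  then show ?case using reach_by_arrivals[OF _ cs, of z "count_list cs"] by (simp add: counts_def)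
next
  case (Suc m)
  have "ennreal (step_prob * step_prob ^ (m + length cs)) \<le> jump (reach (count_list cs) (m + length cs)) z"
    using step_prob_pos Suc.prems Suc.IH by (intro jump_ge_departures) auto
  moreover have "ennreal (step_prob ^ (Suc m + length cs)) \<le> 1"
    using step_prob_pos step_prob_le_1 power_le_one[of step_prob "Suc m + length cs"] by (simp only: ennreal_le_1)
  ultimately show ?case by simp
qed

lemma reach_uniform:
  assumes cs: "set cs \<subseteq> job_types K d" and z: "valid z" "length (jobs z) \<le> L"
  shows "ennreal (step_prob ^ (L + length cs)) \<le> reach (count_list cs) (L + length cs) z"
proof -
  let ?m = "length (jobs z)"
  have "ennreal (step_prob ^ (L + length cs)) \<le> ennreal (step_prob ^ (?m + length cs))"
    using step_prob_pos step_prob_le_1 z(2) by (intro ennreal_leI power_decreasing) auto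
  also have "\<dots> \<le> reach (count_list cs) (?m + length cs) z"
    by (rule reach_by_emptying[OF cs z(1) refl])
  also have "\<dots> \<le> reach (count_list cs) (L + length cs) z"
    by (rule reach_mono_le[OF z(1)]) (use z(2) in simp)
  finally show ?thesis .
qed

text \<open>
  A finite mean after one step is recorded because the return time starts with a step away from the
  target.
\<close>

theorem hitting_bound:
  assumes load: "lam < mu * real K" and cs: "set cs \<subseteq> job_types K d"
  obtains V where "\<And>z. valid z \<Longrightarrow> jump V z < \<infinity>"
    and "\<And>z n. valid z \<Longrightarrow> (\<bbbE>w. path_cost (count_list cs) n z w) \<le> V z"
proof -
  obtain C L e where CLe: "0 \<le> C" "0 < e"
    "\<And>z. valid z \<Longrightarrow> jump (\<lambda>z. ennreal (energy z)) z \<le> ennreal (energy z) + ennreal C"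
    "\<And>z. valid z \<Longrightarrow> L < length (jobs z) \<Longrightarrow> jump (\<lambda>z. ennreal (energy z)) z + ennreal e \<le> ennreal (energy z)"
    using drift[OF load] by metis
  have fin: "ennreal (energy z) < \<infinity>" for z by simp
  have pos: "0 < step_prob ^ (L + length cs)" using step_prob_pos by simp
  show thesis
  proof (rule foster[of "\<lambda>z. ennreal (energy z)", OF fin CLe(3) CLe(4) reach_uniform[OF cs] CLe(2) pos CLe(1)])
    fix V assume V: "\<And>z. valid z \<Longrightarrow> jump V z < \<infinity>"
      "\<And>z. valid z \<Longrightarrow> ennreal (1 / lam) + 1 + (if counts z = count_list cs then 0 else jump V z) \<le> V z"
    show thesis by (rule that[OF V(1) nn_integral_path_cost[OF V(2)]])
  qed
qed

section \<open>From the event-driven model to the residual chain\<close>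

definition advance :: "config \<times> (nat \<Rightarrow> mark) \<Rightarrow> config \<times> (nat \<Rightarrow> mark)" where
  "advance p = (follow (fst p) (snd p), elapse (fst p) (sojourn (fst p) (snd p)) (snd p))"

definition chain :: "nat \<Rightarrow> config \<times> (nat \<Rightarrow> mark) \<Rightarrow> config \<times> (nat \<Rightarrow> mark)" where
  "chain i = advance ^^ i"

lemma chain_0 [simp]: "chain 0 p = p"
  by (simp add: chain_def)

lemma chain_Suc: "chain (Suc i) p = advance (chain i p)"
  by (simp add: chain_def)

lemma chain_Suc': "chain (Suc i) p = chain i (advance p)"
  by (simp add: chain_def funpow_swap1)

definition elapsed :: "nat \<Rightarrow> config \<times> (nat \<Rightarrow> mark) \<Rightarrow> real" where
  "elapsed i p = (\<Sum>k<i. sojourn (fst (chain k p)) (snd (chain k p)))"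

definition start :: "descriptor \<Rightarrow> config" where
  "start x = \<lparr>upcoming = start_number x, jobs = [0..<start_number x],
     kind = (\<lambda>j. if j < start_number x then start_types x ! j else {}),
     head = (\<lambda>s. if s \<in> {1..K} then start_serving x s else None)\<rparr>"

text \<open>
  Passes from requirements to residual requirements at time 0.
\<close>

definition strip :: "descriptor \<Rightarrow> (nat \<Rightarrow> mark) \<Rightarrow> (nat \<Rightarrow> mark)" where
  "strip x w = (\<lambda>j. (interarrival (w j), drawn_type (w j),
     (\<lambda>s. requirement (w j) s - (if j < start_number x then start_attained x j s else 0)), choice_var (w j)))"

lemma valid_start:
  assumes x: "x \<in> descriptors pol K d" shows "valid (start x)"
  unfolding valid_def
proof (intro conjI impI ballI)
  show "start x \<in> configs"
    using x by (auto simp: configs_def start_def descriptors_def)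
  fix s assume "pol = ROS" and s: "s \<in> {1..K}"
  then have inv: "case start_serving x s of None \<Rightarrow> start_queue x s = {} | Some j \<Rightarrow> j \<in> start_queue x s"
    using x unfolding descriptors_def by blast
  have q: "set (line (start x) s) = start_queue x s"
    by (auto simp: line_def start_def start_queue_def)
  have h: "head (start x) s = start_serving x s" using s by (simp add: start_def)
  show "case head (start x) s of None \<Rightarrow> line (start x) s = [] | Some j \<Rightarrow> j \<in> set (line (start x) s)"
    using inv unfolding h q set_empty[symmetric] .
qed

subsection \<open>Coupling\<close>

text \<open>
  The event-driven state and the residual configuration describe the same system: requirement minus
  attained service is the residual requirement, and arrival time minus clock the residual
  interarrival time.
\<close>

definition linked :: "descriptor \<Rightarrow> (nat \<Rightarrow> mark) \<Rightarrow> state \<Rightarrow> config \<times> (nat \<Rightarrow> mark) \<Rightarrow> bool" where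
  "linked x w \<sigma> p \<longleftrightarrow> (case p of (z, w') \<Rightarrow>
     z \<in> configs \<and> start_number x \<le> upcoming z \<and> next_job \<sigma> = upcoming z \<and> present \<sigma> = jobs z \<and>
     (\<forall>j\<in>set (jobs z). kind z j = job_type x w j) \<and>
     (\<forall>s\<in>{1..K}. serving \<sigma> s = head z s) \<and>
     (\<forall>j\<in>set (jobs z). \<forall>s. requirement (w' j) s = requirement (w j) s - attained \<sigma> j s) \<and>
     interarrival (w' (upcoming z)) = arrival_time x w (upcoming z) - clock \<sigma> \<and>
     (\<forall>i>upcoming z. interarrival (w' i) = interarrival (w i)) \<and>
     (\<forall>i\<ge>upcoming z. drawn_type (w' i) = drawn_type (w i) \<and> requirement (w' i) = requirement (w i)) \<and>
     (\<forall>i. choice_var (w' i) = choice_var (w i)))"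

lemma linkedI:
  assumes "z \<in> configs" "start_number x \<le> upcoming z" "next_job \<sigma> = upcoming z" "present \<sigma> = jobs z"
    "\<And>j. j \<in> set (jobs z) \<Longrightarrow> kind z j = job_type x w j"
    "\<And>s. s \<in> {1..K} \<Longrightarrow> serving \<sigma> s = head z s"
    "\<And>j s. j \<in> set (jobs z) \<Longrightarrow> requirement (w' j) s = requirement (w j) s - attained \<sigma> j s"
    "interarrival (w' (upcoming z)) = arrival_time x w (upcoming z) - clock \<sigma>"
    "\<And>i. i > upcoming z \<Longrightarrow> interarrival (w' i) = interarrival (w i)"
    "\<And>i. i \<ge> upcoming z \<Longrightarrow> drawn_type (w' i) = drawn_type (w i)"
    "\<And>i. i \<ge> upcoming z \<Longrightarrow> requirement (w' i) = requirement (w i)"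
    "\<And>i. choice_var (w' i) = choice_var (w i)"
  shows "linked x w \<sigma> (z, w')"
  using assms by (auto simp: linked_def)

lemma linked_initial:
  assumes x: "x \<in> descriptors pol K d"
  shows "linked x w (initial_state x) (start x, strip x w)"
  using valid_configs[OF valid_start[OF x]]
  by (auto simp: linked_def initial_state_def start_def strip_def job_type_def arrival_time_def)

text \<open>
  Completion and arrival times on the absolute time scale are ringing times plus the current clock, so
  both descriptions single out the same next event. This holds for every input with admissible
  types, exceptional ones included, which is what strict measurability of the return time requires.
\<close>

lemma linked_step:
  assumes types: "\<forall>j. drawn_type (w j) \<in> job_types K d" and L: "linked x w \<sigma> (z, w')"
  shows "linked x w (step pol x w \<sigma>) (advance (z, w'))"
    and "clock (step pol x w \<sigma>) = clock \<sigma> + sojourn z w'"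
proof -
  let ?n = "upcoming z"
  have z: "z \<in> configs" and n0: "start_number x \<le> ?n" and n: "next_job \<sigma> = ?n" and js: "present \<sigma> = jobs z"
    and kd: "\<And>j. j \<in> set (jobs z) \<Longrightarrow> job_type x w j = kind z j"
    and sv: "\<And>s. s \<in> {1..K} \<Longrightarrow> serving \<sigma> s = head z s"
    and rq: "\<And>j s. j \<in> set (jobs z) \<Longrightarrow> requirement (w' j) s = requirement (w j) s - attained \<sigma> j s"
    and ia: "interarrival (w' ?n) = arrival_time x w ?n - clock \<sigma>"
    and ia': "\<And>i. i > ?n \<Longrightarrow> interarrival (w' i) = interarrival (w i)"
    and fut: "\<And>i. i \<ge> ?n \<Longrightarrow> drawn_type (w' i) = drawn_type (w i) \<and> requirement (w' i) = requirement (w i)"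
    and cv: "\<And>i. choice_var (w' i) = choice_var (w i)"
    using L by (auto simp: linked_def)
  have dom: "s \<in> {1..K}" if "j \<in> set (jobs z)" "s \<in> kind z j" for j s
    using job_typeD[OF kind_type[OF z that(1)]] that(2) by blast
  have jn: "j < ?n" if "j \<in> set (jobs z)" for j using z that by (auto simp: configs_def)
  have queue: "queue x w (jobs z) s = line z s" for s
    unfolding queue_def line_def by (rule filter_cong) (simp_all add: kd)
  have speed: "speed pol x w \<sigma> j s = rate z j s" for j s
    unfolding speed_def rate_def js queue using sv dom kd by (auto split: policy.split)
  have cop: "copies_in_service pol x w \<sigma> = copies z"
    unfolding copies_in_service_def copies_def speed js using kd
    by (auto simp: rate_def split: if_splits)
  have compl: "completion_time pol x w \<sigma> p = clock \<sigma> + ring_time z (Some p) w'" if "p \<in> copies z" for p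
  proof -
    obtain j s where p: "p = (j, s)" by (cases p)
    have "j \<in> set (jobs z)" using that finite_copies(2)[OF z] p by auto
    then show ?thesis by (simp add: completion_time_def p ring_time_def level_def drain_def speed rq)
  qed
  have arr: "arrival_time x w ?n = clock \<sigma> + ring_time z None w'"
    using ia by (simp add: ring_time_def level_def drain_def)
  have next_ep: "next_epoch pol x w \<sigma> = clock \<sigma> + sojourn z w'"
  proof -
    have "insert (arrival_time x w ?n) (completion_time pol x w \<sigma> ` copies z) = (\<lambda>k. ring_time z k w' + clock \<sigma>) ` clocks z"
      unfolding clocks_def by (auto simp: arr compl image_iff add.commute)
    then have "next_epoch pol x w \<sigma> = Min ((\<lambda>k. ring_time z k w' + clock \<sigma>) ` clocks z)"
      by (simp add: next_epoch_def n cop)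
    also have "\<dots> = sojourn z w' + clock \<sigma>"
      unfolding sojourn_def by (rule Min_add_commute) (auto simp: finite_clocks[OF z], simp add: clocks_def)
    finally show ?thesis by simp
  qed
  have fin: "completed_jobs pol x w \<sigma> = finished z w'"
    unfolding completed_jobs_def finished_def cop next_ep by (auto simp: compl)
  define \<sigma>' where "\<sigma>' = serve pol x w \<sigma>"
  have \<sigma>': "clock \<sigma>' = clock \<sigma> + sojourn z w'" "next_job \<sigma>' = ?n" "present \<sigma>' = jobs z" "serving \<sigma>' = serving \<sigma>"
    "\<And>j s. attained \<sigma>' j s = attained \<sigma> j s + rate z j s * sojourn z w'"
    by (simp_all add: \<sigma>'_def serve_def next_ep n js speed)
  let ?w = "elapse z (sojourn z w') w'"
  have w: "interarrival (?w i) = interarrival (w' i) - (if i = ?n then sojourn z w' else 0)"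
    "drawn_type (?w i) = drawn_type (w' i)" "requirement (?w i) s = requirement (w' i) s - rate z i s * sojourn z w'"
    "choice_var (?w i) = choice_var (w i)" for i s
    by (simp_all add: elapse_def cv)
  have fresh: "requirement (?w i) = requirement (w i)" if "i \<ge> ?n" for i
    using fut[OF that] jn[of i] that by (auto simp: elapse_def fun_eq_iff rate_def)
  have adv: "advance (z, w') = (follow z w', ?w)" by (simp add: advance_def)
  have fz: "follow z w' \<in> configs"
    unfolding follow_def using z types[THEN spec] fut[of ?n] by (auto intro: admit_configs discharge_configs)
  have "linked x w (step pol x w \<sigma>) (advance (z, w')) \<and> clock (step pol x w \<sigma>) = clock \<sigma> + sojourn z w'"
  proof (cases "sojourn z w' = interarrival (w' ?n)")
    case True
    have st: "step pol x w \<sigma> = arrive x w \<sigma>'"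
      using True by (simp add: step_def next_ep n ia \<sigma>'_def)
    have fo: "follow z w' = admit z (drawn_type (w ?n))"
      using True fut[of ?n] by (simp add: follow_def)
    have ty: "job_type x w ?n = drawn_type (w ?n)" using n0 by (simp add: job_type_def)
    have tyK: "drawn_type (w ?n) \<subseteq> {1..K}" using types[THEN spec] job_typeD by blast
    have at: "arrival_time x w (Suc ?n) = arrival_time x w ?n + interarrival (w (Suc ?n))"
      using n0 by (simp add: arrival_time_def)
    have nj: "?n \<notin> set (jobs z)" using jn by blast
    let ?c = "drawn_type (w ?n)" and ?\<tau> = "arrive x w \<sigma>'"
    have sel: "clock ?\<tau> = clock \<sigma> + sojourn z w'" "next_job ?\<tau> = Suc ?n" "present ?\<tau> = jobs z @ [?n]"
      "attained ?\<tau> j s = (if j = ?n then 0 else attained \<sigma> j s + rate z j s * sojourn z w')"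
      "serving ?\<tau> s = (if s \<in> ?c \<and> serving \<sigma> s = None then Some ?n else serving \<sigma> s)" for j s
      by (simp_all add: arrive_def Let_def \<sigma>' ty)
    have asel: "upcoming (admit z ?c) = Suc ?n" "jobs (admit z ?c) = jobs z @ [?n]"
      "kind (admit z ?c) j = (if j = ?n then ?c else kind z j)"
      "head (admit z ?c) s = (if s \<in> ?c \<and> head z s = None then Some ?n else head z s)" for j s
      by (simp_all add: admit_def)
    have "linked x w ?\<tau> (admit z ?c, ?w)"
    proof (rule linkedI, unfold sel asel)
      show "admit z ?c \<in> configs" using fz unfolding fo .
      show "start_number x \<le> Suc ?n" using n0 by simp
      show "(if j = ?n then ?c else kind z j) = job_type x w j" if "j \<in> set (jobs z @ [?n])" for j
        using that kd ty nj by auto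
      show "(if s \<in> ?c \<and> serving \<sigma> s = None then Some ?n else serving \<sigma> s) =
          (if s \<in> ?c \<and> head z s = None then Some ?n else head z s)" if "s \<in> {1..K}" for s
        using sv[OF that] by simp
      show "requirement (?w j) s = requirement (w j) s - (if j = ?n then 0 else attained \<sigma> j s + rate z j s * sojourn z w')"
        if "j \<in> set (jobs z @ [?n])" for j s
      proof (cases "j = ?n")
        case True
        then show ?thesis using fresh[of ?n] by simp
      next
        case False
        then show ?thesis using that rq[of j s] by (simp add: w)
      qed
      show "interarrival (?w (Suc ?n)) = arrival_time x w (Suc ?n) - (clock \<sigma> + sojourn z w')"
      proof -
        have "interarrival (?w (Suc ?n)) = interarrival (w (Suc ?n))"
          using ia'[of "Suc ?n"] by (simp add: w)
        then show ?thesis using True ia at by linarith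
      qed
      show "interarrival (?w i) = interarrival (w i)" if "Suc ?n < i" for i
        using that ia'[of i] by (simp add: w)
      show "drawn_type (?w i) = drawn_type (w i)" if "Suc ?n \<le> i" for i
        using that fut[of i] by (simp add: w)
      show "requirement (?w i) = requirement (w i)" if "Suc ?n \<le> i" for i
        using that by (intro fresh) simp
      show "choice_var (?w i) = choice_var (w i)" for i by (rule w)
    qed (rule refl)+
    then show ?thesis unfolding adv st fo using sel by blast
  next
    case False
    have st: "step pol x w \<sigma> = depart x w (finished z w') \<sigma>'"
      using False by (simp add: step_def next_ep n ia \<sigma>'_def fin) (simp add: algebra_simps)?
    have fo: "follow z w' = discharge z (finished z w') (\<lambda>j. choice_var (w j))"
      using False by (simp add: follow_def cv)
    let ?js = "filter (\<lambda>j. j \<notin> finished z w') (jobs z)"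
    have qu: "queue x w ?js s = filter (\<lambda>j. s \<in> kind z j) ?js" for s
      unfolding queue_def by (rule filter_cong) (auto simp: kd)
    let ?z = "discharge z (finished z w') (\<lambda>j. choice_var (w j))" and ?\<tau> = "depart x w (finished z w') \<sigma>'"
    have sel: "clock ?\<tau> = clock \<sigma> + sojourn z w'" "next_job ?\<tau> = ?n" "present ?\<tau> = ?js"
      "attained ?\<tau> j s = attained \<sigma> j s + rate z j s * sojourn z w'" for j s
      by (simp_all add: depart_def Let_def \<sigma>')
    have ser: "serving ?\<tau> s = head ?z s" if "s \<in> {1..K}" for s
      using sv[OF that] by (simp add: depart_def Let_def \<sigma>' discharge_def qu del: filter_filter split: option.split)
    have asel: "upcoming ?z = ?n" "jobs ?z = ?js" "kind ?z = kind z"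
      by (simp_all add: discharge_def)
    have "linked x w ?\<tau> (?z, ?w)"
    proof (rule linkedI, unfold sel asel)
      show "?z \<in> configs" using fz unfolding fo .
      show "kind z j = job_type x w j" if "j \<in> set ?js" for j
        using that kd by simp
      show "serving ?\<tau> s = head ?z s" if "s \<in> {1..K}" for s by (rule ser[OF that])
      show "requirement (?w j) s = requirement (w j) s - (attained \<sigma> j s + rate z j s * sojourn z w')"
        if "j \<in> set ?js" for j s
        using that rq[of j s] by (simp add: w)
      show "interarrival (?w ?n) = arrival_time x w ?n - (clock \<sigma> + sojourn z w')"
        using ia by (simp add: w)
      show "interarrival (?w i) = interarrival (w i)" if "?n < i" for i
        using that ia'[of i] by (simp add: w)
      show "drawn_type (?w i) = drawn_type (w i)" if "?n \<le> i" for i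
        using that fut[of i] by (simp add: w)
      show "requirement (?w i) = requirement (w i)" if "?n \<le> i" for i
        using that by (rule fresh)
      show "choice_var (?w i) = choice_var (w i)" for i by (rule w)
    qed (rule refl n0)+
    then show ?thesis unfolding adv st fo using sel by blast
  qed
  then show "linked x w (step pol x w \<sigma>) (advance (z, w'))"
    and "clock (step pol x w \<sigma>) = clock \<sigma> + sojourn z w'" by blast+
qed

lemma linked_epoch:
  assumes types: "\<forall>j. drawn_type (w j) \<in> job_types K d" and x: "x \<in> descriptors pol K d"
  shows "linked x w (epoch_state pol x w i) (chain i (start x, strip x w)) \<and>
    clock (epoch_state pol x w i) = elapsed i (start x, strip x w)"
proof (induction i)
  case 0
  then show ?case using linked_initial[OF x]
    by (simp add: epoch_state_def elapsed_def) (simp add: initial_state_def)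
next
  case (Suc i)
  let ?p = "chain i (start x, strip x w)"
  obtain z w' where p: "?p = (z, w')" by (cases ?p)
  have e: "epoch_state pol x w (Suc i) = step pol x w (epoch_state pol x w i)"
    by (simp add: epoch_state_def)
  show ?case
    using linked_step[OF types, of x "epoch_state pol x w i" z w'] Suc unfolding e chain_Suc p
    by (simp add: elapsed_def p)
qed

lemma job_counts_chain:
  assumes types: "\<forall>j. drawn_type (w j) \<in> job_types K d" and x: "x \<in> descriptors pol K d"
  shows "job_counts pol x w t =
    counts (fst (chain (LEAST i. t < elapsed (Suc i) (start x, strip x w)) (start x, strip x w)))"
proof -
  let ?p = "(start x, strip x w)"
  have c: "clock (epoch_state pol x w i) = elapsed i ?p" for i
    using linked_epoch[OF assms] by blast
  define i where "i = (LEAST i. t < elapsed (Suc i) ?p)"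
  have s: "state_at pol x w t = epoch_state pol x w i"
    by (simp add: state_at_def c i_def)
  have "linked x w (epoch_state pol x w i) (chain i ?p)" using linked_epoch[OF assms] by blast
  then have "present (epoch_state pol x w i) = jobs (fst (chain i ?p))"
    "\<And>j. j \<in> set (jobs (fst (chain i ?p))) \<Longrightarrow> kind (fst (chain i ?p)) j = job_type x w j"
    by (auto simp: linked_def case_prod_beta)
  then show ?thesis
    unfolding i_def[symmetric] by (auto simp: fun_eq_iff job_counts_def counts_def s intro!: arg_cong[where f=card])
qed

subsection \<open>The law of the stripped input\<close>

lemma prob_space_requirement_law:
  assumes "0 \<le> start_attained x j s"
  shows "prob_space (requirement_law mu x j s)"
proof -
  have "emeasure (exp_law mu) {start_attained x j s<..} \<noteq> 0 \<and> emeasure (exp_law mu) {start_attained x j s<..} \<noteq> \<infinity>"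
  proof -
    have "emeasure (exp_law mu) {start_attained x j s<..} = (\<integral>\<^sup>+y. indicator {start_attained x j s<..} y \<partial>exp_law mu)"
      by (simp add: sets_exp_law)
    also have "\<dots> = (\<integral>\<^sup>+y. (if start_attained x j s < y then 1 else 0) \<partial>exp_law mu)"
      by (rule nn_integral_cong) (simp add: indicator_def)
    also have "\<dots> = ennreal (exp (- mu * start_attained x j s))"
      using exp_law_memoryless[OF mu_pos assms, of "\<lambda>_. 1"] E.emeasure_space_1 by simp
    finally show ?thesis by simp
  qed
  then show ?thesis
    unfolding requirement_law_def
    using prob_space_exp_law[OF mu_pos] by (auto intro!: prob_space_uniform_measure)
qed

lemma sets_requirement_law: "sets (requirement_law mu x j s) = sets borel"
  by (simp add: requirement_law_def sets_exp_law)

lemma sets_mark_law: "sets (mark_law K d lam mu x j) = sets fresh_mark"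
  unfolding mark_law_def fresh_mark_def
  by (intro sets_pair_measure_cong sets_PiM_cong refl) (simp add: sets_requirement_law sets_exp_law)

lemma sets_input_law: "sets (input_law K d lam mu x) = sets fresh_law"
  unfolding input_law_def fresh_law_def by (intro sets_PiM_cong refl) (rule sets_mark_law)

lemma distr_requirement_law:
  assumes "0 \<le> start_attained x j s"
  shows "distr (requirement_law mu x j s) (exp_law mu)
    (\<lambda>y. y - (if j < start_number x then start_attained x j s else 0)) = exp_law mu"
proof (cases "j < start_number x")
  case True
  have "distr (requirement_law mu x j s) (exp_law mu) (\<lambda>y. y - start_attained x j s) =
      distr (uniform_measure (exp_law mu) {start_attained x j s<..}) borel (\<lambda>y. y - start_attained x j s)"
    by (rule distr_cong) (simp_all add: True requirement_law_def sets_exp_law)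
  then show ?thesis using True distr_residual_exp_law[OF mu_pos assms] by simp
next
  case False
  then show ?thesis
    by (simp add: requirement_law_def distr_id2)
qed

definition strip_mark :: "descriptor \<Rightarrow> nat \<Rightarrow> mark \<Rightarrow> mark" where
  "strip_mark x j m = (interarrival m, drawn_type m,
     (\<lambda>s. requirement m s - (if j < start_number x then start_attained x j s else 0)), choice_var m)"

lemma measurable_strip_mark: "strip_mark x j \<in> fresh_mark \<rightarrow>\<^sub>M fresh_mark"
  unfolding strip_mark_def by (rule measurable_markI) measurable

lemma measurable_strip: "strip x \<in> fresh_law \<rightarrow>\<^sub>M fresh_law"
  unfolding strip_def by (intro measurable_inputI measurable_markI) measurable

lemma prob_space_requirements:
  assumes "\<And>s. 0 \<le> start_attained x j s"
  shows "prob_space (\<Pi>\<^sub>M s\<in>UNIV. requirement_law mu x j s)"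
  by (rule prob_space_PiM) (rule prob_space_requirement_law[OF assms])

lemma mark_law_strip:
  assumes a: "\<And>s. 0 \<le> start_attained x j s"
  shows "prob_space (mark_law K d lam mu x j)"
    and "distr (mark_law K d lam mu x j) fresh_mark (strip_mark x j) = fresh_mark"
proof -
  let ?A = "exp_law lam" and ?T = type_law and ?R' = service_law and ?C = choice_law
    and ?R = "\<Pi>\<^sub>M s\<in>(UNIV::nat set). requirement_law mu x j s"
  let ?f = "\<lambda>r s. r s - (if j < start_number x then start_attained x j s else 0)"
  interpret S: prob_space ?R by (rule prob_space_requirements[OF a])
  interpret SC: pair_prob_space ?R ?C ..
  interpret TSC: pair_prob_space ?T "?R \<Otimes>\<^sub>M ?C" ..
  interpret ATSC: pair_prob_space ?A "?T \<Otimes>\<^sub>M (?R \<Otimes>\<^sub>M ?C)" ..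
  show "prob_space (mark_law K d lam mu x j)"
    unfolding mark_law_def by (rule ATSC.prob_space_axioms)
  have f1: "(\<lambda>y. y - (if j < start_number x then start_attained x j s else 0)) \<in> requirement_law mu x j s \<rightarrow>\<^sub>M exp_law mu" for s
    by (subst measurable_cong_sets[OF sets_requirement_law sets_exp_law]) simp
  have R: "distr ?R ?R' ?f = ?R'"
    by (rule distr_PiM_componentwise[OF prob_space_requirement_law[OF a] distr_requirement_law[OF a] f1])
  have fm: "?f \<in> ?R \<rightarrow>\<^sub>M ?R'"
  proof (rule measurable_PiM_single')
    show "(\<lambda>r. ?f r s) \<in> ?R \<rightarrow>\<^sub>M exp_law mu" for s
      by (rule measurable_compose[where f="\<lambda>r. r s", OF measurable_component_singleton[OF UNIV_I] f1])
  qed auto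
  have "?R' \<Otimes>\<^sub>M ?C = distr ?R ?R' ?f \<Otimes>\<^sub>M distr ?C ?C (\<lambda>u. u)" by (simp add: R)
  also have "\<dots> = distr (?R \<Otimes>\<^sub>M ?C) (?R' \<Otimes>\<^sub>M ?C) (\<lambda>(r, u). (?f r, u))"
    using fm C.sigma_finite_measure_axioms by (intro pair_measure_distr) simp_all
  finally have RC: "distr (?R \<Otimes>\<^sub>M ?C) (?R' \<Otimes>\<^sub>M ?C) (\<lambda>(r, u). (?f r, u)) = ?R' \<Otimes>\<^sub>M ?C" by simp
  have rcm: "(\<lambda>(r, u). (?f r, u)) \<in> ?R \<Otimes>\<^sub>M ?C \<rightarrow>\<^sub>M ?R' \<Otimes>\<^sub>M ?C"
    using fm by measurable
  have "?T \<Otimes>\<^sub>M (?R' \<Otimes>\<^sub>M ?C) = distr ?T ?T (\<lambda>c. c) \<Otimes>\<^sub>M distr (?R \<Otimes>\<^sub>M ?C) (?R' \<Otimes>\<^sub>M ?C) (\<lambda>(r, u). (?f r, u))"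
    by (simp add: RC)
  also have "\<dots> = distr (?T \<Otimes>\<^sub>M (?R \<Otimes>\<^sub>M ?C)) (?T \<Otimes>\<^sub>M (?R' \<Otimes>\<^sub>M ?C)) (\<lambda>(c, p). (c, (\<lambda>(r, u). (?f r, u)) p))"
    using rcm RC.sigma_finite_measure_axioms by (intro pair_measure_distr) (simp_all add: RC)
  finally have TRC: "distr (?T \<Otimes>\<^sub>M (?R \<Otimes>\<^sub>M ?C)) (?T \<Otimes>\<^sub>M (?R' \<Otimes>\<^sub>M ?C)) (\<lambda>(c, p). (c, (\<lambda>(r, u). (?f r, u)) p)) = ?T \<Otimes>\<^sub>M (?R' \<Otimes>\<^sub>M ?C)"
    by simp
  have trcm: "(\<lambda>(c, p). (c, (\<lambda>(r, u). (?f r, u)) p)) \<in> ?T \<Otimes>\<^sub>M (?R \<Otimes>\<^sub>M ?C) \<rightarrow>\<^sub>M ?T \<Otimes>\<^sub>M (?R' \<Otimes>\<^sub>M ?C)"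
    using rcm by measurable
  have "fresh_mark = distr ?A ?A (\<lambda>a. a) \<Otimes>\<^sub>M distr (?T \<Otimes>\<^sub>M (?R \<Otimes>\<^sub>M ?C)) (?T \<Otimes>\<^sub>M (?R' \<Otimes>\<^sub>M ?C)) (\<lambda>(c, p). (c, (\<lambda>(r, u). (?f r, u)) p))"
    by (simp add: TRC fresh_mark_def)
  also have "\<dots> = distr (mark_law K d lam mu x j) fresh_mark (\<lambda>(a, q). (a, (\<lambda>(c, p). (c, (\<lambda>(r, u). (?f r, u)) p)) q))"
    unfolding mark_law_def fresh_mark_def
    using trcm TRC.sigma_finite_measure_axioms by (intro pair_measure_distr) (simp_all add: TRC)
  also have "(\<lambda>(a, q). (a, (\<lambda>(c, p). (c, (\<lambda>(r, u). (?f r, u)) p)) q)) = strip_mark x j"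
    by (auto simp: fun_eq_iff strip_mark_def)
  finally show "distr (mark_law K d lam mu x j) fresh_mark (strip_mark x j) = fresh_mark" by simp
qed

text \<open>
  Jobs present at time 0 have requirements conditioned to exceed the attained service, so their
  residuals are exponential; all other coordinates are untouched.
\<close>

lemma distr_strip:
  assumes x: "x \<in> descriptors pol K d"
  shows "distr (input_law K d lam mu x) fresh_law (strip x) = fresh_law"
proof -
  have a: "0 \<le> start_attained x j s" for j s using x by (simp add: descriptors_def)
  have m: "strip_mark x j \<in> mark_law K d lam mu x j \<rightarrow>\<^sub>M fresh_mark" for j
    using measurable_strip_mark by (subst measurable_cong_sets[OF sets_mark_law refl])
  have "strip x = (\<lambda>w j. strip_mark x j (w j))"
    by (simp add: strip_def strip_mark_def fun_eq_iff)
  then show ?thesis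
    unfolding input_law_def fresh_law_def
    using distr_PiM_componentwise[OF mark_law_strip(1)[OF a] mark_law_strip(2)[OF a] m] by simp
qed

subsection \<open>Paths of the chain\<close>

text \<open>
  The sojourn is attained by some clock, so an event that is not an arrival completes at least one
  copy. Every step therefore changes the population, and a path leaves its initial population at once.
\<close>

lemma counts_follow:
  assumes z: "z \<in> configs" and t: "drawn_type (w (upcoming z)) \<in> job_types K d"
  shows "counts (follow z w) \<noteq> counts z"
proof (cases "sojourn z w = interarrival (w (upcoming z))")
  case True
  then have "follow z w = admit z (drawn_type (w (upcoming z)))" by (simp add: follow_def)
  then show ?thesis by (auto simp: counts_admit[OF z] fun_eq_iff)
next
  case False
  let ?D = "finished z w"
  have f: "follow z w = discharge z ?D (\<lambda>j. choice_var (w j))" using False by (simp add: follow_def)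
  have "sojourn z w \<in> (\<lambda>k. ring_time z k w) ` clocks z"
    unfolding sojourn_def by (rule Min_in) (auto simp: finite_clocks[OF z], simp add: clocks_def)
  then obtain k where k: "k \<in> clocks z" "sojourn z w = ring_time z k w" by blast
  have "k \<noteq> None"
  proof
    assume "k = None"
    then show False using False k(2) by (simp add: ring_time_def level_def drain_def)
  qed
  then obtain j s where js: "k = Some (j, s)" by (metis not_None_eq surj_pair)
  then have jD: "j \<in> ?D" using k by (auto simp: finished_def clocks_def)
  let ?c = "kind z j"
  have "{i \<in> set (jobs (follow z w)). kind (follow z w) i = ?c} \<subset> {i \<in> set (jobs z). kind z i = ?c}"
    using jD finished_subset[of z w] unfolding f by (auto simp: discharge_def)
  then have "counts (follow z w) ?c < counts z ?c"
    unfolding counts_def by (rule psubset_card_mono[rotated]) simp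
  then show ?thesis by auto
qed

lemma path_cost_chain:
  "(\<And>i. i < n \<Longrightarrow> counts (fst (chain i p)) \<noteq> N) \<Longrightarrow>
    path_cost N (Suc n) (fst p) (snd p) = (\<Sum>i\<le>n. cost (fst (chain i p)) (snd (chain i p)))"
proof (induction n arbitrary: p)
  case 0
  then show ?case by simp
next
  case (Suc n)
  have "path_cost N (Suc n) (fst (advance p)) (snd (advance p)) = (\<Sum>i\<le>n. cost (fst (chain i (advance p))) (snd (chain i (advance p))))"
    using Suc.prems[of "Suc i" for i] by (intro Suc.IH) (simp add: chain_Suc'[symmetric])
  moreover have "counts (fst p) \<noteq> N" using Suc.prems[of 0] by simp
  ultimately show ?case
    by (simp add: sum.atMost_Suc_shift chain_Suc' advance_def del: path_cost.simps(2) sum.atMost_Suc) (simp add: advance_def)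
qed

lemma cost_ge_1: "1 \<le> cost z w"
  by (simp add: cost_def)

lemma cost_finite: "cost z w < \<infinity> \<Longrightarrow> 0 < sojourn z w \<and> ennreal (sojourn z w) \<le> cost z w"
  by (auto simp: cost_def split: if_splits)

text \<open>
  Each step costs at least 1, so finite cost forces a hit.
\<close>

lemma path_cost_hits:
  assumes fin: "(SUP n. path_cost N n (fst p) (snd p)) < \<infinity>"
  obtains m where "counts (fst (chain m p)) = N"
    and "(\<Sum>i\<le>m. cost (fst (chain i p)) (snd (chain i p))) \<le> (SUP n. path_cost N n (fst p) (snd p))"
proof -
  have "\<exists>m. counts (fst (chain m p)) = N"
  proof (rule ccontr)
    assume "\<not> ?thesis"
    then have no: "counts (fst (chain i p)) \<noteq> N" for i by blast
    have "of_nat n \<le> (SUP n. path_cost N n (fst p) (snd p))" for n :: nat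
    proof -
      have "of_nat n \<le> (\<Sum>i\<le>n. 1::ennreal)" by simp
      also have "\<dots> \<le> (\<Sum>i\<le>n. cost (fst (chain i p)) (snd (chain i p)))" by (intro sum_mono cost_ge_1)
      also have "\<dots> = path_cost N (Suc n) (fst p) (snd p)" by (rule path_cost_chain[symmetric]) (rule no)
      also have "\<dots> \<le> (SUP n. path_cost N n (fst p) (snd p))" by (rule SUP_upper) simp
      finally show ?thesis .
    qed
    then have "(SUP n. of_nat n :: ennreal) \<le> (SUP n. path_cost N n (fst p) (snd p))" by (rule SUP_least)
    then have "\<infinity> \<le> (SUP n. path_cost N n (fst p) (snd p))"
      unfolding ennreal_SUP_of_nat_eq_top infinity_ennreal_def .
    with fin show False by (meson not_less)
  qed
  then have ex: "\<exists>m. counts (fst (chain m p)) = N" .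
  define m where "m = (LEAST m. counts (fst (chain m p)) = N)"
  have m: "counts (fst (chain m p)) = N" "\<And>i. i < m \<Longrightarrow> counts (fst (chain i p)) \<noteq> N"
    using LeastI_ex[OF ex] not_less_Least unfolding m_def by blast+
  have "(\<Sum>i\<le>m. cost (fst (chain i p)) (snd (chain i p))) = path_cost N (Suc m) (fst p) (snd p)"
    by (rule path_cost_chain[symmetric]) (rule m(2))
  also have "\<dots> \<le> (SUP n. path_cost N n (fst p) (snd p))" by (rule SUP_upper) simp
  finally show thesis by (rule that[OF m(1)])
qed

text \<open>
  The first step is taken unconditionally: the initial population is the target, and the path must
  leave it before it can return.
\<close>

definition excursion_cost :: "config \<times> (nat \<Rightarrow> mark) \<Rightarrow> ennreal" where
  "excursion_cost p = cost (fst p) (snd p) +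
     (SUP n. path_cost (counts (fst p)) n (fst (advance p)) (snd (advance p)))"

lemma elapsed_Suc: "elapsed (Suc i) p = elapsed i p + sojourn (fst (chain i p)) (snd (chain i p))"
  by (simp add: elapsed_def)

text \<open>
  If the cost is finite, all steps up to the hit have positive duration. The epochs are then strictly
  increasing, so the path shows the population of each of these steps at its epoch: a different one
  after the first step, the initial one at the hit.
\<close>

theorem return_time_le_excursion_cost:
  assumes z: "fst p \<in> configs" and t: "drawn_type (snd p (upcoming (fst p))) \<in> job_types K d"
  defines "Y \<equiv> \<lambda>t. counts (fst (chain (LEAST i. t < elapsed (Suc i) p) p))"
  shows "return_time Y \<le> excursion_cost p"
proof (cases "excursion_cost p < \<infinity>")
  case False
  then show ?thesis by (simp add: less_top[symmetric])
next
  case True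
  let ?N = "counts (fst p)" and ?S = "SUP n. path_cost (counts (fst p)) n (fst (advance p)) (snd (advance p))"
  let ?c = "\<lambda>i. cost (fst (chain i p)) (snd (chain i p))"
  have S: "?S < \<infinity>" and c0: "cost (fst p) (snd p) < \<infinity>"
    using True by (auto simp: excursion_cost_def)
  obtain m where m: "counts (fst (chain m (advance p))) = ?N"
    "(\<Sum>i\<le>m. cost (fst (chain i (advance p))) (snd (chain i (advance p)))) \<le> ?S"
    using path_cost_hits[OF S] by blast
  have hit: "counts (fst (chain (Suc m) p)) = ?N" using m(1) by (simp add: chain_Suc')
  have le: "(\<Sum>i\<le>Suc m. ?c i) \<le> excursion_cost p"
    using m(2) unfolding sum.atMost_Suc_shift excursion_cost_def by (simp add: chain_Suc' add_left_mono)
  have fin: "?c i < \<infinity>" if "i \<le> Suc m" for i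
  proof -
    have "?c i \<le> (\<Sum>i\<le>Suc m. ?c i)" using that by (intro member_le_sum) auto
    then show ?thesis using le True by (meson order_le_less_trans)
  qed
  have pos: "0 < sojourn (fst (chain i p)) (snd (chain i p))" if "i \<le> Suc m" for i
    using cost_finite[OF fin[OF that]] by blast
  have mono: "elapsed i p < elapsed k p" if "i < k" "k \<le> Suc (Suc m)" for i k
    using that
  proof (induction k)
    case (Suc k)
    have "elapsed k p < elapsed (Suc k) p" using pos[of k] Suc.prems by (simp add: elapsed_Suc)
    then show ?case using Suc by (cases "i = k") auto
  qed simp
  have at: "(LEAST k. elapsed i p < elapsed (Suc k) p) = i" if i: "i \<le> Suc m" for i
  proof (rule Least_equality)
    show "elapsed i p < elapsed (Suc i) p" using i by (intro mono) auto
    fix k assume k: "elapsed i p < elapsed (Suc k) p"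
    show "i \<le> k"
    proof (rule ccontr)
      assume "\<not> i \<le> k"
      then have "elapsed (Suc k) p \<le> elapsed i p"
        using i mono[of "Suc k" i] by (cases "Suc k = i") auto
      with k show False by simp
    qed
  qed
  have Y: "Y (elapsed i p) = counts (fst (chain i p))" if "i \<le> Suc m" for i
    by (simp add: Y_def at[OF that])
  have zero: "elapsed 0 p = 0" by (simp add: elapsed_def)
  have Y0: "Y 0 = ?N" using Y[of 0] by (simp add: zero)
  have neq: "counts (fst (chain 1 p)) \<noteq> ?N"
    using counts_follow[OF z, of "snd p"] t by (simp add: chain_Suc advance_def)
  then have m1: "1 \<le> m" using hit by (cases m) auto
  have "return_time Y \<le> ennreal (elapsed (Suc m) p)"
    unfolding return_time_def
  proof (rule INF_lower, rule CollectI, intro exI conjI)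
    show "0 \<le> elapsed 1 p" using mono[of 0 1] by (simp add: zero)
    show "elapsed 1 p < elapsed (Suc m) p" using m1 by (intro mono) auto
    show "Y (elapsed 1 p) \<noteq> Y 0" using neq m1 by (simp add: Y Y0)
    show "Y (elapsed (Suc m) p) = Y 0" using hit by (simp add: Y Y0)
  qed
  also have "\<dots> = (\<Sum>i<Suc m. ennreal (sojourn (fst (chain i p)) (snd (chain i p))))"
    unfolding elapsed_def using pos by (intro sum_ennreal[symmetric]) (simp add: less_imp_le)
  also have "\<dots> \<le> (\<Sum>i<Suc m. ?c i)"
    using cost_finite[OF fin] by (intro sum_mono) simp
  also have "\<dots> \<le> (\<Sum>i\<le>Suc m. ?c i)" by (intro sum_mono2) auto
  also have "\<dots> \<le> excursion_cost p" by (rule le)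
  finally show ?thesis .
qed

lemma path_cost_mono: "path_cost N n z w \<le> path_cost N (Suc n) z w"
proof (induction n arbitrary: z w)
  case (Suc n)
  then show ?case by (simp add: add_left_mono)
qed simp

text \<open>
  The Markov property replaces the path after the first step by a path with fresh input, whose mean
  cost \<open>hitting_bound\<close> controls uniformly in the truncation; monotone convergence removes the latter.
\<close>

lemma nn_integral_excursion_cost:
  assumes load: "lam < mu * real K" and z: "valid z"
  shows "(\<bbbE>w. excursion_cost (z, w)) < \<infinity>"
proof -
  note zc = valid_configs[OF z]
  define cs where "cs = map (kind z) (jobs z)"
  have cs: "set cs \<subseteq> job_types K d" using kind_type[OF zc] by (auto simp: cs_def)
  have N: "count_list cs = counts z"
  proof
    fix c
    have d: "distinct (jobs z)" using zc by (simp add: configs_def)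
    have "count_list cs c = length (filter (\<lambda>j. kind z j = c) (jobs z))"
      unfolding cs_def by (induction "jobs z") (auto simp: count_list_eq_length_filter filter_map o_def eq_commute)
    also have "\<dots> = card (set (filter (\<lambda>j. kind z j = c) (jobs z)))"
      using d by (intro distinct_card[symmetric]) simp
    finally show "count_list cs c = counts z c" by (simp add: counts_def)
  qed
  obtain V where V: "\<And>y. valid y \<Longrightarrow> jump V y < \<infinity>"
    "\<And>y n. valid y \<Longrightarrow> (\<bbbE>w. path_cost (counts z) n y w) \<le> V y"
    using hitting_bound[OF load cs] unfolding N by metis
  let ?P = "\<lambda>n w. path_cost (counts z) n (follow z w) (elapse z (sojourn z w) w)"
  have m: "?P n \<in> borel_measurable fresh_law" for n
    by (rule measurable_config_compose[OF measurable_path_cost measurable_follow[OF zc] measurable_after_elapse[OF zc]])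
  have P: "(\<bbbE>w. ?P n w) \<le> jump V z" for n
    unfolding markov_property[OF observable_path_cost zc]
    by (rule jump_mono_valid[OF z]) (rule V(2))
  have "(\<bbbE>w. excursion_cost (z, w)) = (\<bbbE>w. cost z w) + (\<bbbE>w. (SUP n. ?P n w))"
    unfolding excursion_cost_def advance_def fst_conv snd_conv
    using m measurable_cost[OF zc] by (intro nn_integral_add) auto
  also have "(\<bbbE>w. (SUP n. ?P n w)) = (SUP n. \<integral>\<^sup>+w. ?P n w \<partial>fresh_law)"
    by (rule nn_integral_monotone_convergence_SUP) (auto intro!: incseq_SucI path_cost_mono m simp: le_fun_def simp del: path_cost.simps)
  also have "(\<bbbE>w. cost z w) + (SUP n. \<integral>\<^sup>+w. ?P n w \<partial>fresh_law) \<le> (ennreal (1 / lam) + 1) + jump V z"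
    by (intro add_mono nn_integral_cost[OF zc] SUP_least P)
  also have "\<dots> < \<infinity>" using V(1)[OF z] by simp
  finally show ?thesis .
qed

subsection \<open>Measurability\<close>

lemma measurable_chain:
  assumes z: "z \<in> configs"
  shows "(\<lambda>w. fst (chain i (z, w))) \<in> fresh_law \<rightarrow>\<^sub>M count_space configs \<and>
         (\<lambda>w. snd (chain i (z, w))) \<in> fresh_law \<rightarrow>\<^sub>M fresh_law"
proof (induction i)
  case 0
  then show ?case using z by simp
next
  case (Suc i)
  then show ?case
    unfolding chain_Suc advance_def fst_conv snd_conv
    by (auto intro: measurable_config_compose[OF measurable_follow] measurable_config_compose[OF measurable_after_elapse])
qed

lemma measurable_elapsed:
  assumes z: "z \<in> configs" shows "(\<lambda>w. elapsed i (z, w)) \<in> borel_measurable fresh_law"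
  unfolding elapsed_def
  using measurable_chain[OF z]
  by (intro borel_measurable_sum measurable_config_compose[OF measurable_sojourn]) auto

text \<open>
  The bound \<open>elapsed (Suc i) p\<close> that selects the index at \<open>t\<close> also selects it shortly after \<open>t\<close>. If no
  index qualifies at \<open>t\<close>, none does later, and the description operator returns the same value.
\<close>

lemma right_constant_chain:
  "right_constant (\<lambda>t. counts (fst (chain (LEAST i. t < elapsed (Suc i) p) p)))"
  unfolding right_constant_def
proof
  fix t
  let ?L = "\<lambda>t. LEAST i. t < elapsed (Suc i) p"
  have "\<exists>e>0. \<forall>t'. t \<le> t' \<and> t' < t + e \<longrightarrow> ?L t' = ?L t"
  proof (cases "\<exists>i. t < elapsed (Suc i) p")
    case True
    then have i: "t < elapsed (Suc (?L t)) p" by (rule LeastI_ex)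
    have *: "?L t' = ?L t" if "t \<le> t'" "t' < t + (elapsed (Suc (?L t)) p - t)" for t'
    proof (rule Least_equality)
      show "t' < elapsed (Suc (?L t)) p" using that by simp
      fix k assume "t' < elapsed (Suc k) p"
      then have "t < elapsed (Suc k) p" using that by simp
      then show "?L t \<le> k" by (rule Least_le)
    qed
    have "0 < elapsed (Suc (?L t)) p - t" using i by simp
    then show ?thesis using * by blast
  next
    case False
    have "?L t' = ?L t" if "t \<le> t'" for t'
    proof -
      have "(\<lambda>i. t' < elapsed (Suc i) p) = (\<lambda>i. t < elapsed (Suc i) p)"
        using False that by (meson order_le_less_trans)
      then show ?thesis by simp
    qed
    then show ?thesis using zero_less_one by blast
  qed
  then show "\<exists>e>0. \<forall>t'. t \<le> t' \<and> t' < t + e \<longrightarrow> counts (fst (chain (?L t') p)) = counts (fst (chain (?L t) p))"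
    by metis
qed

lemma pred_counts_chain:
  assumes z: "z \<in> configs"
  shows "Measurable.pred fresh_law (\<lambda>w. counts (fst (chain (LEAST i. t < elapsed (Suc i) (z, w)) (z, w))) =
     counts (fst (chain (LEAST i. t' < elapsed (Suc i) (z, w)) (z, w))))"
proof -
  have L: "(\<lambda>w. LEAST i. t < elapsed (Suc i) (z, w)) \<in> fresh_law \<rightarrow>\<^sub>M count_space UNIV" for t
    using measurable_elapsed[OF z] by (intro measurable_Least) measurable
  have c: "(\<lambda>w. fst (chain (LEAST i. t < elapsed (Suc i) (z, w)) (z, w))) \<in> fresh_law \<rightarrow>\<^sub>M count_space configs" for t
    by (rule measurable_compose_countable[OF _ L]) (use measurable_chain[OF z] in blast)
  have "(\<lambda>w. (\<lambda>a w. counts a = counts (fst (chain (LEAST i. t' < elapsed (Suc i) (z, w)) (z, w))))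
      (fst (chain (LEAST i. t < elapsed (Suc i) (z, w)) (z, w))) w) \<in> fresh_law \<rightarrow>\<^sub>M count_space UNIV"
    by (rule measurable_compose_countable'[OF _ c countable_configs]) (rule measurable_compose[OF c], simp)
  then show ?thesis by simp
qed

subsection \<open>Positive recurrence\<close>

theorem stable:
  assumes load: "lam < mu * real K"
  shows "system_stable pol K d lam mu"
  unfolding system_stable_def positive_recurrent_def
proof (intro ballI conjI)
  fix x assume x: "x \<in> descriptors pol K d"
  let ?P = "input_law K d lam mu x"
  let ?Y = "\<lambda>w t. counts (fst (chain (LEAST i. t < elapsed (Suc i) (start x, w)) (start x, w)))"
  note v = valid_start[OF x] and zc = valid_configs[OF valid_start[OF x]]
  have sp: "space ?P = space fresh_law" by (rule sets_eq_imp_space_eq[OF sets_input_law])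
  have strip: "strip x \<in> ?P \<rightarrow>\<^sub>M fresh_law"
    using measurable_strip by (subst measurable_cong_sets[OF sets_input_law refl])
  have eq: "job_counts pol x w = ?Y (strip x w)" if "w \<in> space ?P" for w
    using that drawn_type_space unfolding sp by (intro ext job_counts_chain[OF _ x]) auto
  have m: "(\<lambda>w. return_time (?Y w)) \<in> borel_measurable fresh_law"
    by (rule measurable_return_time[OF right_constant_chain pred_counts_chain[OF zc]])
  have "(\<lambda>w. return_time (?Y (strip x w))) \<in> borel_measurable ?P"
    by (rule measurable_compose[OF strip m])
  then show "(\<lambda>w. return_time (job_counts pol x w)) \<in> borel_measurable ?P"
    by (rule measurable_cong[THEN iffD1, rotated]) (simp add: eq)
  have "(\<integral>\<^sup>+w. return_time (job_counts pol x w) \<partial>?P) = (\<integral>\<^sup>+w. return_time (?Y (strip x w)) \<partial>?P)"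
    by (rule nn_integral_cong) (simp add: eq)
  also have "\<dots> = (\<integral>\<^sup>+w. return_time (?Y w) \<partial>distr ?P fresh_law (strip x))"
    by (subst nn_integral_distr[OF strip]) (simp_all add: m)
  also have "\<dots> = (\<bbbE>w. return_time (?Y w))"
    unfolding distr_strip[OF x] ..
  also have "\<dots> \<le> (\<bbbE>w. excursion_cost (start x, w))"
    using return_time_le_excursion_cost[of "(start x, w)" for w] zc drawn_type_space
    by (intro nn_integral_mono) auto
  also have "\<dots> < \<infinity>" by (rule nn_integral_excursion_cost[OF load v])
  finally show "(\<integral>\<^sup>+w. return_time (job_counts pol x w) \<partial>?P) < \<infinity>" .
qed

end

theorem proposition3:
  fixes K d :: nat and lam mu :: real
  assumes "1 \<le> d" and "d \<le> K"
    and "0 < lam" and "0 < mu"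
    and "total_load K lam mu < 1"
  shows "system_stable PS K d lam mu \<and> system_stable ROS K d lam mu"
proof -
  have "0 < mu * real K" using assms by simp
  then have load: "lam < mu * real K"
    using assms(5) by (simp add: total_load_def divide_less_eq)
  interpret PS: redundancy PS K d lam mu by unfold_locales (use assms in auto)
  interpret ROS: redundancy ROS K d lam mu by unfold_locales (use assms in auto)
  show ?thesis using PS.stable[OF load] ROS.stable[OF load] by blast
qed

end
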